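(* Let $W=W(D_n)$ with $n\ge4$, realized as the group of signed permutations of $\{\pm1,\dots,\pm n\}$ with an even number of sign changes. For a double partition $\lambda=(\lambda^1,\lambda^2)$ of $n$, partition $\{1,\dots,n\}$ into consecutive blocks whose sizes are the parts of $\lambda^1$ and then of $\lambda^2$, and let $W_\lambda=\prod_i W(A_{\lambda^1_i-1})\times\prod_i W(D_{\lambda^2_i})$ be the product of $\mathfrak{S}_I$ over blocks $I$ of $\lambda^1$ and $D_I$ over blocks $I$ of $\lambda^2$. For an even partition $\lambda$ of $n$, let $W^+_\lambda=\prod_i W(A_{\lambda_i-1})$ be the product of $\mathfrak{S}_I$ over the blocks $I$ of $\lambda$, and $W^-_\lambda=tW^+_\lambda t^{-1}$ where $t=(1\,-1)$ is the sign change of the first coordinate. Then: (1) if $n$ is odd, $\{W_\lambda\mid \lambda \text{ a double partition of } n,\ \lambda^2>1\}$ is a set of representatives of the $W$-conjugacy classes of reflection subgroups of $W$; if $n$ is even, such a set of representatives is $\{W_\lambda\mid \lambda \text{ a double partition of } n,\ \lambda^2>1,\ \text{and } \lambda^1 \text{ non-even if } \lambda^2=\emptyset\}\cup\{W^{\pm}_\lambda\mid \lambda \text{ an even partition of } n\}$; (2) the parabolic closure of $W_\lambda$ is of type $W(D_{n-m})\times\prod_iW(A_{\lambda^1_i-1})$, where $\lambda^1$ is a partition of $m$, and the parabolic closure of $W^\epsilon_\lambda$ is $W^\epsilon_\lambda$ itself; (3) the Coxeter elements of $W_\lambda$ have cycle type $(\lambda^1,(\lambda^2-1)\cup1^{\ell(\lambda^2)})$,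 and the Coxeter elements of $W^+_\lambda$ and of $W^-_\lambda$ lie in the two distinct $W$-conjugacy classes $(\lambda,+)$ and $(\lambda,-)$ of elements of cycle type $(\lambda,\emptyset)$, respectively; (4) in particular, the map $\gamma\colon\mathcal{R}\to\mathcal{C}$ is injective but not surjective.
   Context: Partitions: $\lambda=(\lambda_1\ge\dots\ge\lambda_k>0)$, $\ell(\lambda)=k$, $\emptyset$ the empty partition; a partition is even if all its parts are even; $\lambda^1\cup\lambda^2$ has the parts of both; $\lambda-1$ subtracts $1$ from each part; $\lambda>1$ means all parts exceed $1$ (vacuous for $\emptyset$); $1^k$ has $k$ parts equal to $1$; a double partition of $n$ is a pair $(\lambda^1,\lambda^2)$ of partitions with $\lambda^1\cup\lambda^2$ a partition of $n$. For $I\subseteq\{1,\dots,n\}$, $\mathfrak{S}_I$ is the group of permutations of $I$ (signed permutations without sign changes, generated by $(i\,j)(-i\,-j)$, $i,j\in I$) and $D_I$ is the group of signed permutations of $\pm I$ with an even number of sign changes (generated by $(i\,j)(-i\,-j)$ and $(i\,-j)(-i\,j)$, $i,j\in I$). Reflections of $W$ are $(i\,j)(-i\,-j)$ and $(i\,-j)(-i\,j)$, $i\ne j$; a reflection subgroup is generated by reflections. Cycle type: for a signed permutation $w$, a cycle of $w$ on the lines $\langle e_i\rangle$ is negative if an odd number of the $e_i$ in it are sent to negatives, positive otherwise; the cycle type is $(\lambda^1,\lambda^2)$ with $\lambda^1$ the lengths of positive and $\lambda^2$ of negative cycles. Elements of $W(B_n)$ of cycle type $(\lambda^1,\lambda^2)$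 lie in $W(D_n)$ iff $\ell(\lambda^2)$ is even, and form a single $W(D_n)$-class unless $\lambda^2=\emptyset$ and $\lambda^1$ is even, in which case they form two $W(D_n)$-classes, labelled $(\lambda^1,+)$ and $(\lambda^1,-)$. Parabolic closure of $X\subseteq W$: the pointwise stabilizer in $W$ of the fixed-point space of $X$ in $\mathbb{R}^n$. A Coxeter element of a reflection subgroup $R$ is a product, in some order, of a Coxeter generating set of $R$. $\gamma$ maps the class of a reflection subgroup $R$ to the $W$-class of a Coxeter element of $R$; $\mathcal{R}$, $\mathcal{C}$ are the sets of conjugacy classes of reflection subgroups and of elements of $W$. *)

theory Defs
  imports Complex_Main "HOL-Library.Multiset"
begin

definition signed_perm :: "nat \<Rightarrow> (int \<Rightarrow> int) \<Rightarrow> bool" where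
  "signed_perm n w \<longleftrightarrow> bij w \<and> (\<forall>i. w (- i) = - w i) \<and>
     (\<forall>i. \<not> (1 \<le> \<bar>i\<bar> \<and> \<bar>i\<bar> \<le> int n) \<longrightarrow> w i = i)"

definition WD :: "nat \<Rightarrow> (int \<Rightarrow> int) set" where
  "WD n = {w. signed_perm n w \<and> even (card {i \<in> {1..int n}. w i < 0})}"

definition tp :: "int \<Rightarrow> int \<Rightarrow> int \<Rightarrow> int" where
  "tp i j k = (if k = i then j else if k = j then i
               else if k = - i then - j else if k = - j then - i else k)"

definition reflections :: "nat \<Rightarrow> (int \<Rightarrow> int) set" where
  "reflections n = {tp i j | i j. i \<in> {1..int n} \<and> j \<in> {1..int n} \<and> i \<noteq> j}
                 \<union> {tp i (- j) | i j. i \<in> {1..int n} \<and> j \<in> {1..int n} \<and> i \<noteq> j}"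

inductive_set gen :: "(int \<Rightarrow> int) set \<Rightarrow> (int \<Rightarrow> int) set" for X where
  gen_id: "id \<in> gen X"
| gen_mult: "x \<in> X \<Longrightarrow> g \<in> gen X \<Longrightarrow> x \<circ> g \<in> gen X"
| gen_inv: "x \<in> X \<Longrightarrow> g \<in> gen X \<Longrightarrow> inv x \<circ> g \<in> gen X"

definition refl_subgroup :: "nat \<Rightarrow> (int \<Rightarrow> int) set \<Rightarrow> bool" where
  "refl_subgroup n H \<longleftrightarrow> (\<exists>X. X \<subseteq> reflections n \<and> H = gen X)"

definition conj :: "(int \<Rightarrow> int) \<Rightarrow> (int \<Rightarrow> int) \<Rightarrow> (int \<Rightarrow> int)" where
  "conj g h = g \<circ> h \<circ> inv g"

definition conj_sub :: "nat \<Rightarrow> (int \<Rightarrow> int) set \<Rightarrow> (int \<Rightarrow> int) set \<Rightarrow> bool" where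
  "conj_sub n H K \<longleftrightarrow> (\<exists>g \<in> WD n. K = conj g ` H)"

definition conj_el :: "nat \<Rightarrow> (int \<Rightarrow> int) \<Rightarrow> (int \<Rightarrow> int) \<Rightarrow> bool" where
  "conj_el n x y \<longleftrightarrow> (\<exists>g \<in> WD n. y = conj g x)"

definition is_reps :: "nat \<Rightarrow> (int \<Rightarrow> int) set set \<Rightarrow> bool" where
  "is_reps n Reps \<longleftrightarrow> (\<forall>H \<in> Reps. refl_subgroup n H) \<and>
     (\<forall>H. refl_subgroup n H \<longrightarrow> (\<exists>K \<in> Reps. conj_sub n H K)) \<and>
     (\<forall>H \<in> Reps. \<forall>K \<in> Reps. conj_sub n H K \<longrightarrow> H = K)"

definition is_partition :: "nat list \<Rightarrow> bool" where
  "is_partition l \<longleftrightarrow> sorted_wrt (\<lambda>x y. y \<le> x) l \<and> (\<forall>x \<in> set l. 0 < x)"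

definition partition_of :: "nat \<Rightarrow> nat list \<Rightarrow> bool" where
  "partition_of n l \<longleftrightarrow> is_partition l \<and> sum_list l = n"

definition double_partition :: "nat \<Rightarrow> nat list \<times> nat list \<Rightarrow> bool" where
  "double_partition n lam \<longleftrightarrow> is_partition (fst lam) \<and> is_partition (snd lam) \<and>
     sum_list (fst lam) + sum_list (snd lam) = n"

definition even_part :: "nat list \<Rightarrow> bool" where
  "even_part l \<longleftrightarrow> (\<forall>x \<in> set l. even x)"

definition gt1 :: "nat list \<Rightarrow> bool" where
  "gt1 l \<longleftrightarrow> (\<forall>x \<in> set l. 1 < x)"

fun blocks :: "nat \<Rightarrow> nat list \<Rightarrow> int set list" where
  "blocks s [] = []"
| "blocks s (a # as) = {int s + 1 .. int (s + a)} # blocks (s + a) as"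

definition A_gens :: "int set \<Rightarrow> (int \<Rightarrow> int) set" where
  "A_gens I = {tp i j | i j. i \<in> I \<and> j \<in> I \<and> i \<noteq> j}"

definition D_gens :: "int set \<Rightarrow> (int \<Rightarrow> int) set" where
  "D_gens I = A_gens I \<union> {tp i (- j) | i j. i \<in> I \<and> j \<in> I \<and> i \<noteq> j}"

definition Wlam :: "nat list \<times> nat list \<Rightarrow> (int \<Rightarrow> int) set" where
  "Wlam lam = gen ((\<Union>I \<in> set (blocks 0 (fst lam)). A_gens I) \<union>
                   (\<Union>I \<in> set (blocks (sum_list (fst lam)) (snd lam)). D_gens I))"

definition Wplus :: "nat list \<Rightarrow> (int \<Rightarrow> int) set" where
  "Wplus l = gen (\<Union>I \<in> set (blocks 0 l). A_gens I)"

definition tsign :: "int \<Rightarrow> int" where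
  "tsign k = (if k = 1 then -1 else if k = -1 then 1 else k)"

definition Wminus :: "nat list \<Rightarrow> (int \<Rightarrow> int) set" where
  "Wminus l = conj tsign ` Wplus l"

definition sext :: "(nat \<Rightarrow> real) \<Rightarrow> int \<Rightarrow> real" where
  "sext v i = (if 0 < i then v (nat i) else - v (nat (- i)))"

text \<open>w e_i = sgn(w i) e_|w i|; so w v = v iff v_i = sext v (w i) for all i.\<close>
definition fixes_vec :: "nat \<Rightarrow> (int \<Rightarrow> int) \<Rightarrow> (nat \<Rightarrow> real) \<Rightarrow> bool" where
  "fixes_vec n w v \<longleftrightarrow> (\<forall>i \<in> {1..n}. sext v (w (int i)) = v i)"

definition par_closure :: "nat \<Rightarrow> (int \<Rightarrow> int) set \<Rightarrow> (int \<Rightarrow> int) set" where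
  "par_closure n X = {w \<in> WD n. \<forall>v. (\<forall>x \<in> X. fixes_vec n x v) \<longrightarrow> fixes_vec n w v}"

definition eval_word :: "(int \<Rightarrow> int) list \<Rightarrow> (int \<Rightarrow> int)" where
  "eval_word ws = foldr (\<circ>) ws id"

definition elem_order :: "(int \<Rightarrow> int) \<Rightarrow> nat" where
  "elem_order g = (LEAST k. 0 < k \<and> g ^^ k = id)"

text \<open>Coxeter relators: (s t)^(m_st) with m_st the order of s t (for s = t this is s s).\<close>
definition cox_rels :: "(int \<Rightarrow> int) set \<Rightarrow> (int \<Rightarrow> int) list set" where
  "cox_rels S = {concat (replicate (elem_order (s \<circ> t)) [s, t]) | s t. s \<in> S \<and> t \<in> S}"

inductive cox_step :: "(int \<Rightarrow> int) set \<Rightarrow> (int \<Rightarrow> int) list \<Rightarrow> (int \<Rightarrow> int) list \<Rightarrow> bool"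
  for S where
  "r \<in> cox_rels S \<Longrightarrow> set u \<subseteq> S \<Longrightarrow> set v \<subseteq> S \<Longrightarrow> cox_step S (u @ r @ v) (u @ v)"

definition coxeter_gen_set :: "nat \<Rightarrow> (int \<Rightarrow> int) set \<Rightarrow> (int \<Rightarrow> int) set \<Rightarrow> bool" where
  "coxeter_gen_set n R S \<longleftrightarrow> S \<subseteq> reflections n \<and> gen S = R \<and>
     (\<forall>ws. set ws \<subseteq> S \<longrightarrow> eval_word ws = id \<longrightarrow> equivclp (cox_step S) ws [])"

definition coxeter_element :: "nat \<Rightarrow> (int \<Rightarrow> int) set \<Rightarrow> (int \<Rightarrow> int) \<Rightarrow> bool" where
  "coxeter_element n R c \<longleftrightarrow>
     (\<exists>S ws. coxeter_gen_set n R S \<and> distinct ws \<and> set ws = S \<and> c = eval_word ws)"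

definition line_orbit :: "(int \<Rightarrow> int) \<Rightarrow> nat \<Rightarrow> nat set" where
  "line_orbit w i = {nat \<bar>(w ^^ k) (int i)\<bar> | k. True}"

definition cycles :: "nat \<Rightarrow> (int \<Rightarrow> int) \<Rightarrow> nat set set" where
  "cycles n w = line_orbit w ` {1..n}"

definition neg_cycle :: "(int \<Rightarrow> int) \<Rightarrow> nat set \<Rightarrow> bool" where
  "neg_cycle w C \<longleftrightarrow> odd (card {j \<in> C. w (int j) < 0})"

definition cycle_type :: "nat \<Rightarrow> (int \<Rightarrow> int) \<Rightarrow> nat multiset \<times> nat multiset" where
  "cycle_type n w = (image_mset card (mset_set {C \<in> cycles n w. \<not> neg_cycle w C}),
                     image_mset card (mset_set {C \<in> cycles n w. neg_cycle w C}))"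

end

theory Submission
  imports Defs "HOL-Library.FuncSet"
begin

text \<open>
  A set of reflections is a signed graph on \<open>{1, \<dots>, n}\<close>, and the group it generates depends only
  on the connected components and on which of them contain a cycle of negative sign: after changing
  signs, a component \<open>I\<close> contributes \<open>\<SS>\<^sub>I\<close> if it is balanced and \<open>D\<^sub>I\<close> otherwise. This gives the
  classification under \<open>W(B\<^sub>n)\<close>, and a class splits under \<open>W(D\<^sub>n)\<close> precisely if the normalizer of the
  subgroup in \<open>W(B\<^sub>n)\<close> is contained in \<open>W(D\<^sub>n)\<close>, which happens if all components are balanced of
  even size.

  For a set \<open>S\<close> of reflections that is a Coxeter generating set, the geometric representation shows
  that no \<open>s \<in> S\<close> lies in the subgroup generated by the others, and that the graph of noncommuting
  pairs of \<open>S\<close> has no cycle, as the invariant form is positive definite. This forces each component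
  of the signed graph to be a path, with at most one doubled edge, located at an end. The product of
  the reflections along a simple path, in any order, is a positive cycle; the doubled edge splits
  off a negative cycle of length one. Hence the cycle type of a Coxeter element determines the sizes
  and the types of the components.
\<close>

section \<open>Signed permutations and generated subgroups\<close>

text \<open>A Coxeter generating set is given only through its presentation; nothing says that its
  elements are simple for some choice of positive roots, so its shape has to be extracted from the
  relations. The bridge to signed graphs is that distinct reflections fail to commute exactly when
  their edges share one vertex and no more; parallel edges of opposite sign commute. Three edges
  from a vertex to three others thus form a triangle of noncommuting pairs, a negative cycle on at
  least three vertices stays a cycle, and a doubled edge continued on both sides becomes a square.
  Acyclicity does not exclude two forks joined by a path, whose diagram is a tree; there one
  generator lies in the group of the others.

  Blocks are lists of signed integers: choosing the signs is the switching that makes the edges of a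
  balanced component positive, and the same lists serve as orbits, paths and signed cycles.
  Conjugacy under \<open>W(D\<^sub>n)\<close> is obtained from \<open>W(B\<^sub>n)\<close> by
  multiplying a conjugating element with a normalizing element that has an odd number of sign
  changes, whenever there is one.\<close>

definition WB :: "nat \<Rightarrow> (int \<Rightarrow> int) set" where
  "WB n = {w. signed_perm n w}"

definition pts :: "nat \<Rightarrow> int set" where
  "pts n = {x. 1 \<le> \<bar>x\<bar> \<and> \<bar>x\<bar> \<le> int n}"

text \<open>With signed arguments \<open>tp x y\<close> covers both kinds of reflections. The
  condition excludes \<open>tp x x\<close>, which is the identity, and \<open>tp x (- x)\<close>,
  which is a single sign change.\<close>

definition adm :: "int \<Rightarrow> int \<Rightarrow> bool" where
  "adm x y \<longleftrightarrow> x \<noteq> 0 \<and> y \<noteq> 0 \<and> \<bar>x\<bar> \<noteq> \<bar>y\<bar>"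

lemma adm_sym: "adm x y \<Longrightarrow> adm y x"
  by (auto simp: adm_def)

lemma adm_uminus [simp]: "adm (- x) y = adm x y" "adm x (- y) = adm x y"
  by (auto simp: adm_def)

lemma tp_left [simp]: "tp x y x = y"
  by (simp add: tp_def)

lemma tp_right [simp]: "tp x y y = x"
  by (simp add: tp_def)

lemma tp_odd: "adm x y \<Longrightarrow> tp x y (- k) = - tp x y k"
  by (auto simp: tp_def adm_def)

lemma tp_other: "\<bar>k\<bar> \<noteq> \<bar>x\<bar> \<Longrightarrow> \<bar>k\<bar> \<noteq> \<bar>y\<bar> \<Longrightarrow> tp x y k = k"
  by (auto simp: tp_def)

lemma tp_tp [simp]: "adm x y \<Longrightarrow> tp x y (tp x y k) = k"
  by (auto simp: tp_def adm_def)

lemma tp_invol: "adm x y \<Longrightarrow> tp x y \<circ> tp x y = id"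
  by (rule ext) simp

lemma tp_sym: "adm x y \<Longrightarrow> tp x y = tp y x"
  by (rule ext) (auto simp: tp_def adm_def)

lemma tp_uminus: "adm x y \<Longrightarrow> tp (- x) (- y) = tp x y"
  by (rule ext) (auto simp: tp_def adm_def)

lemma tp_uminus': "adm x y \<Longrightarrow> tp (- x) y = tp x (- y)"
  using tp_uminus[of x "- y"] by simp

lemma bij_invol: "f \<circ> f = id \<Longrightarrow> bij f"
  using o_bij by blast

lemma inv_invol: "f \<circ> f = id \<Longrightarrow> inv f = f"
  by (metis bij_invol bij_is_inj comp_eq_dest_lhs id_apply inv_f_f ext)

lemma bij_tp: "adm x y \<Longrightarrow> bij (tp x y)"
  by (rule bij_invol) (rule tp_invol)

lemma inv_tp: "adm x y \<Longrightarrow> inv (tp x y) = tp x y"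
  by (rule inv_invol) (rule tp_invol)

lemma conj_apply: "bij g \<Longrightarrow> conj g h (g x) = g (h x)"
  by (simp add: conj_def bij_is_inj)

lemma conj_id: "bij g \<Longrightarrow> conj g id = id"
  using surj_iff[of g] by (simp add: conj_def bij_is_surj)

lemma conj_comp: "bij g \<Longrightarrow> conj g (a \<circ> b) = conj g a \<circ> conj g b"
  by (auto simp: conj_def fun_eq_iff bij_is_inj)

lemma conj_conj: "bij g \<Longrightarrow> bij h \<Longrightarrow> conj g (conj h a) = conj (g \<circ> h) a"
  by (simp add: conj_def o_inv_distrib comp_assoc)

lemma conj_by_id [simp]: "conj id a = a"
  by (simp add: conj_def)

lemma conj_inv: "bij g \<Longrightarrow> conj (inv g) (conj g a) = a"
  by (simp add: conj_conj bij_imp_bij_inv) (simp add: bij_is_inj)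

lemma conj_inv': "bij g \<Longrightarrow> conj g (conj (inv g) a) = a"
  by (simp add: conj_conj bij_imp_bij_inv) (metis bij_is_surj conj_by_id surj_iff)

text \<open>\<open>tp\<close> is defined by equalities among signed points, and an odd bijection
  preserves these. Conjugation thus relabels the vertices of a signed graph.\<close>

lemma conj_tp:
  assumes "bij g" "\<And>i. g (- i) = - g i"
  shows "conj g (tp x y) = tp (g x) (g y)"
proof (rule ext)
  fix k
  obtain z where z: "k = g z" using assms(1) by (metis bij_pointE)
  have inj: "g a = g b \<longleftrightarrow> a = b" for a b using assms(1) by (metis bij_pointE)
  show "conj g (tp x y) k = tp (g x) (g y) k"
    unfolding z conj_apply[OF assms(1)]
    by (auto simp: tp_def inj assms(2)[symmetric])
qed

lemma WB_bij: "w \<in> WB n \<Longrightarrow> bij w"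
  and WB_odd: "w \<in> WB n \<Longrightarrow> w (- i) = - w i"
  and WB_out: "w \<in> WB n \<Longrightarrow> i \<notin> pts n \<Longrightarrow> w i = i"
  by (auto simp: WB_def signed_perm_def pts_def)

lemma WBI: "bij w \<Longrightarrow> (\<And>i. w (- i) = - w i) \<Longrightarrow> (\<And>i. i \<notin> pts n \<Longrightarrow> w i = i) \<Longrightarrow> w \<in> WB n"
  unfolding WB_def signed_perm_def pts_def mem_Collect_eq by blast

lemma pts_uminus [simp]: "- x \<in> pts n \<longleftrightarrow> x \<in> pts n"
  and pts_abs [simp]: "\<bar>x\<bar> \<in> pts n \<longleftrightarrow> x \<in> pts n"
  by (auto simp: pts_def)

lemma pts_nz: "x \<in> pts n \<Longrightarrow> x \<noteq> 0"
  by (auto simp: pts_def)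

lemma finite_pts: "finite (pts n)"
  by (rule finite_subset[of _ "{- int n..int n}"]) (auto simp: pts_def)

lemma adm_pts: "x \<in> pts n \<Longrightarrow> y \<in> pts n \<Longrightarrow> \<bar>x\<bar> \<noteq> \<bar>y\<bar> \<Longrightarrow> adm x y"
  by (auto simp: adm_def pts_def)

lemma WB_pts: "w \<in> WB n \<Longrightarrow> w x \<in> pts n \<longleftrightarrow> x \<in> pts n"
  by (metis WB_bij WB_out bij_pointE)

lemma WB_inj: "w \<in> WB n \<Longrightarrow> w x = w y \<longleftrightarrow> x = y"
  using bij_is_inj[OF WB_bij] by (simp add: inj_eq)

lemma WB_abs: "w \<in> WB n \<Longrightarrow> \<bar>w x\<bar> = \<bar>w y\<bar> \<longleftrightarrow> \<bar>x\<bar> = \<bar>y\<bar>"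
  by (simp add: abs_eq_iff WB_odd[symmetric] WB_inj)

lemma WB_abs': "w \<in> WB n \<Longrightarrow> \<bar>w \<bar>x\<bar>\<bar> = \<bar>w x\<bar>"
  by (simp add: WB_abs)

lemma WB_id: "id \<in> WB n"
  by (rule WBI) auto

lemma WB_comp: "v \<in> WB n \<Longrightarrow> w \<in> WB n \<Longrightarrow> v \<circ> w \<in> WB n"
  by (rule WBI) (auto simp: bij_comp WB_bij WB_odd WB_out)

lemma WB_inv: "w \<in> WB n \<Longrightarrow> inv w \<in> WB n"
proof -
  assume w: "w \<in> WB n"
  have inv: "w (inv w x) = x" for x using WB_bij[OF w] by (simp add: bij_is_surj surj_f_inv_f)
  show "inv w \<in> WB n"
  proof (rule WBI)
    show "bij (inv w)" using w by (simp add: WB_bij bij_imp_bij_inv)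
    show "inv w (- i) = - inv w i" for i
      using WB_inj[OF w, of "inv w (- i)" "- inv w i"] by (simp add: inv WB_odd[OF w])
    show "inv w i = i" if "i \<notin> pts n" for i
      using WB_inj[OF w, of "inv w i" i] that by (simp add: inv WB_out[OF w])
  qed
qed

lemma WB_conj: "g \<in> WB n \<Longrightarrow> w \<in> WB n \<Longrightarrow> conj g w \<in> WB n"
  by (simp add: conj_def WB_comp WB_inv)

lemma WB_tp:
  assumes "x \<in> pts n" "y \<in> pts n" "\<bar>x\<bar> \<noteq> \<bar>y\<bar>"
  shows "tp x y \<in> WB n"
  by (rule WBI) (use assms adm_pts[OF assms] pts_nz in \<open>auto simp: bij_tp tp_odd tp_def\<close>)

section \<open>The sign character of W(B_n)\<close>

definition eps :: "nat \<Rightarrow> (int \<Rightarrow> int) \<Rightarrow> int" where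
  "eps n w = (\<Prod>i\<in>{1..int n}. sgn (w i))"

lemma WB_permutes:
  assumes "w \<in> WB n"
  shows "bij_betw (\<lambda>i. \<bar>w i\<bar>) {1..int n} {1..int n}"
proof -
  have inj: "inj_on (\<lambda>i. \<bar>w i\<bar>) {1..int n}"
    by (rule inj_onI) (auto simp: WB_abs[OF assms])
  have "(\<lambda>i. \<bar>w i\<bar>) ` {1..int n} \<subseteq> {1..int n}"
    using WB_pts[OF assms] by (auto simp: pts_def)
  then show ?thesis using inj by (simp add: bij_betw_def endo_inj_surj)
qed

text \<open>By oddness the sign of \<open>v (w i)\<close> is the sign of \<open>v\<close> at the
  line of \<open>w i\<close> times the sign of \<open>w i\<close>, and taking lines makes
  \<open>w\<close> a permutation of the index set. So \<open>eps\<close> is a character of W(B_n),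
  with kernel W(D_n).\<close>

lemma eps_comp:
  assumes "v \<in> WB n" "w \<in> WB n"
  shows "eps n (v \<circ> w) = eps n v * eps n w"
proof -
  have "sgn (v (w i)) = sgn (v \<bar>w i\<bar>) * sgn (w i)" if "i \<in> {1..int n}" for i
  proof -
    have "w i \<noteq> 0" using WB_pts[OF assms(2), of i] that by (auto simp: pts_def)
    then show ?thesis using WB_odd[OF assms(1), of "w i"] by (cases "w i > 0") auto
  qed
  then have "eps n (v \<circ> w) = (\<Prod>i\<in>{1..int n}. sgn (v \<bar>w i\<bar>)) * eps n w"
    by (simp add: eps_def prod.distrib)
  then show ?thesis
    using prod.reindex_bij_betw[OF WB_permutes[OF assms(2)], of "\<lambda>i. sgn (v i)"]
    by (simp add: eps_def)
qed

lemma eps_card: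
  assumes "w \<in> WB n"
  shows "eps n w = (-1) ^ card {i \<in> {1..int n}. w i < 0}"
proof -
  have "eps n w = (\<Prod>i\<in>{1..int n}. if w i < 0 then -1 else 1)"
    unfolding eps_def
  proof (rule prod.cong)
    fix i assume "i \<in> {1..int n}"
    then have "w i \<noteq> 0" using WB_pts[OF assms, of i] by (auto simp: pts_def)
    then show "sgn (w i) = (if w i < 0 then -1 else 1)" by auto
  qed simp
  also have "\<dots> = (\<Prod>i\<in>{i \<in> {1..int n}. w i < 0}. -1)"
    by (rule prod.mono_neutral_cong_right) auto
  finally show ?thesis by simp
qed

lemma WD_eps: "w \<in> WD n \<longleftrightarrow> w \<in> WB n \<and> eps n w = 1"
proof -
  have "w \<in> WD n \<longleftrightarrow> w \<in> WB n \<and> even (card {i \<in> {1..int n}. w i < 0})"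
    by (simp add: WD_def WB_def)
  then show ?thesis using eps_card[of w n]
    by (cases "w \<in> WB n") (auto simp: minus_one_power_iff split: if_splits)
qed

lemma WD_WB: "w \<in> WD n \<Longrightarrow> w \<in> WB n"
  by (simp add: WD_eps)

lemma eps_cases: "w \<in> WB n \<Longrightarrow> eps n w = 1 \<or> eps n w = -1"
  by (simp add: eps_card minus_one_power_iff)

lemma eps_id: "eps n id = 1"
  by (simp add: eps_def)

lemma WD_id: "id \<in> WD n"
  by (simp add: WD_eps eps_id WB_id)

lemma WD_comp: "v \<in> WD n \<Longrightarrow> w \<in> WD n \<Longrightarrow> v \<circ> w \<in> WD n"
  by (simp add: WD_eps WB_comp eps_comp)

lemma WD_comp_odd: "v \<in> WB n \<Longrightarrow> w \<in> WB n \<Longrightarrow> v \<notin> WD n \<Longrightarrow> w \<notin> WD n \<Longrightarrow> v \<circ> w \<in> WD n"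
  using eps_cases[of v n] eps_cases[of w n] by (auto simp: WD_eps WB_comp eps_comp)

lemma WD_inv: "w \<in> WD n \<Longrightarrow> inv w \<in> WD n"
proof -
  assume w: "w \<in> WD n"
  then have "w \<circ> inv w = id" 
    using surj_iff[of w] bij_is_surj[OF WB_bij[OF WD_WB[OF w]]] by simp
  then have "eps n w * eps n (inv w) = 1"
    using eps_comp[of w n "inv w"] w by (simp add: WD_WB WB_inv eps_id)
  then show ?thesis using w by (auto simp: WD_eps WB_inv)
qed

lemma WD_tp:
  assumes "x \<in> pts n" "y \<in> pts n" "\<bar>x\<bar> \<noteq> \<bar>y\<bar>"
  shows "tp x y \<in> WD n"
proof -
  have neg: "tp x y i < 0 \<longleftrightarrow> (x < 0) \<noteq> (y < 0) \<and> (i = \<bar>x\<bar> \<or> i = \<bar>y\<bar>)" if "i > 0" for i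
    using that adm_pts[OF assms] unfolding tp_def adm_def by (smt (verit))
  have "\<bar>x\<bar> \<in> {1..int n}" "\<bar>y\<bar> \<in> {1..int n}" using assms by (simp_all add: pts_def)
  then have "{i \<in> {1..int n}. tp x y i < 0} = (if (x < 0) = (y < 0) then {} else {\<bar>x\<bar>, \<bar>y\<bar>})"
    using neg by auto
  then have "even (card {i \<in> {1..int n}. tp x y i < 0})" using assms(3) by simp
  then show ?thesis using WB_tp[OF assms] by (simp add: WD_def WB_def)
qed

section \<open>Reflections as exchanges of signed points\<close>

lemma reflections_eq: "reflections n = {tp x y | x y. x \<in> pts n \<and> y \<in> pts n \<and> \<bar>x\<bar> \<noteq> \<bar>y\<bar>}"
  (is "_ = ?R")
proof
  show "reflections n \<subseteq> ?R"
  proof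
    fix w assume "w \<in> reflections n"
    then consider i j where "w = tp i j" "i \<in> {1..int n}" "j \<in> {1..int n}" "i \<noteq> j"
      | i j where "w = tp i (- j)" "i \<in> {1..int n}" "j \<in> {1..int n}" "i \<noteq> j"
      unfolding reflections_def by blast
    then show "w \<in> ?R"
    proof cases
      case (1 i j) then show ?thesis by (intro CollectI exI[of _ i] exI[of _ j]) (auto simp: pts_def)
    next
      case (2 i j) then show ?thesis by (intro CollectI exI[of _ i] exI[of _ "- j"]) (auto simp: pts_def)
    qed
  qed
  show "?R \<subseteq> reflections n"
  proof
    fix w assume "w \<in> ?R"
    then obtain x y where w: "w = tp x y" and xy: "x \<in> pts n" "y \<in> pts n" "\<bar>x\<bar> \<noteq> \<bar>y\<bar>" by blast
    have "w = tp \<bar>x\<bar> \<bar>y\<bar> \<or> w = tp \<bar>x\<bar> (- \<bar>y\<bar>)"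
      using tp_uminus[OF adm_pts[OF xy]] tp_uminus'[OF adm_pts[OF xy]] w by (auto simp: abs_if)
    moreover have "\<bar>x\<bar> \<in> {1..int n}" "\<bar>y\<bar> \<in> {1..int n}" using xy by (auto simp: pts_def)
    ultimately show "w \<in> reflections n" using xy(3) unfolding reflections_def by blast
  qed
qed

lemma reflectionsE:
  assumes "w \<in> reflections n"
  obtains x y where "w = tp x y" "x \<in> pts n" "y \<in> pts n" "\<bar>x\<bar> \<noteq> \<bar>y\<bar>" "adm x y"
  using assms adm_pts unfolding reflections_eq by blast

lemma reflectionsI: "x \<in> pts n \<Longrightarrow> y \<in> pts n \<Longrightarrow> \<bar>x\<bar> \<noteq> \<bar>y\<bar> \<Longrightarrow> tp x y \<in> reflections n"
  unfolding reflections_eq by blast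

lemma finite_reflections: "finite (reflections n)"
proof (rule finite_subset)
  show "reflections n \<subseteq> (\<lambda>(x, y). tp x y) ` (pts n \<times> pts n)"
  proof
    fix w assume "w \<in> reflections n"
    then obtain x y where "w = tp x y" "x \<in> pts n" "y \<in> pts n" by (rule reflectionsE)
    then show "w \<in> (\<lambda>(x, y). tp x y) ` (pts n \<times> pts n)"
      by (intro image_eqI[of _ _ "(x, y)"]) auto
  qed
qed (simp add: finite_pts)

lemma reflection_invol: "s \<in> reflections n \<Longrightarrow> s \<circ> s = id"
  by (metis reflectionsE tp_invol)

lemma reflections_WD: "reflections n \<subseteq> WD n"
  using WD_tp by (auto simp: reflections_eq)

lemma finite_WB: "finite (WB n)"
proof (rule finite_subset)
  show "WB n \<subseteq> {f. \<forall>x. (x \<in> pts n \<longrightarrow> f x \<in> pts n) \<and> (x \<notin> pts n \<longrightarrow> f x = x)}"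
    by (auto simp: WB_pts WB_out)
  have "inj_on (\<lambda>f. restrict f (pts n)) {f. \<forall>x. (x \<in> pts n \<longrightarrow> f x \<in> pts n) \<and> (x \<notin> pts n \<longrightarrow> f x = x)}"
  proof (rule inj_onI, rule ext)
    fix f g :: "int \<Rightarrow> int" and x
    assume fg: "f \<in> {f. \<forall>x. (x \<in> pts n \<longrightarrow> f x \<in> pts n) \<and> (x \<notin> pts n \<longrightarrow> f x = x)}"
      "g \<in> {f. \<forall>x. (x \<in> pts n \<longrightarrow> f x \<in> pts n) \<and> (x \<notin> pts n \<longrightarrow> f x = x)}"
      "restrict f (pts n) = restrict g (pts n)"
    from fun_cong[OF fg(3), of x] show "f x = g x"
      using fg(1,2) by (cases "x \<in> pts n") auto
  qed
  moreover have "(\<lambda>f. restrict f (pts n)) ` {f. \<forall>x. (x \<in> pts n \<longrightarrow> f x \<in> pts n) \<and> (x \<notin> pts n \<longrightarrow> f x = x)}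
    \<subseteq> (\<Pi>\<^sub>E i\<in>pts n. pts n)" by auto
  ultimately show "finite {f. \<forall>x. (x \<in> pts n \<longrightarrow> f x \<in> pts n) \<and> (x \<notin> pts n \<longrightarrow> f x = x)}"
    by (meson finite_PiE finite_imageD finite_pts finite_subset)
qed

section \<open>Groups generated by involutions\<close>

definition invols :: "(int \<Rightarrow> int) set \<Rightarrow> bool" where
  "invols X \<longleftrightarrow> (\<forall>x\<in>X. x \<circ> x = id)"

lemma gen_base: "x \<in> X \<Longrightarrow> x \<in> gen X"
  using gen.gen_mult[OF _ gen.gen_id, of x X] by simp

lemma gen_comp: "g \<in> gen X \<Longrightarrow> h \<in> gen X \<Longrightarrow> g \<circ> h \<in> gen X"
  by (induction rule: gen.induct) (auto simp: comp_assoc intro: gen.intros)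

text \<open>An involution is its own inverse, so the two closure clauses of \<open>gen\<close>
  coincide and an invariant only has to survive left multiplication by a generator.\<close>

lemma gen_closed:
  assumes "invols X" "id \<in> K" "\<And>x g. x \<in> X \<Longrightarrow> g \<in> gen X \<Longrightarrow> g \<in> K \<Longrightarrow> x \<circ> g \<in> K"
  shows "gen X \<subseteq> K"
proof
  fix g assume "g \<in> gen X"
  then show "g \<in> K"
  proof (induction rule: gen.induct)
    case gen_id show ?case by (rule assms(2))
  next
    case (gen_mult x g) then show ?case by (rule assms(3))
  next
    case (gen_inv x g)
    then have "inv x = x" using assms(1) inv_invol by (auto simp: invols_def)
    then show ?case using assms(3)[OF gen_inv(1,2,3)] by metis
  qed
qed

lemma gen_least:
  assumes "invols X" "X \<subseteq> gen Y"
  shows "gen X \<subseteq> gen Y"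
  by (rule gen_closed[OF assms(1) gen.gen_id]) (use assms(2) gen_comp in blast)

lemma gen_eqI: "invols X \<Longrightarrow> invols Y \<Longrightarrow> X \<subseteq> gen Y \<Longrightarrow> Y \<subseteq> gen X \<Longrightarrow> gen X = gen Y"
  using gen_least by blast

lemma gen_mono: "X \<subseteq> Y \<Longrightarrow> gen X \<subseteq> gen Y"
proof
  fix g assume XY: "X \<subseteq> Y" and "g \<in> gen X"
  from this(2) show "g \<in> gen Y"
    by (induction rule: gen.induct) (use XY in \<open>blast intro: gen.intros\<close>)+
qed

text \<open>One inclusion, proved for an arbitrary bijection, is applied to \<open>g\<close> and to
  \<open>inv g\<close>.\<close>

lemma gen_conj:
  assumes "bij g" "invols X"
  shows "conj g ` gen X = gen (conj g ` X)"
proof -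
  have *: "gen X \<subseteq> {h. conj g h \<in> gen (conj g ` X)}" if g: "bij g" and X: "invols X" for g X
  proof (rule gen_closed[OF X])
    show "id \<in> {h. conj g h \<in> gen (conj g ` X)}"
      using gen.gen_id[of "conj g ` X"] conj_id[OF g] by simp
    fix x h assume "x \<in> X" "h \<in> gen X" "h \<in> {h. conj g h \<in> gen (conj g ` X)}"
    then show "x \<circ> h \<in> {h. conj g h \<in> gen (conj g ` X)}"
      using conj_comp[OF g, of x h] gen_comp[of "conj g x" "conj g ` X" "conj g h"]
        gen_base[of "conj g x" "conj g ` X"] by simp
  qed
  have "invols (conj g ` X)"
    unfolding invols_def
  proof
    fix y assume "y \<in> conj g ` X"
    then obtain x where x: "x \<in> X" "y = conj g x" by blast
    then show "y \<circ> y = id"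
      using conj_comp[OF assms(1), of x x] assms(2) conj_id[OF assms(1)]
      by (metis invols_def)
  qed
  from *[OF bij_imp_bij_inv[OF assms(1)] this]
  have "gen (conj g ` X) \<subseteq> {h. conj (inv g) h \<in> gen X}"
    by (simp add: image_comp o_def conj_inv[OF assms(1)])
  then have "gen (conj g ` X) \<subseteq> conj g ` gen X"
    using conj_inv'[OF assms(1)] by (metis (no_types, lifting) image_eqI mem_Collect_eq subset_iff)
  then show ?thesis using *[OF assms] by blast
qed

lemma invols_refl: "X \<subseteq> reflections n \<Longrightarrow> invols X"
  using reflection_invol by (auto simp: invols_def)

lemma gen_WD:
  assumes "X \<subseteq> reflections n" 
  shows "gen X \<subseteq> WD n"
  by (rule gen_closed[OF invols_refl[OF assms] WD_id])
    (use assms reflections_WD WD_comp in blast)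

section \<open>Decomposition of reflection subgroups into pieces\<close>

text \<open>At most one signed point on each line. The choice of the points is a switching of the
  signed graph: relative to it, \<open>tp x y\<close> is a positive edge and
  \<open>tp x (- y)\<close> a negative one.\<close>

definition good :: "int set \<Rightarrow> bool" where
  "good I \<longleftrightarrow> 0 \<notin> I \<and> inj_on abs I"

lemma gen_superset: "X \<subseteq> Y \<Longrightarrow> X \<subseteq> gen Y"
  using gen_base by blast

lemma good_adm: "good I \<Longrightarrow> x \<in> I \<Longrightarrow> y \<in> I \<Longrightarrow> x \<noteq> y \<Longrightarrow> adm x y"
  by (auto simp: good_def adm_def inj_on_def)

lemma good_subset: "good I \<Longrightarrow> J \<subseteq> I \<Longrightarrow> good J"
  by (auto simp: good_def inj_on_def)

lemma good_uminus: "good I \<Longrightarrow> good (uminus ` I)"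
  by (auto simp: good_def inj_on_def)

lemma good_no_neg: "good I \<Longrightarrow> x \<in> I \<Longrightarrow> - x \<notin> I"
  unfolding good_def inj_on_def by (metis abs_minus_cancel neg_equal_zero)

lemma A_gensI: "x \<in> I \<Longrightarrow> y \<in> I \<Longrightarrow> x \<noteq> y \<Longrightarrow> tp x y \<in> A_gens I"
  by (auto simp: A_gens_def)

lemma D_gensI: "x \<in> I \<Longrightarrow> y \<in> I \<Longrightarrow> x \<noteq> y \<Longrightarrow> tp x y \<in> D_gens I"
  "x \<in> I \<Longrightarrow> y \<in> I \<Longrightarrow> x \<noteq> y \<Longrightarrow> tp x (- y) \<in> D_gens I"
  by (auto simp: D_gens_def A_gens_def)

lemma A_gens_subset_iff: "A_gens I \<subseteq> H \<longleftrightarrow> (\<forall>x\<in>I. \<forall>y\<in>I. x \<noteq> y \<longrightarrow> tp x y \<in> H)"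
  unfolding A_gens_def by blast

lemma D_gens_subset_iff: "D_gens I \<subseteq> H \<longleftrightarrow>
    (\<forall>x\<in>I. \<forall>y\<in>I. x \<noteq> y \<longrightarrow> tp x y \<in> H \<and> tp x (- y) \<in> H)"
  unfolding D_gens_def A_gens_def by blast

lemma A_gens_mono: "I \<subseteq> J \<Longrightarrow> A_gens I \<subseteq> A_gens J"
  unfolding A_gens_def by blast

lemma D_gens_mono: "I \<subseteq> J \<Longrightarrow> D_gens I \<subseteq> D_gens J"
  unfolding D_gens_def A_gens_def by blast

lemma A_gens_D_gens: "A_gens I \<subseteq> D_gens I"
  unfolding D_gens_def by blast

lemma A_gens_D_gens_mono: "I \<subseteq> J \<Longrightarrow> A_gens I \<subseteq> D_gens J"
  using A_gens_D_gens A_gens_mono by blast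

text \<open>Both signs of each edge occur, so only the lines of \<open>I\<close> matter; a block of
  type D may be switched at any vertex.\<close>

lemma D_gens_eq:
  assumes "good I"
  shows "D_gens I = {tp x y | x y. \<bar>x\<bar> \<in> abs ` I \<and> \<bar>y\<bar> \<in> abs ` I \<and> \<bar>x\<bar> \<noteq> \<bar>y\<bar>}"
proof
  have sgn: "\<bar>i\<bar> \<noteq> \<bar>j\<bar>" if "i \<in> I" "j \<in> I" "i \<noteq> j" for i j
    using assms that by (auto simp: good_def inj_on_def)
  show "D_gens I \<subseteq> {tp x y | x y. \<bar>x\<bar> \<in> abs ` I \<and> \<bar>y\<bar> \<in> abs ` I \<and> \<bar>x\<bar> \<noteq> \<bar>y\<bar>}"
    unfolding D_gens_subset_iff
  proof (intro ballI impI conjI)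
    fix x y assume xy: "x \<in> I" "y \<in> I" "x \<noteq> y"
    note s = sgn[OF xy]
    show "tp x y \<in> {tp x y | x y. \<bar>x\<bar> \<in> abs ` I \<and> \<bar>y\<bar> \<in> abs ` I \<and> \<bar>x\<bar> \<noteq> \<bar>y\<bar>}"
      using xy s by blast
    show "tp x (- y) \<in> {tp x y | x y. \<bar>x\<bar> \<in> abs ` I \<and> \<bar>y\<bar> \<in> abs ` I \<and> \<bar>x\<bar> \<noteq> \<bar>y\<bar>}"
      using xy s by (intro CollectI exI[of _ x] exI[of _ "- y"]) auto
  qed
  show "{tp x y | x y. \<bar>x\<bar> \<in> abs ` I \<and> \<bar>y\<bar> \<in> abs ` I \<and> \<bar>x\<bar> \<noteq> \<bar>y\<bar>} \<subseteq> D_gens I"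
  proof
    fix w assume "w \<in> {tp x y | x y. \<bar>x\<bar> \<in> abs ` I \<and> \<bar>y\<bar> \<in> abs ` I \<and> \<bar>x\<bar> \<noteq> \<bar>y\<bar>}"
    then obtain x y i j where w: "w = tp x y" and ij: "i \<in> I" "j \<in> I" "\<bar>x\<bar> = \<bar>i\<bar>" "\<bar>y\<bar> = \<bar>j\<bar>"
      "\<bar>x\<bar> \<noteq> \<bar>y\<bar>" by fastforce
    then have "i \<noteq> j" by auto
    then have a: "adm i j" using good_adm[OF assms ij(1,2)] by blast
    have "(x = i \<or> x = - i) \<and> (y = j \<or> y = - j)" using ij by (auto simp: abs_eq_iff)
    then have "w = tp i j \<or> w = tp i (- j)"
      using w tp_uminus[OF a] tp_uminus'[OF a] by auto
    then show "w \<in> D_gens I" using D_gensI[OF ij(1,2) \<open>i \<noteq> j\<close>] by auto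
  qed
qed

lemma D_gens_abs_cong: "good I \<Longrightarrow> good J \<Longrightarrow> abs ` I = abs ` J \<Longrightarrow> D_gens I = D_gens J"
  by (simp add: D_gens_eq)

lemma D_gens_uminus: "good I \<Longrightarrow> D_gens (uminus ` I) = D_gens I"
  by (rule D_gens_abs_cong) (auto simp: good_uminus image_image)

lemma A_gens_uminus:
  assumes "good I"
  shows "A_gens (uminus ` I) = A_gens I"
proof -
  have "A_gens (uminus ` I) \<subseteq> A_gens I" if "good I" for I
    unfolding A_gens_subset_iff using tp_uminus[OF good_adm[OF that]] A_gensI[of _ I] by auto
  from this[OF assms] this[OF good_uminus[OF assms]] show ?thesis
    by (simp add: image_image)
qed

section \<open>Completing a connected block\<close>

lemma tp_trans:
  assumes "tp x y \<in> gen X" "tp y z \<in> gen X" "adm x y" "adm y z" "adm x z"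
  shows "tp x z \<in> gen X"
proof -
  have "conj (tp x y) (tp y z) = tp (tp x y y) (tp x y z)"
    by (rule conj_tp) (simp_all add: bij_tp tp_odd assms)
  moreover have "tp x y z = z" using assms by (intro tp_other) (auto simp: adm_def)
  ultimately have "tp x z = tp x y \<circ> tp y z \<circ> tp x y"
    by (simp add: conj_def inv_tp[OF assms(3)])
  then show ?thesis using gen_comp assms by metis
qed

text \<open>Composing edges along \<open>x\<close>, \<open>a\<close>, \<open>b\<close>,
  \<open>y\<close> produces every cross edge from the single edge \<open>tp a b\<close>.\<close>

lemma A_merge:
  assumes g: "good (I \<union> J)" "I \<inter> J = {}" and I: "A_gens I \<subseteq> gen X" and J: "A_gens J \<subseteq> gen X"
    and ab: "a \<in> I" "b \<in> J" "tp a b \<in> gen X"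
  shows "A_gens (I \<union> J) \<subseteq> gen X"
proof -
  have adm: "adm x y" if "x \<in> I \<union> J" "y \<in> I \<union> J" "x \<noteq> y" for x y
    using good_adm[OF g(1) that] .
  have tI: "tp x y \<in> gen X" if "x \<in> I" "y \<in> I" "x \<noteq> y" for x y
    using I that unfolding A_gens_subset_iff by blast
  have tJ: "tp x y \<in> gen X" if "x \<in> J" "y \<in> J" "x \<noteq> y" for x y
    using J that unfolding A_gens_subset_iff by blast
  have xb: "tp x b \<in> gen X" if "x \<in> I" for x
  proof (cases "x = a")
    case False
    then show ?thesis using tp_trans[of x a X b] tI[of x a] ab adm g(2) that by blast
  qed (use ab in simp)
  have xy: "tp x y \<in> gen X" if "x \<in> I" "y \<in> J" for x y
  proof (cases "y = b")
    case False
    then show ?thesis using tp_trans[of x b X y] tJ[of b y] xb[of x] ab adm g(2) that by blast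
  qed (use xb that in simp)
  have "tp y x \<in> gen X" if "x \<in> I" "y \<in> J" for x y
  proof -
    have "adm y x" using that adm g(2) by blast
    then show ?thesis using xy[OF that] tp_sym by metis
  qed
  then show ?thesis unfolding A_gens_subset_iff using tI tJ xy by blast
qed

text \<open>One negative edge suffices: the positive edge from \<open>x\<close> to \<open>a\<close>,
  the negative edge from \<open>a\<close> to \<open>b\<close> and the positive edge from
  \<open>- b\<close> to \<open>- y\<close> compose to the negative edge from \<open>x\<close> to
  \<open>y\<close>. The cases treat coincidences of \<open>x\<close>, \<open>y\<close> with
  \<open>a\<close>, \<open>b\<close>.\<close>

lemma D_make:
  assumes g: "good I" and I: "A_gens I \<subseteq> gen X"
    and ab: "a \<in> I" "b \<in> I" "a \<noteq> b" "tp a (- b) \<in> gen X"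
  shows "D_gens I \<subseteq> gen X"
proof -
  have adm: "adm x y" if "x \<in> I" "y \<in> I" "x \<noteq> y" for x y
    using good_adm[OF g that] .
  have tI: "tp x y \<in> gen X" "tp (- x) (- y) \<in> gen X" if "x \<in> I" "y \<in> I" "x \<noteq> y" for x y
    using I that tp_uminus[OF adm[OF that]] unfolding A_gens_subset_iff by auto
  have aa: "adm b a" "adm a b" using adm ab by auto
  have ba: "tp b (- a) \<in> gen X"
    using ab(4) tp_sym[of a "- b"] tp_uminus'[OF aa(1)] aa by simp
  have "tp x (- y) \<in> gen X" if xy: "x \<in> I" "y \<in> I" "x \<noteq> y" for x y
  proof (cases "x = b")
    case True
    show ?thesis
    proof (cases "y = a")
      case False
      then show ?thesis using tp_trans[of b "- a" X "- y"] tI(2)[of a y] ba ab True xy adm by auto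
    qed (use True ba in simp)
  next
    case False
    have "tp x (- b) \<in> gen X"
    proof (cases "x = a")
      case F: False
      then show ?thesis using tp_trans[of x a X "- b"] tI(1)[of x a] ab False xy adm by auto
    qed (use ab in simp)
    then show ?thesis
      using tp_trans[of x "- b" X "- y"] tI(2)[of b y] ab False xy adm by (cases "y = b") auto
  qed
  then show ?thesis unfolding D_gens_subset_iff using tI by blast
qed

text \<open>The second point \<open>a'\<close> supplies a negative edge \<open>tp a (- a')\<close>
  inside \<open>I\<close>, after which \<open>D_make\<close> applies to the union.\<close>

lemma D_merge:
  assumes g: "good (I \<union> J)" "I \<inter> J = {}" and I: "D_gens I \<subseteq> gen X" and J: "A_gens J \<subseteq> gen X"
    and ab: "a \<in> I" "a' \<in> I" "a \<noteq> a'" "b \<in> J" "tp a b \<in> gen X"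
  shows "D_gens (I \<union> J) \<subseteq> gen X"
proof (rule D_make[OF g(1)])
  show "A_gens (I \<union> J) \<subseteq> gen X"
    by (rule A_merge[OF g _ J ab(1,4,5)]) (use I A_gens_D_gens in blast)
  show "tp a (- a') \<in> gen X" using I ab unfolding D_gens_subset_iff by blast
qed (use ab in auto)

text \<open>A partition of the n lines into nonempty blocks, each an ordered list of signed
  representatives. For the groups the order is immaterial; later it is the order along a path or a
  cycle. A line that no edge meets is a singleton block.\<close>

definition valid :: "nat \<Rightarrow> int list list \<Rightarrow> bool" where
  "valid n L \<longleftrightarrow> distinct (map abs (concat L)) \<and> abs ` set (concat L) = {1..int n} \<and> [] \<notin> set L"

lemma valid_perm: "mset L = mset L' \<Longrightarrow> valid n L \<Longrightarrow> valid n L'"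
proof -
  assume m: "mset L = mset L'" and v: "valid n L"
  have "mset (concat M) = sum_mset (image_mset mset (mset M))" for M :: "int list list"
    unfolding mset_concat sum_mset_sum_list[symmetric] mset_map ..
  then have "mset (concat L) = mset (concat L')" by (simp only: m)
  then have "mset (map abs (concat L)) = mset (map abs (concat L'))" by simp
  note mset_eq_imp_distinct_iff[OF this] mset_eq_setD[OF this] mset_eq_setD[OF m]
  then show ?thesis using v unfolding valid_def set_map by (metis (no_types))
qed

lemma valid_uminus: "valid n (p # L) \<Longrightarrow> valid n (map uminus p # L)"
proof -
  have "map abs (concat (map uminus p # L)) = map abs (concat (p # L))" by simp
  moreover have "abs ` set (concat (map uminus p # L)) = abs ` set (concat (p # L))"
    by (simp add: image_Un image_image)
  ultimately show "valid n (p # L) \<Longrightarrow> valid n (map uminus p # L)"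
    unfolding valid_def by (simp only:) auto
qed

lemma valid_rev: "valid n (p # L) \<Longrightarrow> valid n (rev p # L)"
  by (simp add: valid_def rev_map[symmetric] eq_commute[of "[]"])

lemma valid_merge: "valid n (p # q # L) \<Longrightarrow> valid n ((p @ q) # L)"
  by (simp add: valid_def Un_assoc Int_Un_distrib2 image_Un Int_Un_distrib eq_commute[of "[]"])

lemma valid_good:
  assumes "valid n L"
  shows "good (set (concat L))"
proof -
  have "0 \<notin> abs ` set (concat L)" using assms by (simp add: valid_def)
  then have "0 \<notin> set (concat L)" by (metis abs_zero image_eqI)
  then show ?thesis using assms unfolding valid_def good_def distinct_map by blast
qed

lemma valid_distinct: "valid n L \<Longrightarrow> distinct (concat L)"
  by (auto simp: valid_def distinct_map)

lemma valid_distinct1: "valid n L \<Longrightarrow> p \<in> set L \<Longrightarrow> distinct p"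
  by (drule valid_distinct) (induction L, auto)

lemma valid_good1: "valid n L \<Longrightarrow> p \<in> set L \<Longrightarrow> good (set p)"
  by (drule valid_good) (rule good_subset, auto)

lemma valid_pts: "valid n L \<Longrightarrow> p \<in> set L \<Longrightarrow> x \<in> set p \<Longrightarrow> x \<in> pts n"
proof -
  assume "valid n L" "p \<in> set L" "x \<in> set p"
  then have "\<bar>x\<bar> \<in> {1..int n}" unfolding valid_def by (metis UN_I imageI set_concat)
  then show ?thesis by (simp add: pts_def)
qed

lemma valid_cover: "valid n L \<Longrightarrow> x \<in> pts n \<Longrightarrow> \<exists>p\<in>set L. x \<in> set p \<or> - x \<in> set p"
proof -
  assume v: "valid n L" and x: "x \<in> pts n"
  then have "\<bar>x\<bar> \<in> abs ` set (concat L)" by (simp add: valid_def pts_def)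
  then obtain y where "y \<in> set (concat L)" "\<bar>x\<bar> = \<bar>y\<bar>" by blast
  then show ?thesis by (auto simp: abs_eq_iff)
qed

lemma valid_disjoint:
  assumes "valid n (p # L)" "q \<in> set L" "x \<in> set p" "y \<in> set q"
  shows "\<bar>x\<bar> \<noteq> \<bar>y\<bar>"
proof -
  have "\<bar>x\<bar> \<in> set (map abs p)" "\<bar>y\<bar> \<in> set (map abs (concat L))" using assms by auto
  moreover have "distinct (map abs p @ map abs (concat L))" using assms(1) unfolding valid_def by simp
  ultimately show ?thesis unfolding distinct_append by (metis IntI emptyE)
qed

lemma valid_length: "valid n L \<Longrightarrow> length (concat L) = n"
proof -
  assume v: "valid n L"
  then have "card (set (map abs (concat L))) = length (concat L)"
    unfolding valid_def by (metis distinct_card length_map)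
  then show ?thesis using v by (simp add: valid_def del: length_concat set_concat)
qed

text \<open>A piece of type A stands for \<open>\<SS>\<^sub>I\<close>, up to sign changes, and one of type D for
  \<open>D\<^sub>I\<close>. The generators attached to pieces are kept abstract, since both the full sets of
  reflections and the simple ones are needed.\<close>

definition gens_union :: "(int list \<Rightarrow> 'a set) \<Rightarrow> (int list \<Rightarrow> 'a set) \<Rightarrow> int list list \<Rightarrow> int list list \<Rightarrow> 'a set" where
  "gens_union fA fD LA LD = (\<Union>p\<in>set LA. fA p) \<union> (\<Union>q\<in>set LD. fD q)"

definition decomp :: "nat \<Rightarrow> (int list \<Rightarrow> 'a set) \<Rightarrow> (int list \<Rightarrow> 'a set) \<Rightarrow> 'a set \<Rightarrow> int list list \<Rightarrow> int list list \<Rightarrow> bool" where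
  "decomp n fA fD S LA LD \<longleftrightarrow> valid n (LA @ LD) \<and> (\<forall>q\<in>set LD. 2 \<le> length q) \<and> S = gens_union fA fD LA LD"

text \<open>Switching all vertices of a block at once leaves its edges alone. This freedom allows a
  prescribed signed point, and not just its negative, to be found in a block.\<close>

definition neg_inv :: "(int list \<Rightarrow> 'a set) \<Rightarrow> bool" where
  "neg_inv f \<longleftrightarrow> (\<forall>p. distinct p \<and> good (set p) \<longrightarrow> f (map uminus p) = f p)"

lemma neg_invD: "neg_inv f \<Longrightarrow> distinct p \<Longrightarrow> good (set p) \<Longrightarrow> f (map uminus p) = f p"
  by (auto simp: neg_inv_def)

lemma decomp_perm:
  assumes "decomp n fA fD S LA LD" "mset LA = mset LA'" "mset LD = mset LD'"
  shows "decomp n fA fD S LA' LD'"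
  using assms(1) valid_perm[of "LA @ LD" "LA' @ LD'" n] assms(2,3)
    mset_eq_setD[OF assms(2)] mset_eq_setD[OF assms(3)]
  by (auto simp: decomp_def gens_union_def)

lemma valid_front: "valid n (LA @ q # LD) \<longleftrightarrow> valid n (q # LA @ LD)"
  using valid_perm[of "LA @ q # LD" "q # LA @ LD" n] valid_perm[of "q # LA @ LD" "LA @ q # LD" n]
  by auto

lemma decomp_negA: "decomp n fA fD S (p # LA) LD \<Longrightarrow> neg_inv fA \<Longrightarrow> decomp n fA fD S (map uminus p # LA) LD"
  using valid_uminus[of n p "LA @ LD"] valid_good1[of n "p # LA @ LD" p] valid_distinct1[of n "p # LA @ LD" p]
  by (auto simp: decomp_def gens_union_def neg_invD)

lemma decomp_negD: "decomp n fA fD S LA (q # LD) \<Longrightarrow> neg_inv fD \<Longrightarrow> decomp n fA fD S LA (map uminus q # LD)"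
  using valid_uminus[of n q "LA @ LD"] valid_good1[of n "q # LA @ LD" q] valid_distinct1[of n "q # LA @ LD" q]
  by (auto simp: decomp_def gens_union_def neg_invD valid_front)

lemma ex_front: "x \<in> set L \<Longrightarrow> \<exists>L'. mset L = mset (x # L')"
  by (metis insert_DiffM mset.simps(2) mset_remove1 set_mset_mset)

text \<open>The block through the line of \<open>a\<close> is moved to the front and, if it contains
  \<open>- a\<close> instead, switched as a whole.\<close>

lemma decomp_pick:
  assumes "decomp n fA fD S LA LD" "neg_inv fA" "neg_inv fD" "a \<in> pts n"
  obtains (A) p LA' where "decomp n fA fD S (p # LA') LD" "a \<in> set p"
  | (D) q LD' where "decomp n fA fD S LA (q # LD')" "a \<in> set q"
proof -
  obtain p where p: "p \<in> set LA \<or> p \<in> set LD" "a \<in> set p \<or> - a \<in> set p"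
    using valid_cover[of n "LA @ LD" a] assms by (auto simp: decomp_def)
  have um: "a \<in> set (map uminus p)" if "- a \<in> set p"
    using that by (metis add.inverse_inverse imageI set_map)
  from p(1) show ?thesis
  proof
    assume "p \<in> set LA"
    then obtain LA' where "mset LA = mset (p # LA')" using ex_front by metis
    then have "decomp n fA fD S (p # LA') LD" using decomp_perm[OF assms(1)] by simp
    then show ?thesis using A p(2) um decomp_negA assms(2) by blast
  next
    assume "p \<in> set LD"
    then obtain LD' where "mset LD = mset (p # LD')" using ex_front by metis
    then have "decomp n fA fD S LA (p # LD')" using decomp_perm[OF assms(1)] by simp
    then show ?thesis using D p(2) um decomp_negD assms(3) by blast
  qed
qed

text \<open>The second endpoint of an edge is normalized in the same way in another block. Blocks
  are switched independently, so the first one keeps its signs and the edge becomes positive between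
  the two lists.\<close>

lemma decomp_pickA:
  assumes s: "decomp n fA fD S (p # LA) LD" "neg_inv fA" "neg_inv fD" "b \<in> pts n" "\<not> (b \<in> set p \<or> - b \<in> set p)"
  obtains (A) q LA' where "decomp n fA fD S (p # q # LA') LD" "b \<in> set q"
  | (D) q LD' where "decomp n fA fD S (p # LA) (q # LD')" "b \<in> set q"
proof -
  obtain q where q: "q \<in> set LA \<or> q \<in> set LD" "b \<in> set q \<or> - b \<in> set q"
    using valid_cover[of n "p # LA @ LD" b] assms by (auto simp: decomp_def)
  have um: "b \<in> set (map uminus q)" if "- b \<in> set q"
    using that by (metis add.inverse_inverse imageI set_map)
  from q(1) show ?thesis
  proof
    assume "q \<in> set LA"
    then obtain LA' where "mset LA = mset (q # LA')" using ex_front by metis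
    then have 1: "decomp n fA fD S (q # p # LA') LD" using decomp_perm[OF s(1)] by simp
    have 2: "decomp n fA fD S (q # p # LA') LD \<Longrightarrow> decomp n fA fD S (p # q # LA') LD" for q
      using decomp_perm[of n fA fD S "q # p # LA'" LD "p # q # LA'" LD] by simp
    show ?thesis
    proof (cases "b \<in> set q")
      case True then show ?thesis using A 1 2 by blast
    next
      case False then show ?thesis using A decomp_negA[OF 1 assms(2)] 2 um q(2) by blast
    qed
  next
    assume "q \<in> set LD"
    then obtain LD' where "mset LD = mset (q # LD')" using ex_front by metis
    then have "decomp n fA fD S (p # LA) (q # LD')" using decomp_perm[OF s(1)] by simp
    then show ?thesis using D q(2) um decomp_negD assms(3) by blast
  qed
qed

lemma decomp_pickD:
  assumes s: "decomp n fA fD S LA (p # LD)" "neg_inv fA" "neg_inv fD" "b \<in> pts n" "\<not> (b \<in> set p \<or> - b \<in> set p)"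
  obtains (A) q LA' where "decomp n fA fD S (q # LA') (p # LD)" "b \<in> set q"
  | (D) q LD' where "decomp n fA fD S LA (p # q # LD')" "b \<in> set q"
proof -
  obtain q where q: "q \<in> set LA \<or> q \<in> set LD" "b \<in> set q \<or> - b \<in> set q"
    using valid_cover[of n "p # LA @ LD" b] assms by (auto simp: decomp_def valid_front)
  have um: "b \<in> set (map uminus q)" if "- b \<in> set q"
    using that by (metis add.inverse_inverse imageI set_map)
  from q(1) show ?thesis
  proof
    assume "q \<in> set LA"
    then obtain LA' where "mset LA = mset (q # LA')" using ex_front by metis
    then have "decomp n fA fD S (q # LA') (p # LD)" using decomp_perm[OF s(1)] by simp
    then show ?thesis using A q(2) um decomp_negA assms(2) by blast
  next
    assume "q \<in> set LD"
    then obtain LD' where "mset LD = mset (q # LD')" using ex_front by metis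
    then have 1: "decomp n fA fD S LA (q # p # LD')" using decomp_perm[OF s(1)] by simp
    have 2: "decomp n fA fD S LA (q # p # LD') \<Longrightarrow> decomp n fA fD S LA (p # q # LD')" for q
      using decomp_perm[of n fA fD S LA "q # p # LD'" LA "p # q # LD'"] by simp
    show ?thesis
    proof (cases "b \<in> set q")
      case True then show ?thesis using D 1 2 by blast
    next
      case False then show ?thesis using D decomp_negD[OF 1 assms(3)] 2 um q(2) by blast
    qed
  qed
qed

section \<open>The group of a system of blocks\<close>

abbreviation gA :: "int list \<Rightarrow> (int \<Rightarrow> int) set" where "gA p \<equiv> A_gens (set p)"
abbreviation gD :: "int list \<Rightarrow> (int \<Rightarrow> int) set" where "gD p \<equiv> D_gens (set p)"

lemma neg_inv_gens: "neg_inv (\<lambda>p. gA p)" "neg_inv (\<lambda>p. gD p)"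
  by (auto simp: neg_inv_def A_gens_uminus D_gens_uminus)

definition piece_group :: "int list list \<Rightarrow> int list list \<Rightarrow> (int \<Rightarrow> int) set" where
  "piece_group LA LD = gen (gens_union (\<lambda>p. gA p) (\<lambda>q. gD q) LA LD)"

text \<open>A type D block on one line would generate nothing and duplicate a type A singleton. On
  at least two lines it contains an element negating a given point, so the type can be recovered
  from the group.\<close>

definition pieces :: "nat \<Rightarrow> int list list \<Rightarrow> int list list \<Rightarrow> bool" where
  "pieces n LA LD \<longleftrightarrow> valid n (LA @ LD) \<and> (\<forall>q\<in>set LD. 2 \<le> length q)"

lemma D_gens_reflections: "good I \<Longrightarrow> I \<subseteq> pts n \<Longrightarrow> D_gens I \<subseteq> reflections n"
  unfolding D_gens_subset_iff
proof (intro ballI impI conjI)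
  fix x y assume g: "good I" "I \<subseteq> pts n" and xy: "x \<in> I" "y \<in> I" "x \<noteq> y"
  then have "\<bar>x\<bar> \<noteq> \<bar>y\<bar>" by (auto simp: good_def inj_on_def)
  then show "tp x y \<in> reflections n" "tp x (- y) \<in> reflections n"
    using g(2) xy by (auto intro!: reflectionsI)
qed

lemma gens_union_reflections:
  assumes "valid n (LA @ LD)"
  shows "gens_union (\<lambda>p. gA p) (\<lambda>q. gD q) LA LD \<subseteq> reflections n"
proof -
  have "gD p \<subseteq> reflections n" if "p \<in> set (LA @ LD)" for p
    by (rule D_gens_reflections[OF valid_good1[OF assms that]]) (use valid_pts[OF assms that] in blast)
  then show ?thesis unfolding gens_union_def using A_gens_D_gens by fastforce
qed

lemma piece_group_mem:
  assumes "x \<in> set p" "y \<in> set p" "x \<noteq> y"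
  shows "p \<in> set LA \<Longrightarrow> tp x y \<in> piece_group LA LD"
    and "p \<in> set LD \<Longrightarrow> tp x y \<in> piece_group LA LD"
    and "p \<in> set LD \<Longrightarrow> tp x (- y) \<in> piece_group LA LD"
  unfolding piece_group_def gens_union_def
  using A_gensI[OF assms] D_gensI[OF assms] by (auto intro!: gen_base)

lemma st_piece_group:
  assumes "decomp n (\<lambda>p. gA p) (\<lambda>q. gD q) S LA LD"
  shows "pieces n LA LD" "gen S = piece_group LA LD" "S \<subseteq> reflections n"
  using assms gens_union_reflections by (auto simp: decomp_def pieces_def piece_group_def)

lemma gen_insert_eqI:
  assumes "S \<subseteq> reflections n" "e \<in> reflections n" "T \<subseteq> reflections n"
    "S \<subseteq> gen T" "e \<in> gen T" "T \<subseteq> gen (insert e S)"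
  shows "gen (insert e S) = gen T"
  by (rule gen_eqI) (use assms invols_refl[of "insert e S" n] invols_refl[of T n] in auto)

lemma two_elems: "2 \<le> length q \<Longrightarrow> distinct q \<Longrightarrow> a \<in> set q \<Longrightarrow> \<exists>a'\<in>set q. a \<noteq> a'"
  by (metis One_nat_def Suc_1 distinct_card card_1_singletonE card_le_Suc0_iff_eq finite_set not_less_eq_eq)

lemma merge_good:
  assumes "valid n (p # q # L)"
  shows "good (set p \<union> set q)" "set p \<inter> set q = {}"
  using valid_good1[OF valid_merge[OF assms], of "p @ q"] valid_distinct[OF assms] by auto

text \<open>The effect of one more edge on the components: inside a type A block a positive edge is
  already present and a negative one turns the block into type D; a type D block absorbs every edge
  on its lines; an edge between two blocks merges them, with type D as soon as one of them has
  it.\<close>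

lemma insert_reflection_pieces:
  assumes pc: "pieces n LA LD" and e: "e \<in> reflections n"
  shows "\<exists>LA' LD'. pieces n LA' LD' \<and> gen (insert e (gens_union (\<lambda>p. gA p) (\<lambda>q. gD q) LA LD)) = piece_group LA' LD'"
proof -
  let ?U = "gens_union (\<lambda>p. gA p) (\<lambda>q. gD q)" and ?st = "decomp n (\<lambda>p. gA p) (\<lambda>q. gD q)"
  define S where "S = ?U LA LD"
  obtain a b where ab: "e = tp a b" "a \<in> pts n" "b \<in> pts n" "\<bar>a\<bar> \<noteq> \<bar>b\<bar>" "adm a b"
    using e by (rule reflectionsE)
  have st: "?st S LA LD" using pc by (simp add: decomp_def pieces_def S_def)
  have SR: "S \<subseteq> reflections n" using st st_piece_group by blast
  have merged: ?thesis if "?st T LA' LD'" "S \<subseteq> gen T" "e \<in> gen T" "T \<subseteq> gen (insert e S)" for T LA' LD'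
    using that gen_insert_eqI[OF SR e, of T] st_piece_group[OF that(1)] S_def by metis
  have Sb: "S \<subseteq> gen (insert e S)" "e \<in> gen (insert e S)" using gen_base by blast+
  have same: ?thesis if "e \<in> S" 
  proof -
    have "insert e S = S" using that by blast
    then show ?thesis using st_piece_group[OF st] S_def by metis
  qed
  show ?thesis
    using st neg_inv_gens ab(2)
  proof (cases rule: decomp_pick)
    case (A p LA')
    have vp: "valid n (p # LA' @ LD)" using A(1) by (simp add: decomp_def)
    note gp = valid_good1[OF vp, of p, simplified]
    have S1: "S = gA p \<union> ?U LA' LD" using A(1) by (auto simp: decomp_def gens_union_def)
    show ?thesis
    proof (cases "b \<in> set p \<or> - b \<in> set p")
      case True
      then show ?thesis
      proof
        assume "b \<in> set p"
        then have "e \<in> S" unfolding S1 ab(1) using A(2) ab(4) by (auto intro!: A_gensI)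
        then show ?thesis by (rule same)
      next
        \<comment> \<open>The representative of the line of \<open>b\<close> is \<open>- b\<close>,
          so \<open>tp a b\<close> is a negative edge of this block.\<close>
        assume b: "- b \<in> set p"
        let ?T = "?U LA' (p # LD)"
        have "length p = card (set p)" using distinct_card[OF valid_distinct1[OF vp, of p]] by simp
        moreover have "card {a, - b} \<le> card (set p)" using A(2) b by (intro card_mono) auto
        ultimately have "2 \<le> length p" using ab(4) by (auto simp: card_insert_if split: if_splits)
        then have T: "?st ?T LA' (p # LD)" using A(1) by (auto simp: decomp_def valid_front)
        show ?thesis
        proof (rule merged[OF T])
          show "S \<subseteq> gen ?T"
            unfolding S1 gens_union_def by (rule gen_superset) (use A_gens_D_gens in fastforce)
          show "e \<in> gen ?T"
            unfolding ab(1) gens_union_def using D_gensI(2)[OF A(2) b] ab(4) by (auto intro!: gen_base)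
          have "gD p \<subseteq> gen (insert e S)"
            by (rule D_make[OF gp, of _ a "- b"])
              (use A(2) b ab(1,4) Sb S1 in auto)
          then show "?T \<subseteq> gen (insert e S)" using Sb S1 unfolding gens_union_def by auto
        qed
      qed
    next
      case False
      show ?thesis using A(1) neg_inv_gens ab(3) False
      proof (cases rule: decomp_pickA)
        case A': (A q LA'')
        let ?T = "?U ((p @ q) # LA'') LD"
        have v: "valid n (p # q # LA'' @ LD)" using A'(1) by (simp add: decomp_def)
        have T: "?st ?T ((p @ q) # LA'') LD" using A'(1) valid_merge[OF v] by (simp add: decomp_def)
        have S2: "S = gA p \<union> gA q \<union> ?U LA'' LD" using A'(1) by (auto simp: decomp_def gens_union_def)
        show ?thesis
        proof (rule merged[OF T])
          have "gA p \<subseteq> gA (p @ q)" "gA q \<subseteq> gA (p @ q)" by (simp_all add: A_gens_mono)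
          then show "S \<subseteq> gen ?T" unfolding S2 gens_union_def by (intro gen_superset) fastforce
          show "e \<in> gen ?T"
            unfolding ab(1) gens_union_def using A_gensI[of a "set (p @ q)" b] A(2) A'(2) ab(4)
            by (auto intro!: gen_base)
          have "gA (p @ q) \<subseteq> gen (insert e S)"
            unfolding set_append
            by (rule A_merge[OF merge_good[OF v] _ _ A(2) A'(2)])
              (use S2 Sb ab(1) in auto)
          then show "?T \<subseteq> gen (insert e S)" using Sb S2 unfolding gens_union_def by auto
        qed
      next
        case (D q LD')
        let ?T = "?U LA' ((q @ p) # LD')"
        have v: "valid n (p # LA' @ q # LD')" using D(1) by (simp add: decomp_def)
        have v: "valid n (q # p # LA' @ LD')" using valid_perm[OF _ v, of "q # p # LA' @ LD'"] by simp
        have T: "?st ?T LA' ((q @ p) # LD')" using D(1) valid_merge[OF v] by (auto simp: decomp_def valid_front)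
        have S2: "S = gA p \<union> gD q \<union> ?U LA' LD'" using D(1) by (auto simp: decomp_def gens_union_def)
        have l: "2 \<le> length q" using D(1) by (simp add: decomp_def)
        obtain b' where b': "b' \<in> set q" "b \<noteq> b'"
          using two_elems[OF l _ D(2)] valid_distinct1[OF v, of q] by auto
        show ?thesis
        proof (rule merged[OF T])
          have "gA p \<subseteq> gD (q @ p)" "gD q \<subseteq> gD (q @ p)"
            by (simp_all add: A_gens_D_gens_mono D_gens_mono)
          then show "S \<subseteq> gen ?T" unfolding S2 gens_union_def by (intro gen_superset) fastforce
          show "e \<in> gen ?T"
            unfolding ab(1) gens_union_def using D_gensI(1)[of a "set (q @ p)" b] D(2) A(2) ab(4)
            by (auto intro!: gen_base)
          have "tp b a \<in> gen (insert e S)" using Sb(2) ab(1) tp_sym[OF ab(5)] by simp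
          then have "gD (q @ p) \<subseteq> gen (insert e S)"
            unfolding set_append
            by (intro D_merge[OF merge_good[OF v] _ _ D(2) b' A(2)])
              (use S2 Sb in auto)
          then show "?T \<subseteq> gen (insert e S)" using Sb S2 unfolding gens_union_def by auto
        qed
      qed
    qed
  next
    case (D p LD')
    have vp: "valid n (p # LA @ LD')" using D(1) by (simp add: decomp_def valid_front)
    note gp = valid_good1[OF vp, of p, simplified]
    have S1: "S = gD p \<union> ?U LA LD'" using D(1) by (auto simp: decomp_def gens_union_def)
    have l: "2 \<le> length p" using D(1) by (simp add: decomp_def)
    obtain a' where a': "a' \<in> set p" "a \<noteq> a'"
      using two_elems[OF l _ D(2)] valid_distinct1[OF vp, of p] by auto
    show ?thesis
    proof (cases "b \<in> set p \<or> - b \<in> set p")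
      case True
      then have "e \<in> S"
      proof
        assume "b \<in> set p"
        then show "e \<in> S" unfolding S1 ab(1) using D(2) ab(4) by (auto intro!: D_gensI)
      next
        assume "- b \<in> set p"
        then show "e \<in> S" unfolding S1 ab(1) using D_gensI(2)[of a "set p" "- b"] D(2) ab(4) by auto
      qed
      then show ?thesis by (rule same)
    next
      case False
      show ?thesis using D(1) neg_inv_gens ab(3) False
      proof (cases rule: decomp_pickD)
        case (A q LA')
        let ?T = "?U LA' ((p @ q) # LD')"
        have v: "valid n (q # LA' @ p # LD')" using A(1) by (simp add: decomp_def)
        have v: "valid n (p # q # LA' @ LD')" using valid_perm[OF _ v, of "p # q # LA' @ LD'"] by simp
        have T: "?st ?T LA' ((p @ q) # LD')" using A(1) valid_merge[OF v] by (auto simp: decomp_def valid_front)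
        have S2: "S = gD p \<union> gA q \<union> ?U LA' LD'" using A(1) by (auto simp: decomp_def gens_union_def)
        show ?thesis
        proof (rule merged[OF T])
          have "gA q \<subseteq> gD (p @ q)" "gD p \<subseteq> gD (p @ q)"
            by (simp_all add: A_gens_D_gens_mono D_gens_mono)
          then show "S \<subseteq> gen ?T" unfolding S2 gens_union_def by (intro gen_superset) fastforce
          show "e \<in> gen ?T"
            unfolding ab(1) gens_union_def using D_gensI(1)[of a "set (p @ q)" b] D(2) A(2) ab(4)
            by (auto intro!: gen_base)
          have "gD (p @ q) \<subseteq> gen (insert e S)"
            unfolding set_append
            by (rule D_merge[OF merge_good[OF v] _ _ D(2) a' A(2)])
              (use S2 Sb ab(1) in auto)
          then show "?T \<subseteq> gen (insert e S)" using Sb S2 unfolding gens_union_def by auto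
        qed
      next
        case D': (D q LD'')
        let ?T = "?U LA ((p @ q) # LD'')"
        have v: "valid n (LA @ p # q # LD'')" using D'(1) by (simp add: decomp_def)
        have v: "valid n (p # q # LA @ LD'')" using valid_perm[OF _ v, of "p # q # LA @ LD''"] by simp
        have T: "?st ?T LA ((p @ q) # LD'')" using D'(1) valid_merge[OF v] by (auto simp: decomp_def valid_front)
        have S2: "S = gD p \<union> gD q \<union> ?U LA LD''" using D'(1) by (auto simp: decomp_def gens_union_def)
        show ?thesis
        proof (rule merged[OF T])
          have "gD q \<subseteq> gD (p @ q)" "gD p \<subseteq> gD (p @ q)"
            by (auto simp: D_gens_mono)
          then show "S \<subseteq> gen ?T" unfolding S2 gens_union_def by (intro gen_superset) fastforce
          show "e \<in> gen ?T"
            unfolding ab(1) gens_union_def using D_gensI(1)[of a "set (p @ q)" b] D(2) D'(2) ab(4)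
            by (auto intro!: gen_base)
          have "gD (p @ q) \<subseteq> gen (insert e S)"
            unfolding set_append
            by (rule D_merge[OF merge_good[OF v] _ _ D(2) a' D'(2)])
              (use S2 Sb ab(1) A_gens_D_gens in auto)
          then show "?T \<subseteq> gen (insert e S)" using Sb S2 unfolding gens_union_def by auto
        qed
      qed
    qed
  qed
qed

lemma valid_singletons: "valid n (map (\<lambda>i. [i]) [1..int n])"
proof -
  have "concat (map (\<lambda>i. [i]) xs) = xs" for xs :: "int list" by (induction xs) auto
  moreover have "map abs [1..int n] = [1..int n]" by (rule map_idI) auto
  moreover have "abs ` {1..int n} = {1..int n}" by (auto simp: image_iff)
  moreover have "[] \<notin> set (map (\<lambda>i. [i]) [1..int n])" by force
  ultimately show ?thesis unfolding valid_def by simp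
qed

lemma reflection_subgroup_pieces:
  assumes "X \<subseteq> reflections n"
  shows "\<exists>LA LD. pieces n LA LD \<and> gen X = piece_group LA LD"
proof -
  have "finite X" using assms finite_reflections finite_subset by blast
  then show ?thesis using assms
  proof (induction X rule: finite_induct)
    case empty
    have "gA [i] = {}" for i by (auto simp: A_gens_def)
    then have "gens_union (\<lambda>p. gA p) (\<lambda>q. gD q) (map (\<lambda>i. [i]) [1..int n]) [] = {}" by (simp add: gens_union_def)
    then show ?case using valid_singletons[of n]
      by (intro exI[of _ "map (\<lambda>i. [i]) [1..int n]"] exI[of _ "[]"]) (simp add: pieces_def piece_group_def)
  next
    case (insert e X)
    then obtain LA LD where LL: "pieces n LA LD" "gen X = piece_group LA LD" by blast
    let ?U = "gens_union (\<lambda>p. gA p) (\<lambda>q. gD q) LA LD"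
    have gens_union: "?U \<subseteq> reflections n" using LL gens_union_reflections by (auto simp: pieces_def)
    \<comment> \<open>The generators treated so far may be replaced by all edges of their pieces,
      since both generate the same group.\<close>
    have "gen (insert e X) = gen (insert e ?U)"
    proof (rule gen_eqI)
      have *: "gen A \<subseteq> gen (insert e A)" for A using gen_mono by blast
      show "insert e X \<subseteq> gen (insert e ?U)"
        using gen_base[of e "insert e ?U"] *[of ?U] LL(2) gen_base[of _ X] unfolding piece_group_def by blast
      show "insert e ?U \<subseteq> gen (insert e X)"
        using gen_base[of e "insert e X"] *[of X] LL(2) gen_base[of _ ?U] unfolding piece_group_def by blast
    qed (use gens_union insert.prems invols_refl[of "insert e ?U" n] invols_refl[of "insert e X" n] in auto)
    then show ?case using insert_reflection_pieces[OF LL(1), of e] insert.prems by simp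
  qed
qed

section \<open>Standard representatives\<close>

definition match :: "int list \<Rightarrow> int list \<Rightarrow> int \<Rightarrow> int" where
  "match xs ys z = (case map_of (zip xs ys) z of Some y \<Rightarrow> y
     | None \<Rightarrow> (case map_of (zip xs ys) (- z) of Some y \<Rightarrow> - y | None \<Rightarrow> z))"

lemma match_nth:
  assumes "distinct xs" "good (set xs)" "length xs = length ys" "k < length xs"
  shows "match xs ys (xs ! k) = ys ! k" "match xs ys (- (xs ! k)) = - (ys ! k)"
proof -
  have "map_of (zip xs ys) (xs ! k) = Some (ys ! k)"
    using assms by (simp add: map_of_zip_nth)
  moreover have "- (xs ! k) \<notin> set xs"
    by (rule good_no_neg[OF assms(2)]) (use assms in auto)
  then have "map_of (zip xs ys) (- (xs ! k)) = None"
    using assms(3) by (simp add: map_of_zip_is_None)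
  ultimately show "match xs ys (xs ! k) = ys ! k" "match xs ys (- (xs ! k)) = - (ys ! k)"
    by (simp_all add: match_def)
qed

lemma match_other:
  assumes "length xs = length ys" "z \<notin> set xs" "- z \<notin> set xs"
  shows "match xs ys z = z"
  using assms by (simp add: match_def map_of_zip_is_None[THEN iffD2])

lemma signed_cases:
  assumes "abs ` set xs = {1..int n}" "z \<in> pts n"
  obtains k where "k < length xs" "z = xs ! k \<or> z = - (xs ! k)"
proof -
  have "\<bar>z\<bar> \<in> abs ` set xs" using assms by (simp add: pts_def)
  then obtain x where "x \<in> set xs" "\<bar>z\<bar> = \<bar>x\<bar>" by blast
  then show ?thesis using that by (auto simp: in_set_conv_nth abs_eq_iff)
qed

text \<open>Bijectivity holds because exchanging the two lists gives the inverse map.\<close>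

lemma match_WB:
  assumes x: "distinct xs" "good (set xs)" "abs ` set xs = {1..int n}"
    and y: "distinct ys" "good (set ys)" "abs ` set ys = {1..int n}"
    and l: "length xs = length ys"
  shows "match xs ys \<in> WB n"
proof (rule WBI)
  have out: "match xs ys z = z" if "z \<notin> pts n" "abs ` set xs = {1..int n}" "length xs = length ys"
    for z xs and ys :: "int list"
  proof (rule match_other[OF that(3)])
    have "\<bar>z\<bar> \<notin> abs ` set xs" using that by (simp add: pts_def)
    then show "z \<notin> set xs" "- z \<notin> set xs" by (auto simp: image_iff)
  qed
  then show "i \<notin> pts n \<Longrightarrow> match xs ys i = i" for i using l x by blast
  have inv: "match ys xs (match xs ys z) = z"
    if x: "distinct xs" "good (set xs)" "abs ` set xs = {1..int n}"
    and y: "distinct ys" "good (set ys)" "abs ` set ys = {1..int n}"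
    and l: "length xs = length ys" for xs ys z
  proof (cases "z \<in> pts n")
    case True
    from x(3) True obtain k where "k < length xs" "z = xs ! k \<or> z = - (xs ! k)" by (rule signed_cases)
    then show ?thesis using match_nth[OF x(1,2) l] match_nth[OF y(1,2)] l by auto
  next
    case False
    then show ?thesis using out[OF False x(3) l] out[OF False y(3) l[symmetric]] by simp
  qed
  show "bij (match xs ys)"
    by (rule o_bij[of "match ys xs"]) (rule ext, simp add: inv[OF x y l] inv[OF y x l[symmetric]])+
  show "match xs ys (- i) = - match xs ys i" for i
  proof (cases "i \<in> pts n")
    case True
    from x(3) True obtain k where "k < length xs" "i = xs ! k \<or> i = - (xs ! k)" by (rule signed_cases)
    then show ?thesis using match_nth[OF x(1,2) l] by auto
  next
    case False
    then show ?thesis using out x(3) l by simp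
  qed
qed

lemma concat_eq_lengths:
  "map length L = map length L' \<Longrightarrow> concat L = concat L' \<Longrightarrow> L = L'"
proof (induction L arbitrary: L')
  case (Cons p L)
  then obtain q M where "L' = q # M" by (cases L') auto
  then show ?case using Cons by auto
qed simp

text \<open>Up to W(B_n) only sizes and types of blocks matter: the concatenated lists are two
  systems of signed representatives of all lines, and W(B_n) permutes such systems
  transitively.\<close>

lemma WB_of_lists:
  assumes "valid n L" "valid n L'" "map length L = map length L'"
  shows "\<exists>g\<in>WB n. map (map g) L = L'"
proof -
  let ?g = "match (concat L) (concat L')"
  have l: "length (concat L) = length (concat L')" using assms valid_length by metis
  note facts = valid_distinct valid_good
  have a: "abs ` set (concat L) = {1..int n}" if "valid n L" for L using that by (simp add: valid_def)
  have "?g \<in> WB n"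
    by (rule match_WB[OF facts[OF assms(1)] a[OF assms(1)] facts[OF assms(2)] a[OF assms(2)] l])
  moreover have "map (map ?g) L = L'"
  proof (rule concat_eq_lengths)
    show "map length (map (map ?g) L) = map length L'" using assms(3) by (simp add: comp_def)
    have "map ?g (concat L) = concat L'"
      by (rule nth_equalityI) (use l match_nth(1)[OF facts[OF assms(1)] l] in auto)
    then show "concat (map (map ?g) L) = concat L'" by (simp add: map_concat)
  qed
  ultimately show ?thesis by blast
qed

text \<open>The ordered counterpart of \<open>blocks\<close>, which makes the standard subgroups
  instances of \<open>piece_group\<close>.\<close>

fun blists :: "nat \<Rightarrow> nat list \<Rightarrow> int list list" where
  "blists s [] = []"
| "blists s (a # as) = [int s + 1..int (s + a)] # blists (s + a) as"

lemma blocks_blists: "blocks s l = map set (blists s l)"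
  by (induction s l rule: blists.induct) auto

lemma length_blists [simp]: "map length (blists s l) = l"
  by (induction s l rule: blists.induct) auto

lemma length_blists_mem: "p \<in> set (blists s l) \<Longrightarrow> length p \<in> set l"
  by (induction s l rule: blists.induct) auto

lemma concat_blists: "concat (blists s l) = [int s + 1..int (s + sum_list l)]"
proof (induction s l rule: blists.induct)
  case (2 s a as)
  show ?case
  proof (cases "sum_list as = 0")
    case True
    then have c: "concat (blists (s + a) as) = []" and s: "sum_list (a # as) = a"
      using 2 by (simp_all del: sum_list_eq_0_iff concat_eq_Nil_conv)
    show ?thesis by (simp only: blists.simps concat.simps c s append_Nil2)
  next
    case False
    then have "1 \<le> sum_list as" by linarith
    then show ?thesis using 2 upto_split1[of "int s + 1" "int (s + a) + 1" "int (s + (a + sum_list as))"]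
      by (simp add: add.assoc)
  qed
qed simp

lemma blists_append: "blists s (l @ m) = blists s l @ blists (s + sum_list l) m"
  by (induction s l rule: blists.induct) (auto simp: add.assoc)

lemma valid_blists:
  assumes "sum_list l = n" "\<forall>x\<in>set l. 0 < x"
  shows "valid n (blists 0 l)"
proof -
  have "map abs [1..int n] = [1..int n]" by (rule map_idI) auto
  moreover have "abs ` {1..int n} = {1..int n}" by (auto simp: image_iff)
  moreover have "[] \<notin> set (blists 0 l)"
  proof
    assume "[] \<in> set (blists 0 l)"
    then have "0 \<in> set (map length (blists 0 l))" by (metis imageI list.set_map list.size(3))
    then show False using assms(2) by fastforce
  qed
  ultimately show ?thesis using assms(1) by (simp add: valid_def concat_blists del: set_concat)
qed

lemma Wlam_piece_group: "Wlam (l1, l2) = piece_group (blists 0 l1) (blists (sum_list l1) l2)"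
  by (simp add: Wlam_def piece_group_def gens_union_def blocks_blists)

lemma Wplus_piece_group: "Wplus l = piece_group (blists 0 l) []"
  by (simp add: Wplus_def piece_group_def gens_union_def blocks_blists)

lemma blists_pieces:
  assumes "double_partition n (l1, l2)" "gt1 l2"
  shows "pieces n (blists 0 l1) (blists (sum_list l1) l2)"
proof -
  have "valid n (blists 0 (l1 @ l2))"
    by (rule valid_blists) (use assms in \<open>auto simp: double_partition_def is_partition_def\<close>)
  moreover have "2 \<le> length q" if "q \<in> set (blists (sum_list l1) l2)" for q
  proof -
    have "1 < length q" using length_blists_mem[OF that] assms(2) by (simp add: gt1_def)
    then show ?thesis by simp
  qed
  ultimately show ?thesis by (simp add: pieces_def blists_append)
qed

section \<open>Conjugation of pieces by signed permutations\<close>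

lemma conj_A_gens:
  assumes "g \<in> WB n"
  shows "conj g ` A_gens I = A_gens (g ` I)"
proof -
  have c: "conj g (tp x y) = tp (g x) (g y)" for x y
    by (rule conj_tp[OF WB_bij[OF assms] WB_odd[OF assms]])
  show ?thesis
  proof
    have "A_gens I \<subseteq> {w. conj g w \<in> A_gens (g ` I)}"
      unfolding A_gens_subset_iff using c A_gensI[of _ "g ` I"] WB_inj[OF assms] by simp
    then show "conj g ` A_gens I \<subseteq> A_gens (g ` I)" by blast
    show "A_gens (g ` I) \<subseteq> conj g ` A_gens I"
      unfolding A_gens_subset_iff
    proof (intro ballI impI)
      fix a b assume "a \<in> g ` I" "b \<in> g ` I" "a \<noteq> b"
      then obtain x y where "x \<in> I" "y \<in> I" "x \<noteq> y" "tp a b = conj g (tp x y)" using c by auto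
      then show "tp a b \<in> conj g ` A_gens I" using A_gensI[of x I y] by simp
    qed
  qed
qed

lemma conj_D_gens:
  assumes "g \<in> WB n"
  shows "conj g ` D_gens I = D_gens (g ` I)"
proof -
  have c: "conj g (tp x y) = tp (g x) (g y)" for x y
    by (rule conj_tp[OF WB_bij[OF assms] WB_odd[OF assms]])
  have c': "conj g (tp x (- y)) = tp (g x) (- g y)" for x y
    using c[of x "- y"] WB_odd[OF assms] by simp
  show ?thesis
  proof
    have "D_gens I \<subseteq> {w. conj g w \<in> D_gens (g ` I)}"
      unfolding D_gens_subset_iff using c c' D_gensI[of _ "g ` I"] WB_inj[OF assms] by simp
    then show "conj g ` D_gens I \<subseteq> D_gens (g ` I)" by blast
    show "D_gens (g ` I) \<subseteq> conj g ` D_gens I"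
      unfolding D_gens_subset_iff
    proof (intro ballI impI)
      fix a b assume "a \<in> g ` I" "b \<in> g ` I" "a \<noteq> b"
      then obtain x y where "x \<in> I" "y \<in> I" "x \<noteq> y" "tp a b = conj g (tp x y)"
        "tp a (- b) = conj g (tp x (- y))" using c c' by auto
      then show "tp a b \<in> conj g ` D_gens I \<and> tp a (- b) \<in> conj g ` D_gens I"
        using D_gensI[of x I y] by simp
    qed
  qed
qed

lemma piece_group_conj:
  assumes g: "g \<in> WB n" and v: "valid n (LA @ LD)"
  shows "conj g ` piece_group LA LD = piece_group (map (map g) LA) (map (map g) LD)"
proof -
  have "conj g ` gens_union (\<lambda>p. gA p) (\<lambda>q. gD q) LA LD
      = gens_union (\<lambda>p. gA p) (\<lambda>q. gD q) (map (map g) LA) (map (map g) LD)"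
    by (simp add: gens_union_def image_Un image_UN conj_A_gens[OF g] conj_D_gens[OF g])
  then show ?thesis
    unfolding piece_group_def using gen_conj[OF WB_bij[OF g] invols_refl[OF gens_union_reflections[OF v]]] by simp
qed

lemma valid_map:
  assumes g: "g \<in> WB n" and v: "valid n L"
  shows "valid n (map (map g) L)"
proof -
  have c: "concat (map (map g) L) = map g (concat L)" by (simp add: map_concat)
  have "distinct (map abs (map g (concat L)))"
    using v WB_abs[OF g] by (simp add: valid_def distinct_map inj_on_def)
  moreover have "abs ` set (map g (concat L)) = {1..int n}"
  proof -
    have "abs ` set (map g (concat L)) = (\<lambda>x. \<bar>g x\<bar>) ` (abs ` set (concat L))"
      by (simp add: image_image WB_abs'[OF g])
    also have "\<dots> = {1..int n}" using v WB_permutes[OF g] by (simp add: valid_def bij_betw_def)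
    finally show ?thesis .
  qed
  moreover have "[] \<notin> set (map (map g) L)" using v by (auto simp: valid_def)
  ultimately show ?thesis unfolding valid_def c by blast
qed

lemma pieces_map: "g \<in> WB n \<Longrightarrow> pieces n LA LD \<Longrightarrow> pieces n (map (map g) LA) (map (map g) LD)"
  using valid_map[of g n "LA @ LD"] by (auto simp: pieces_def)

lemma piece_group_perm:
  "mset LA = mset LA' \<Longrightarrow> mset LD = mset LD' \<Longrightarrow> piece_group LA LD = piece_group LA' LD'"
  by (simp add: piece_group_def gens_union_def mset_eq_setD[of LA LA'] mset_eq_setD[of LD LD'])

lemma pieces_perm:
  "mset LA = mset LA' \<Longrightarrow> mset LD = mset LD' \<Longrightarrow> pieces n LA LD \<Longrightarrow> pieces n LA' LD'"
  using valid_perm[of "LA @ LD" "LA' @ LD'" n] mset_eq_setD[of LD LD'] by (simp add: pieces_def)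

text \<open>The diagonal elements of W(B_n), indexed by sets of lines; those of odd sets supply the
  elements outside W(D_n).\<close>

definition flip :: "int set \<Rightarrow> int \<Rightarrow> int" where
  "flip A z = (if \<bar>z\<bar> \<in> A then - z else z)"

lemma flip_abs [simp]: "\<bar>flip A z\<bar> = \<bar>z\<bar>"
  by (simp add: flip_def)

lemma flip_flip: "flip A \<circ> flip A = id"
  by (auto simp: flip_def)

lemma flip_WB: "A \<subseteq> {1..int n} \<Longrightarrow> flip A \<in> WB n"
  by (rule WBI) (auto simp: flip_def pts_def bij_invol[OF flip_flip])

lemma flip_WD: "A \<subseteq> {1..int n} \<Longrightarrow> flip A \<in> WD n \<longleftrightarrow> even (card A)"
proof -
  assume A: "A \<subseteq> {1..int n}"
  have "{i \<in> {1..int n}. flip A i < 0} = A" using A by (auto simp: flip_def)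
  then show ?thesis using flip_WB[OF A] by (simp add: WD_def WB_def)
qed

lemma tsign_flip: "tsign = flip {1}"
  by (rule ext) (auto simp: tsign_def flip_def)

lemma tsign_WB: "1 \<le> n \<Longrightarrow> tsign \<in> WB n" and tsign_not_WD: "1 \<le> n \<Longrightarrow> tsign \<notin> WD n"
  using flip_WB[of "{1}" n] flip_WD[of "{1}" n] by (auto simp: tsign_flip)

lemma tsign_tsign: "tsign \<circ> tsign = id"
  unfolding tsign_flip by (rule flip_flip)

text \<open>Changing the signs of a whole type A block keeps its edges positive, and a type D block
  tolerates any sign changes. Hence the condition on \<open>A\<close> concerns only
  \<open>LA\<close>.\<close>

lemma piece_group_flip:
  assumes v: "valid n (LA @ LD)" and A: "A \<subseteq> {1..int n}"
    and LA: "\<And>p. p \<in> set LA \<Longrightarrow> abs ` set p \<subseteq> A \<or> abs ` set p \<inter> A = {}"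
  shows "conj (flip A) ` piece_group LA LD = piece_group LA LD"
proof -
  have "gA (map (flip A) p) = gA p" if p: "p \<in> set LA" for p
    using LA[OF p]
  proof
    assume "abs ` set p \<subseteq> A"
    then have "flip A ` set p = uminus ` set p" by (intro image_cong) (auto simp: flip_def)
    moreover have "good (set p)" using valid_good1[OF v] p by simp
    ultimately show ?thesis by (simp add: A_gens_uminus)
  next
    assume "abs ` set p \<inter> A = {}"
    then have "flip A ` set p = id ` set p" by (intro image_cong) (auto simp: flip_def)
    then show ?thesis by simp
  qed
  moreover have "gD (map (flip A) q) = gD q" if q: "q \<in> set LD" for q
  proof (rule D_gens_abs_cong)
    show "good (set q)" using valid_good1[OF v] q by simp
    show "good (set (map (flip A) q))"
      using valid_good1[OF valid_map[OF flip_WB[OF A] v], of "map (flip A) q"] q by simp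
    show "abs ` set (map (flip A) q) = abs ` set q" by (simp add: image_image)
  qed
  ultimately have "gens_union (\<lambda>p. gA p) (\<lambda>q. gD q) (map (map (flip A)) LA) (map (map (flip A)) LD)
      = gens_union (\<lambda>p. gA p) (\<lambda>q. gD q) LA LD" by (simp add: gens_union_def)
  then show ?thesis using piece_group_conj[OF flip_WB[OF A] v] by (simp add: piece_group_def)
qed

text \<open>The normalizing element is a single sign change inside a type D block, or the sign
  change of a whole type A block of odd size. Composing with it moves a conjugating element from the
  other coset into W(D_n).\<close>

lemma piece_group_normalizer_odd:
  assumes pc: "pieces n LA LD" and "LD \<noteq> [] \<or> (\<exists>p\<in>set LA. odd (length p))"
  shows "\<exists>h\<in>WB n - WD n. conj h ` piece_group LA LD = piece_group LA LD"
proof -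
  have v: "valid n (LA @ LD)" using pc by (simp add: pieces_def)
  have sub: "abs ` set p \<subseteq> {1..int n}" if "p \<in> set (LA @ LD)" for p
    using valid_pts[OF v that] by (auto simp: pts_def)
  have "\<exists>A. A \<subseteq> {1..int n} \<and> odd (card A) \<and> conj (flip A) ` piece_group LA LD = piece_group LA LD"
    using assms(2)
  proof
    assume "LD \<noteq> []"
    then obtain q LD' where LD: "LD = q # LD'" by (cases LD) auto
    then have "q \<noteq> []" using pc by (auto simp: pieces_def)
    then have hd: "hd q \<in> set q" by simp
    have v': "valid n (q # LA @ LD')" using v LD by (simp add: valid_front)
    have "abs ` set p \<inter> {\<bar>hd q\<bar>} = {}" if "p \<in> set LA" for p
      using valid_disjoint[OF v' _ hd] that by auto
    moreover have "{\<bar>hd q\<bar>} \<subseteq> {1..int n}" using sub[of q] hd LD by auto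
    ultimately show ?thesis using piece_group_flip[OF v, of "{\<bar>hd q\<bar>}"]
      by (intro exI[of _ "{\<bar>hd q\<bar>}"]) auto
  next
    assume "\<exists>p\<in>set LA. odd (length p)"
    then obtain p where p: "p \<in> set LA" "odd (length p)" by blast
    then obtain LA' where LA': "mset LA = mset (p # LA')" using ex_front by metis
    have v': "valid n (p # LA' @ LD)" using valid_perm[OF _ v, of "p # LA' @ LD"] LA' by simp
    have "set LA = insert p (set LA')" using mset_eq_setD[OF LA'] by simp
    then have "abs ` set p' \<subseteq> abs ` set p \<or> abs ` set p' \<inter> abs ` set p = {}" if "p' \<in> set LA" for p'
      using valid_disjoint[OF v', of p'] that by force
    moreover have "card (abs ` set p) = length p"
      using valid_good1[OF v', of p] valid_distinct1[OF v', of p]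
      by (simp add: card_image good_def distinct_card)
    ultimately show ?thesis using piece_group_flip[OF v sub, of p] p sub[of p]
      by (intro exI[of _ "abs ` set p"]) auto
  qed
  then show ?thesis using flip_WB flip_WD by blast
qed

section \<open>Moving pieces into standard position\<close>

lemma is_partition_unique: "is_partition l \<Longrightarrow> is_partition l' \<Longrightarrow> mset l = mset l' \<Longrightarrow> l = l'"
proof -
  assume "is_partition l" "is_partition l'" "mset l = mset l'"
  then have "sorted (rev l)" "sorted (rev l')" "mset (rev l) = mset (rev l')"
    by (auto simp: is_partition_def sorted_wrt_rev)
  then have "rev l = rev l'" by (metis properties_for_sort)
  then show ?thesis by simp
qed

lemma sort_pieces:
  assumes "[] \<notin> set L"
  obtains L' where "mset L = mset L'" "is_partition (map length L')"
proof
  show "mset L = mset (rev (sort_key length L))" by simp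
  have "sorted (map length (sort_key length L))" by simp
  then show "is_partition (map length (rev (sort_key length L)))"
    using assms by (auto simp: is_partition_def rev_map[symmetric] sorted_wrt_rev)
qed

lemma pieces_standard:
  assumes pc: "pieces n LA LD"
  obtains l1 l2 g where "double_partition n (l1, l2)" "gt1 l2" "mset l1 = mset (map length LA)"
    "mset l2 = mset (map length LD)" "g \<in> WB n" "conj g ` piece_group LA LD = Wlam (l1, l2)"
proof -
  have ne: "[] \<notin> set LA" "[] \<notin> set LD" using pc by (auto simp: pieces_def valid_def)
  obtain LA' where A: "mset LA = mset LA'" "is_partition (map length LA')" by (rule sort_pieces[OF ne(1)])
  obtain LD' where D: "mset LD = mset LD'" "is_partition (map length LD')" by (rule sort_pieces[OF ne(2)])
  let ?l1 = "map length LA'" and ?l2 = "map length LD'"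
  have pc': "pieces n LA' LD'" by (rule pieces_perm[OF A(1) D(1) pc])
  then have v: "valid n (LA' @ LD')" by (simp add: pieces_def)
  have dp: "double_partition n (?l1, ?l2)"
    using A(2) D(2) valid_length[OF v] by (simp add: double_partition_def length_concat)
  have gt: "gt1 ?l2" using pc' by (auto simp: gt1_def pieces_def)
  have v2: "valid n (blists 0 ?l1 @ blists (sum_list ?l1) ?l2)"
    using blists_pieces[OF dp gt] by (simp add: pieces_def)
  obtain g where g: "g \<in> WB n" "map (map g) (LA' @ LD') = blists 0 ?l1 @ blists (sum_list ?l1) ?l2"
    using WB_of_lists[OF v v2] by auto
  have "length (map (map g) LA') = length (blists 0 ?l1)"
    using length_blists[of 0 ?l1] by (metis length_map)
  then have "map (map g) LA' = blists 0 ?l1 \<and> map (map g) LD' = blists (sum_list ?l1) ?l2"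
    using g(2) unfolding map_append by (metis append_eq_append_conv)
  then have "conj g ` piece_group LA' LD' = Wlam (?l1, ?l2)"
    using piece_group_conj[OF g(1) v] by (simp add: Wlam_piece_group)
  then have "conj g ` piece_group LA LD = Wlam (?l1, ?l2)" using piece_group_perm[OF A(1) D(1)] by simp
  moreover have "mset ?l1 = mset (map length LA)" "mset ?l2 = mset (map length LD)"
    using A(1) D(1) by simp_all
  ultimately show ?thesis using that[OF dp gt] g(1) by blast
qed

lemma conj_image_comp: "g \<in> WB n \<Longrightarrow> h \<in> WB n \<Longrightarrow> conj h ` conj g ` H = conj (h \<circ> g) ` H"
  by (simp add: image_image conj_conj WB_bij)

text \<open>A conjugating element outside W(D_n) is corrected on the right by an odd normalizing
  element. When all blocks are even of type A it is corrected on the left by \<open>tsign\<close>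
  instead, at the price of replacing \<open>Wplus l1\<close> by \<open>Wminus l1\<close>.\<close>

lemma pieces_conj_sub:
  assumes pc: "pieces n LA LD" and n: "1 \<le> n"
  obtains l1 l2 where "double_partition n (l1, l2)" "gt1 l2" "mset l1 = mset (map length LA)"
    "mset l2 = mset (map length LD)"
    "l2 \<noteq> [] \<or> \<not> even_part l1 \<Longrightarrow> conj_sub n (piece_group LA LD) (Wlam (l1, l2))"
    "l2 = [] \<Longrightarrow> even_part l1 \<Longrightarrow> conj_sub n (piece_group LA LD) (Wplus l1) \<or> conj_sub n (piece_group LA LD) (Wminus l1)"
proof -
  obtain l1 l2 g where dp: "double_partition n (l1, l2)" "gt1 l2" and m: "mset l1 = mset (map length LA)"
    "mset l2 = mset (map length LD)" and g: "g \<in> WB n" "conj g ` piece_group LA LD = Wlam (l1, l2)"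
    by (rule pieces_standard[OF pc])
  have 1: "conj_sub n (piece_group LA LD) (Wlam (l1, l2))" if "l2 \<noteq> [] \<or> \<not> even_part l1"
  proof (cases "g \<in> WD n")
    case True then show ?thesis using g unfolding conj_sub_def by blast
  next
    case False
    have "LD \<noteq> [] \<or> (\<exists>p\<in>set LA. odd (length p))"
    proof -
      have "set l1 = length ` set LA" using mset_eq_setD[OF m(1)] by simp
      then show ?thesis using that m(2) by (auto simp: even_part_def)
    qed
    then obtain h where h: "h \<in> WB n - WD n" "conj h ` piece_group LA LD = piece_group LA LD"
      using piece_group_normalizer_odd[OF pc] by blast
    then have "conj (g \<circ> h) ` piece_group LA LD = Wlam (l1, l2)"
      using g conj_image_comp[of h n g "piece_group LA LD"] by simp
    moreover have "g \<circ> h \<in> WD n" using WD_comp_odd g(1) False h(1) by blast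
    ultimately show ?thesis unfolding conj_sub_def by blast
  qed
  have 2: "conj_sub n (piece_group LA LD) (Wplus l1) \<or> conj_sub n (piece_group LA LD) (Wminus l1)" if "l2 = []"
  proof -
    have W: "conj g ` piece_group LA LD = Wplus l1" using g that by (simp add: Wlam_piece_group Wplus_piece_group)
    show ?thesis
    proof (cases "g \<in> WD n")
      case True then show ?thesis using W unfolding conj_sub_def by blast
    next
      case False
      then have "tsign \<circ> g \<in> WD n" using WD_comp_odd g(1) tsign_WB[OF n] tsign_not_WD[OF n] by blast
      moreover have "conj (tsign \<circ> g) ` piece_group LA LD = Wminus l1"
        using conj_image_comp[OF g(1) tsign_WB[OF n], of "piece_group LA LD"] W by (simp add: Wminus_def)
      ultimately show ?thesis unfolding conj_sub_def by blast
    qed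
  qed
  show ?thesis using that[OF dp m] 1 2 by blast
qed

section \<open>Classification up to conjugacy\<close>

lemma disjoint_lists:
  assumes "distinct (concat M)" "[] \<notin> set M"
  shows "distinct (map set M)" "distinct M"
proof -
  have "removeAll [] M = M" using assms(2) by simp
  then have d: "distinct M" and
    dis: "\<forall>p q. p \<in> set M \<and> q \<in> set M \<and> p \<noteq> q \<longrightarrow> set p \<inter> set q = {}"
    using assms(1) unfolding distinct_concat_iff by auto
  have "inj_on set (set M)"
  proof (rule inj_onI, rule ccontr)
    fix p q assume pq: "p \<in> set M" "q \<in> set M" "set p = set q" "p \<noteq> q"
    then have "set p \<inter> set q = {}" using dis by blast
    then show False using pq assms(2) by simp
  qed
  then show "distinct (map set M)" "distinct M" using d by (auto simp: distinct_map)
qed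

definition supp :: "int list \<Rightarrow> nat set" where
  "supp p = (\<lambda>x. nat \<bar>x\<bar>) ` set p"

lemma valid_supp:
  assumes v: "valid n L"
  shows "distinct (map supp L)" and "p \<in> set L \<Longrightarrow> card (supp p) = length p"
    and "\<Union> (supp ` set L) = {1..n}"
proof -
  let ?f = "\<lambda>x::int. nat \<bar>x\<bar>"
  have inj: "inj_on ?f (set (concat L))"
    using valid_good[OF v] by (auto simp: good_def inj_on_def)
  have "distinct (concat (map (map ?f) L))"
    using inj valid_distinct[OF v] unfolding map_concat[symmetric] distinct_map by blast
  moreover have "[] \<notin> set (map (map ?f) L)" using v by (auto simp: valid_def)
  ultimately have "distinct (map set (map (map ?f) L))" by (rule disjoint_lists)
  moreover have "map set (map (map ?f) L) = map supp L" by (simp add: supp_def)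
  ultimately show "distinct (map supp L)" by (simp only:)
  show "card (supp p) = length p" if "p \<in> set L"
  proof -
    have "inj_on ?f (set p)" by (rule inj_on_subset[OF inj]) (use that in auto)
    then show ?thesis using valid_distinct1[OF v that] by (simp add: supp_def card_image distinct_card)
  qed
  have "\<Union> (supp ` set L) = nat ` (abs ` set (concat L))" by (auto simp: supp_def image_iff)
  also have "\<dots> = nat ` {1..int n}" using v by (simp add: valid_def)
  also have "\<dots> = {1..n}"
  proof
    show "{1..n} \<subseteq> nat ` {1..int n}"
    proof
      fix x assume "x \<in> {1..n}"
      then show "x \<in> nat ` {1..int n}" by (intro image_eqI[of _ _ "int x"]) auto
    qed
  qed auto
  finally show "\<Union> (supp ` set L) = {1..n}" .
qed

text \<open>Both the cycle type of an element and the orbit type of a subgroup are read off a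
  decomposition into pieces by the following count.\<close>

lemma type_of_pieces:
  assumes v: "valid n (L1 @ L2)"
    and F: "\<And>p x. p \<in> set (L1 @ L2) \<Longrightarrow> x \<in> set p \<Longrightarrow> F (nat \<bar>x\<bar>) = supp p"
    and N1: "\<And>p. p \<in> set L1 \<Longrightarrow> \<not> N (supp p)"
    and N2: "\<And>p. p \<in> set L2 \<Longrightarrow> N (supp p)"
  shows "image_mset card (mset_set {C \<in> F ` {1..n}. \<not> N C}) = mset (map length L1)"
    and "image_mset card (mset_set {C \<in> F ` {1..n}. N C}) = mset (map length L2)"
proof -
  have im: "F ` {1..n} = supp ` set (L1 @ L2)"
  proof -
    have "F ` supp p = {supp p}" if p: "p \<in> set (L1 @ L2)" for p
    proof -
      have "p \<noteq> []" using v p by (auto simp: valid_def)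
      then have "supp p \<noteq> {}" by (simp add: supp_def)
      moreover have "F i = supp p" if "i \<in> supp p" for i using that F[OF p] by (auto simp: supp_def)
      ultimately show ?thesis by auto
    qed
    then have "(\<Union>p\<in>set (L1 @ L2). F ` supp p) = (\<Union>p\<in>set (L1 @ L2). {supp p})"
      by (intro SUP_cong) auto
    then show ?thesis unfolding valid_supp(3)[OF v, symmetric] image_Union image_image by auto
  qed
  have d: "distinct (map supp L1)" "distinct (map supp L2)" using valid_supp(1)[OF v] by simp_all
  have *: "image_mset card (mset_set (supp ` set M)) = mset (map length M)"
    if "distinct (map supp M)" "set M \<subseteq> set (L1 @ L2)" for M
  proof -
    have "mset_set (supp ` set M) = mset (map supp M)" using mset_set_set[OF that(1)] by simp
    then have "image_mset card (mset_set (supp ` set M)) = mset (map (\<lambda>p. card (supp p)) M)"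
      by (simp add: image_mset.compositionality comp_def)
    also have "map (\<lambda>p. card (supp p)) M = map length M"
      using that(2) valid_supp(2)[OF v] by (intro map_cong) auto
    finally show ?thesis .
  qed
  have "{C \<in> F ` {1..n}. \<not> N C} = supp ` set L1" "{C \<in> F ` {1..n}. N C} = supp ` set L2"
    unfolding im using N1 N2 by auto
  then show "image_mset card (mset_set {C \<in> F ` {1..n}. \<not> N C}) = mset (map length L1)"
    "image_mset card (mset_set {C \<in> F ` {1..n}. N C}) = mset (map length L2)"
    using *[OF d(1)] *[OF d(2)] by simp_all
qed

section \<open>An invariant of conjugacy classes of subgroups\<close>

definition line_orb :: "(int \<Rightarrow> int) set \<Rightarrow> nat \<Rightarrow> nat set" where
  "line_orb H i = {nat \<bar>h (int i)\<bar> | h. h \<in> H}"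

text \<open>Separates the two types of blocks: type D on at least two lines contains double sign
  changes, whereas a type A block is mapped to itself as a set of signed points.\<close>

definition neg_orb :: "(int \<Rightarrow> int) set \<Rightarrow> nat set \<Rightarrow> bool" where
  "neg_orb H C \<longleftrightarrow> (\<exists>j\<in>C. \<exists>h\<in>H. h (int j) = - int j)"

definition orbit_type :: "nat \<Rightarrow> (int \<Rightarrow> int) set \<Rightarrow> nat multiset \<times> nat multiset" where
  "orbit_type n H = (image_mset card (mset_set {C \<in> line_orb H ` {1..n}. \<not> neg_orb H C}),
     image_mset card (mset_set {C \<in> line_orb H ` {1..n}. neg_orb H C}))"

lemma valid_disjoint2:
  assumes "valid n L" "p \<in> set L" "q \<in> set L" "p \<noteq> q" "x \<in> set p" "y \<in> set q"
  shows "\<bar>x\<bar> \<noteq> \<bar>y\<bar>"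
proof -
  obtain L' where L': "mset L = mset (p # L')" using ex_front assms(2) by metis
  then have "q \<in> set L'" using assms(3,4) mset_eq_setD[OF L'] by auto
  then show ?thesis using valid_disjoint[OF valid_perm[OF L' assms(1)]] assms(5,6) by blast
qed

lemma piece_group_subset_WD: "valid n (LA @ LD) \<Longrightarrow> piece_group LA LD \<subseteq> WD n"
  unfolding piece_group_def by (rule gen_WD) (rule gens_union_reflections)

lemma gens_union_cases:
  assumes "s \<in> gens_union (\<lambda>p. gA p) (\<lambda>q. gD q) LA LD"
  obtains (A) x y p where "p \<in> set LA" "x \<in> set p" "y \<in> set p" "x \<noteq> y" "s = tp x y"
  | (D) x y q where "q \<in> set LD" "x \<in> set q" "y \<in> set q" "x \<noteq> y" "s = tp x y \<or> s = tp x (- y)"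
proof -
  consider p where "p \<in> set LA" "s \<in> gA p" | q where "q \<in> set LD" "s \<in> gD q"
    using assms unfolding gens_union_def by blast
  then show ?thesis
  proof cases
    case (1 p) then show ?thesis using A unfolding A_gens_def by blast
  next
    case (2 q) then show ?thesis using D unfolding D_gens_def A_gens_def by blast
  qed
qed

lemma piece_group_preserves:
  assumes v: "valid n (LA @ LD)" and h: "h \<in> piece_group LA LD"
  shows "p \<in> set LA \<Longrightarrow> x \<in> set p \<Longrightarrow> h x \<in> set p"
    and "q \<in> set LD \<Longrightarrow> \<bar>x\<bar> \<in> abs ` set q \<Longrightarrow> \<bar>h x\<bar> \<in> abs ` set q"
proof -
  let ?G = "gens_union (\<lambda>p. gA p) (\<lambda>q. gD q) LA LD"
  let ?K = "{h. (\<forall>p\<in>set LA. \<forall>x\<in>set p. h x \<in> set p) \<and>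
    (\<forall>q\<in>set LD. \<forall>x. \<bar>x\<bar> \<in> abs ` set q \<longrightarrow> \<bar>h x\<bar> \<in> abs ` set q)}"
  have v': "valid n (p # q # L)" if "mset (LA @ LD) = mset (p # q # L)" for p q L
    using valid_perm[OF that v] .
  have AD: "p \<noteq> q" if "p \<in> set LA" "q \<in> set LD" for p q
  proof -
    have "distinct (LA @ LD)" by (rule disjoint_lists[OF valid_distinct[OF v]]) (use v in \<open>simp add: valid_def\<close>)
    then show ?thesis using that by auto
  qed
  note dis = valid_disjoint2[OF v]
  have "gen ?G \<subseteq> ?K"
  proof (rule gen_closed)
    show "invols ?G" by (rule invols_refl[OF gens_union_reflections[OF v]])
    show "id \<in> ?K" by simp
    fix s g assume s: "s \<in> ?G" and g: "g \<in> ?K"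
    from s have "s \<in> ?K"
    proof (cases rule: gens_union_cases)
      case (A u w p)
      have "s x \<in> set p'" if "p' \<in> set LA" "x \<in> set p'" for p' x
      proof (cases "p' = p")
        case True
        have gp: "good (set p)" using valid_good1[OF v] A(1) by simp
        then have "x \<noteq> - u" "x \<noteq> - w" using good_no_neg[OF gp] A that True by auto
        then show ?thesis using A that True by (simp add: tp_def)
      next
        case False
        then have "\<bar>x\<bar> \<noteq> \<bar>u\<bar>" "\<bar>x\<bar> \<noteq> \<bar>w\<bar>" using dis[of p' p x] A that by auto
        then show ?thesis using A that by (simp add: tp_other)
      qed
      moreover have "s x = x" if "q \<in> set LD" "\<bar>x\<bar> \<in> abs ` set q" for q x
      proof -
        have "\<bar>x\<bar> \<noteq> \<bar>u\<bar>" "\<bar>x\<bar> \<noteq> \<bar>w\<bar>" using dis[of p q u] dis[of p q w] AD[OF A(1) that(1)] A that by auto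
        then show ?thesis using A that by (simp add: tp_other)
      qed
      ultimately show ?thesis by simp
    next
      case (D u w q)
      have "s x = x" if "p \<in> set LA" "x \<in> set p" for p x
      proof -
        have "\<bar>x\<bar> \<noteq> \<bar>u\<bar>" "\<bar>x\<bar> \<noteq> \<bar>w\<bar>" using dis[of p q x] AD[OF that(1) D(1)] D that by auto
        then show ?thesis using D by (auto simp: tp_other)
      qed
      moreover have "\<bar>s x\<bar> \<in> abs ` set q'" if "q' \<in> set LD" "\<bar>x\<bar> \<in> abs ` set q'" for q' x
      proof (cases "q' = q")
        case True
        then show ?thesis using D that by (auto simp: tp_def)
      next
        case False
        then have "\<bar>x\<bar> \<noteq> \<bar>u\<bar>" "\<bar>x\<bar> \<noteq> \<bar>w\<bar>" using dis[of q q' u] dis[of q q' w] D that by auto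
        then show ?thesis using D that by (auto simp: tp_other)
      qed
      ultimately show ?thesis by simp
    qed
    then show "s \<circ> g \<in> ?K" using g by simp
  qed
  then have "h \<in> ?K" using h unfolding piece_group_def by blast
  then show "p \<in> set LA \<Longrightarrow> x \<in> set p \<Longrightarrow> h x \<in> set p"
    and "q \<in> set LD \<Longrightarrow> \<bar>x\<bar> \<in> abs ` set q \<Longrightarrow> \<bar>h x\<bar> \<in> abs ` set q" by blast+
qed

lemma piece_group_id: "id \<in> piece_group LA LD"
  unfolding piece_group_def by (rule gen.gen_id)

lemma orbit_type_piece_group:
  assumes pc: "pieces n LA LD"
  shows "orbit_type n (piece_group LA LD) = (mset (map length LA), mset (map length LD))"
proof -
  have v: "valid n (LA @ LD)" using pc by (simp add: pieces_def)
  let ?H = "piece_group LA LD"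
  have WB: "h \<in> WB n" if "h \<in> ?H" for h using piece_group_subset_WD[OF v] that WD_WB by blast
  have orb: "line_orb ?H (nat \<bar>x\<bar>) = {nat \<bar>h x\<bar> | h. h \<in> ?H}" for x
    unfolding line_orb_def by simp (metis WB WB_abs')
  have F: "line_orb ?H (nat \<bar>x\<bar>) = supp p" if p: "p \<in> set (LA @ LD)" "x \<in> set p" for p x
  proof
    show "line_orb ?H (nat \<bar>x\<bar>) \<subseteq> supp p"
    proof
      fix y assume "y \<in> line_orb ?H (nat \<bar>x\<bar>)"
      then obtain h where h: "y = nat \<bar>h x\<bar>" "h \<in> ?H" using orb by auto
      have "\<bar>h x\<bar> \<in> abs ` set p"
        using piece_group_preserves[OF v h(2)] p by auto
      then show "y \<in> supp p" using h by (auto simp: supp_def)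
    qed
    show "supp p \<subseteq> line_orb ?H (nat \<bar>x\<bar>)"
    proof
      fix z assume "z \<in> supp p"
      then obtain y where y: "y \<in> set p" "z = nat \<bar>y\<bar>" by (auto simp: supp_def)
      have "\<exists>h\<in>?H. h x = y"
      proof (cases "x = y")
        case True then show ?thesis using piece_group_id by (metis id_apply)
      next
        case False
        then have "tp x y \<in> ?H" using piece_group_mem(1,2)[OF p(2) y(1) False] p(1) by auto
        then show ?thesis by (metis tp_left)
      qed
      then show "z \<in> line_orb ?H (nat \<bar>x\<bar>)" using orb y by auto
    qed
  qed
  have N1: "\<not> neg_orb ?H (supp p)" if p: "p \<in> set LA" for p
  proof
    assume "neg_orb ?H (supp p)"
    then obtain x h where x: "x \<in> set p" "h \<in> ?H" "h \<bar>x\<bar> = - \<bar>x\<bar>" by (auto simp: neg_orb_def supp_def)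
    then have "h x = - x" using WB_odd[OF WB[OF x(2)], of x] by (cases "x \<ge> 0") auto
    then have "- x \<in> set p" using piece_group_preserves(1)[OF v x(2) p x(1)] by simp
    then show False using good_no_neg[of "set p" x] valid_good1[OF v] p x(1) by simp
  qed
  have N2: "neg_orb ?H (supp q)" if q: "q \<in> set LD" for q
  proof -
    have l: "2 \<le> length q" using pc q by (simp add: pieces_def)
    then obtain x where x: "x \<in> set q" by (cases q) auto
    obtain y where y: "y \<in> set q" "x \<noteq> y"
      using two_elems[OF l valid_distinct1[OF v] x] q by auto
    have a: "adm x y" using good_adm[OF valid_good1[OF v, of q] x y] q by simp
    \<comment> \<open>The two reflections on the lines of \<open>x\<close> and \<open>y\<close>
      compose to the sign change on both lines.\<close>
    let ?h = "tp x y \<circ> tp x (- y)"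
    have h: "?h \<in> ?H" using piece_group_mem(2,3)[OF x y q] gen_comp unfolding piece_group_def by blast
    have hx: "?h x = - x" by (simp add: tp_odd[OF a])
    then have "?h \<bar>x\<bar> = - \<bar>x\<bar>" using WB_odd[OF WB[OF h], of x] by (cases "x \<ge> 0") auto
    then show ?thesis unfolding neg_orb_def supp_def
      using h x by (intro bexI[of _ "nat \<bar>x\<bar>"] bexI[of _ ?h]) auto
  qed
  show ?thesis unfolding orbit_type_def
    using type_of_pieces[where F = "line_orb ?H" and N = "neg_orb ?H", OF v F N1 N2] by simp
qed

lemma orbit_type_conj:
  assumes "g \<in> WB n" "pieces n LA LD"
  shows "orbit_type n (conj g ` piece_group LA LD) = (mset (map length LA), mset (map length LD))"
proof -
  have "valid n (LA @ LD)" using assms by (simp add: pieces_def)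
  then show ?thesis
    using piece_group_conj[OF assms(1), of LA LD] orbit_type_piece_group[OF pieces_map[OF assms]] by (simp add: comp_def)
qed

lemma Wlam_conj_eq:
  assumes "double_partition n (l1, l2)" "gt1 l2" "double_partition n (m1, m2)" "gt1 m2"
    and "g \<in> WB n" "conj g ` Wlam (l1, l2) = Wlam (m1, m2)"
  shows "l1 = m1" "l2 = m2"
proof -
  have "(mset l1, mset l2) = (mset m1, mset m2)"
    using orbit_type_conj[OF assms(5) blists_pieces[OF assms(1,2)]]
      orbit_type_piece_group[OF blists_pieces[OF assms(3,4)]] assms(6) by (simp add: Wlam_piece_group)
  then show "l1 = m1" "l2 = m2"
    using assms(1,3) is_partition_unique by (auto simp: double_partition_def)
qed

text \<open>The number of sign changes on a block is 0 or its even size, so each block contributes a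
  factor 1 to \<open>eps\<close>.\<close>

lemma WD_of_even_blocks:
  assumes h: "h \<in> WB n" and v: "valid n L"
    and L: "\<And>p. p \<in> set L \<Longrightarrow> even (length p)"
    and pos: "\<And>p x. p \<in> set L \<Longrightarrow> x \<in> set p \<Longrightarrow> 0 < x"
    and sgn: "\<And>p x y. p \<in> set L \<Longrightarrow> x \<in> set p \<Longrightarrow> y \<in> set p \<Longrightarrow> sgn (h x) = sgn (h y)"
  shows "h \<in> WD n"
proof -
  have "set (concat L) = abs ` set (concat L)" using pos by (force simp: image_iff)
  then have s: "set (concat L) = {1..int n}" using v by (simp add: valid_def)
  have block: "prod_list (map (\<lambda>i. sgn (h i)) p) = 1" if p: "p \<in> set L" for p
  proof -
    have "p \<noteq> []" using p v by (auto simp: valid_def)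
    then have hd: "hd p \<in> set p" by simp
    then have "h (hd p) \<noteq> 0"
      using valid_pts[OF v p hd] WB_pts[OF h, of "hd p"] pts_nz by blast
    then have "sgn (h (hd p)) = 1 \<or> sgn (h (hd p)) = -1" by (auto simp: sgn_if)
    moreover have "map (\<lambda>i. sgn (h i)) p = replicate (length p) (sgn (h (hd p)))"
      using sgn[OF p _ hd] by (intro nth_equalityI) auto
    ultimately show ?thesis using L[OF p] by (auto simp: prod_list_replicate)
  qed
  have "eps n h = prod_list (map (\<lambda>i. sgn (h i)) (concat L))"
    unfolding eps_def s[symmetric] using valid_distinct[OF v] by (simp add: prod.distinct_set_conv_list del: set_concat)
  also have "\<dots> = 1" using block by (induction L) auto
  finally show ?thesis using h by (simp add: WD_eps)
qed

section \<open>The two groups attached to an even partition\<close>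

lemma even_blists:
  assumes "partition_of n l" "even_part l"
  shows "valid n (blists 0 l)" "pieces n (blists 0 l) []" "\<And>p. p \<in> set (blists 0 l) \<Longrightarrow> even (length p)"
    "\<And>p x. p \<in> set (blists 0 l) \<Longrightarrow> x \<in> set p \<Longrightarrow> 0 < x"
proof -
  show v: "valid n (blists 0 l)"
    by (rule valid_blists) (use assms in \<open>auto simp: partition_of_def is_partition_def\<close>)
  then show "pieces n (blists 0 l) []" by (simp add: pieces_def)
  show "\<And>p. p \<in> set (blists 0 l) \<Longrightarrow> even (length p)"
    using assms(2) length_blists_mem by (auto simp: even_part_def)
  fix p x assume px: "p \<in> set (blists 0 l)" "x \<in> set p"
  then have "x \<in> set (concat (blists 0 l))" by auto
  then show "0 < x" unfolding concat_blists by simp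
qed

lemma Wplus_pos:
  assumes "partition_of n l" "even_part l" "w \<in> Wplus l" "x \<in> pts n" "0 < x"
  shows "0 < w x"
proof -
  note b = even_blists[OF assms(1,2)]
  obtain p where p: "p \<in> set (blists 0 l)" "x \<in> set p \<or> - x \<in> set p"
    using valid_cover[OF b(1) assms(4)] by blast
  then have "x \<in> set p" using b(4)[OF p(1), of "- x"] assms(5) by auto
  then have "w x \<in> set p"
    using piece_group_preserves(1)[of n "blists 0 l" "[]" w p x] b(1) assms(3) p(1) by (simp add: Wplus_piece_group)
  then show ?thesis using b(4) p(1) by blast
qed

text \<open>A conjugating element has constant sign on each block, as conjugates of pure
  transpositions are pure.\<close>

lemma Wplus_conj_WD:
  assumes l: "partition_of n l" "even_part l" and m: "partition_of n m" "even_part m"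
    and h: "h \<in> WB n" and eq: "conj h ` Wplus l \<subseteq> Wplus m"
  shows "h \<in> WD n"
proof (rule WD_of_even_blocks[OF h even_blists(1,3,4)[OF l]])
  fix p x y assume p: "p \<in> set (blists 0 l)" and x: "x \<in> set p" and y: "y \<in> set p"
  note v = even_blists(1)[OF l]
  show "sgn (h x) = sgn (h y)"
  proof (cases "x = y")
    case False
    have "tp x y \<in> Wplus l" unfolding Wplus_piece_group using piece_group_mem(1)[OF x y False p] .
    then have t: "tp (h x) (h y) \<in> Wplus m"
      using eq conj_tp[OF WB_bij[OF h] WB_odd[OF h], of x y] by auto
    have P: "h x \<in> pts n" "h y \<in> pts n" using valid_pts[OF v p] x y WB_pts[OF h] by auto
    have "0 < h y" if "0 < h x" using Wplus_pos[OF m t P(1) that] by simp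
    moreover have "0 < h x" if "0 < h y" using Wplus_pos[OF m t P(2) that] by simp
    ultimately show ?thesis using pts_nz[OF P(1)] pts_nz[OF P(2)] by (auto simp: sgn_if)
  qed simp
qed

lemma conj_sub_sym: "conj_sub n H K \<Longrightarrow> conj_sub n K H"
proof -
  assume "conj_sub n H K"
  then obtain g where g: "g \<in> WD n" "K = conj g ` H" by (auto simp: conj_sub_def)
  then have "H = conj (inv g) ` K" by (simp add: image_image conj_inv WB_bij[OF WD_WB])
  then show ?thesis using g WD_inv unfolding conj_sub_def by blast
qed

lemma conj_sub_trans: "conj_sub n H K \<Longrightarrow> conj_sub n K M \<Longrightarrow> conj_sub n H M"
proof -
  assume "conj_sub n H K" "conj_sub n K M"
  then obtain g h where g: "g \<in> WD n" "K = conj g ` H" and h: "h \<in> WD n" "M = conj h ` K"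
    unfolding conj_sub_def by blast
  then have "M = conj (h \<circ> g) ` H" using conj_image_comp[of g n h H] WD_WB by simp
  then show ?thesis using g h WD_comp unfolding conj_sub_def by blast
qed

text \<open>If \<open>g\<close> were a conjugator, \<open>tsign \<circ> g\<close> would carry
  \<open>Wplus l\<close> to \<open>Wplus m\<close> and so lie in W(D_n); then \<open>tsign\<close>
  would lie there too.\<close>

lemma Wplus_not_conj_Wminus:
  assumes n: "1 \<le> n" and l: "partition_of n l" "even_part l" and m: "partition_of n m" "even_part m"
  shows "\<not> conj_sub n (Wplus l) (Wminus m)"
proof
  assume "conj_sub n (Wplus l) (Wminus m)"
  then obtain g where g: "g \<in> WD n" "Wminus m = conj g ` Wplus l" by (auto simp: conj_sub_def)
  let ?h = "tsign \<circ> g"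
  have h: "?h \<in> WB n" using WB_comp tsign_WB[OF n] WD_WB[OF g(1)] by blast
  have "conj ?h ` Wplus l = conj tsign ` conj tsign ` Wplus m"
    using conj_image_comp[OF WD_WB[OF g(1)] tsign_WB[OF n], of "Wplus l"] g(2) by (simp add: Wminus_def)
  also have "\<dots> = Wplus m"
    using conj_image_comp[OF tsign_WB[OF n] tsign_WB[OF n], of "Wplus m"] by (simp add: tsign_tsign)
  finally have "?h \<in> WD n" using Wplus_conj_WD[OF l m h] by blast
  then have "?h \<circ> inv g \<in> WD n" using WD_comp WD_inv g(1) by blast
  moreover have "?h \<circ> inv g = tsign"
    using surj_iff[of g] bij_is_surj[OF WB_bij[OF WD_WB[OF g(1)]]] by (simp add: comp_assoc)
  ultimately show False using tsign_not_WD[OF n] by simp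
qed

section \<open>Systems of representatives\<close>

lemma partition_double: "partition_of n l \<longleftrightarrow> double_partition n (l, [])"
  by (simp add: partition_of_def double_partition_def is_partition_def)

lemma gt1_Nil [simp]: "gt1 []"
  by (simp add: gt1_def)

lemma Wplus_Wlam: "Wplus l = Wlam (l, [])"
  by (simp add: Wplus_piece_group Wlam_piece_group)

lemma refl_subgroup_piece_group: "valid n (LA @ LD) \<Longrightarrow> refl_subgroup n (piece_group LA LD)"
  unfolding refl_subgroup_def piece_group_def using gens_union_reflections by blast

lemma refl_subgroup_Wlam: "double_partition n (l1, l2) \<Longrightarrow> gt1 l2 \<Longrightarrow> refl_subgroup n (Wlam (l1, l2))"
  using refl_subgroup_piece_group blists_pieces by (simp add: Wlam_piece_group pieces_def)

lemma Wminus_piece_group: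
  assumes "1 \<le> n" "partition_of n l" "even_part l"
  shows "Wminus l = piece_group (map (map tsign) (blists 0 l)) []" "pieces n (map (map tsign) (blists 0 l)) []"
  using piece_group_conj[OF tsign_WB[OF assms(1)], of "blists 0 l" "[]"] even_blists(1)[OF assms(2,3)]
    pieces_map[OF tsign_WB[OF assms(1)] even_blists(2)[OF assms(2,3)]]
  by (simp_all add: Wminus_def Wplus_piece_group)

text \<open>An odd \<open>n\<close> has no partition into even parts, so every class of reflection
  subgroups under W(B_n) is a single class under W(D_n).\<close>

lemma is_reps_odd:
  assumes "1 \<le> n" "odd n"
  shows "is_reps n {Wlam lam | lam. double_partition n lam \<and> gt1 (snd lam)}"
  unfolding is_reps_def
proof (intro conjI ballI allI impI)
  fix H assume "H \<in> {Wlam lam | lam. double_partition n lam \<and> gt1 (snd lam)}"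
  then show "refl_subgroup n H" using refl_subgroup_Wlam by auto
next
  fix H assume "refl_subgroup n H"
  then obtain X where "X \<subseteq> reflections n" "H = gen X" by (auto simp: refl_subgroup_def)
  then obtain LA LD where pc: "pieces n LA LD" and H: "H = piece_group LA LD"
    using reflection_subgroup_pieces by blast
  obtain l1 l2 where l: "double_partition n (l1, l2)" "gt1 l2"
    "l2 \<noteq> [] \<or> \<not> even_part l1 \<Longrightarrow> conj_sub n (piece_group LA LD) (Wlam (l1, l2))"
    using pieces_conj_sub[OF pc assms(1)] by metis
  have "l2 \<noteq> [] \<or> \<not> even_part l1"
  proof (rule ccontr)
    assume "\<not> ?thesis"
    then have "sum_list l1 = n" "\<forall>x\<in>set l1. even x" using l(1) by (auto simp: double_partition_def even_part_def)
    moreover have "(\<forall>x\<in>set l1. even x) \<Longrightarrow> even (sum_list l1)" for l1 :: "nat list" by (induction l1) auto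
    ultimately show False using assms(2) by blast
  qed
  then have "conj_sub n H (Wlam (l1, l2))" using l(3) H by blast
  then show "\<exists>K\<in>{Wlam lam | lam. double_partition n lam \<and> gt1 (snd lam)}. conj_sub n H K"
    using l(1,2) by (intro bexI[of _ "Wlam (l1, l2)"]) auto
next
  fix H K assume "H \<in> {Wlam lam | lam. double_partition n lam \<and> gt1 (snd lam)}"
    "K \<in> {Wlam lam | lam. double_partition n lam \<and> gt1 (snd lam)}" "conj_sub n H K"
  then obtain lam mu g where lam: "double_partition n lam" "gt1 (snd lam)" "H = Wlam lam"
    and mu: "double_partition n mu" "gt1 (snd mu)" "K = Wlam mu" and g: "g \<in> WD n" "K = conj g ` H"
    unfolding conj_sub_def by blast
  have "lam = mu"
    using Wlam_conj_eq[of n "fst lam" "snd lam" "fst mu" "snd mu" g] lam mu g WD_WB[OF g(1)]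
    by (simp add: prod_eq_iff)
  then show "H = K" using lam mu by simp
qed

text \<open>The uniqueness part for even \<open>n\<close> passes through \<open>W(B\<^sub>n)\<close>, where \<open>W\<^sup>-\<close> and \<open>W\<^sup>+\<close> are
  conjugate and the double partition is the only invariant.\<close>

lemma is_reps_even:
  assumes n: "1 \<le> n"
  shows "is_reps n ({Wlam lam | lam. double_partition n lam \<and> gt1 (snd lam) \<and>
                     (snd lam = [] \<longrightarrow> \<not> even_part (fst lam))}
                  \<union> {Wplus l | l. partition_of n l \<and> even_part l}
                  \<union> {Wminus l | l. partition_of n l \<and> even_part l})" (is "is_reps n ?R")
proof -
  have shape: "\<exists>l1 l2 g. double_partition n (l1, l2) \<and> gt1 l2 \<and> g \<in> WB n \<and> H = conj g ` Wlam (l1, l2) \<and>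
      (H = Wlam (l1, l2) \<and> (l2 = [] \<longrightarrow> \<not> even_part l1) \<or>
       l2 = [] \<and> even_part l1 \<and> (H = Wplus l1 \<or> H = Wminus l1))" if "H \<in> ?R" for H
  proof -
    have id: "K = conj id ` K" for K by simp
    from that consider l1 l2 where "double_partition n (l1, l2)" "gt1 l2" "l2 = [] \<longrightarrow> \<not> even_part l1" "H = Wlam (l1, l2)"
      | l where "partition_of n l" "even_part l" "H = Wplus l"
      | l where "partition_of n l" "even_part l" "H = Wminus l"
      unfolding Un_iff mem_Collect_eq by (metis prod.collapse)
    then show ?thesis
    proof cases
      case (1 l1 l2) then show ?thesis using WB_id id by blast
    next
      case (2 l)
      then have "double_partition n (l, [])" "H = conj id ` Wlam (l, [])"
        using partition_double by (auto simp: Wplus_Wlam)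
      then show ?thesis using 2 WB_id gt1_Nil by blast
    next
      case (3 l)
      then have "double_partition n (l, [])" "H = conj tsign ` Wlam (l, [])"
        using partition_double by (auto simp: Wminus_def Wplus_Wlam)
      then show ?thesis using 3 tsign_WB[OF n] gt1_Nil by blast
    qed
  qed
  show ?thesis unfolding is_reps_def
  proof (intro conjI ballI allI impI)
    fix H assume "H \<in> ?R"
    then consider l1 l2 where "double_partition n (l1, l2)" "gt1 l2" "H = Wlam (l1, l2)"
      | l where "partition_of n l" "even_part l" "H = Wplus l"
      | l where "partition_of n l" "even_part l" "H = Wminus l"
      unfolding Un_iff mem_Collect_eq by (metis prod.collapse)
    then show "refl_subgroup n H"
    proof cases
      case 3 then show ?thesis using Wminus_piece_group[OF n 3(1,2)] refl_subgroup_piece_group by (simp add: pieces_def)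
    qed (auto simp: refl_subgroup_Wlam partition_double Wplus_Wlam)
  next
    fix H assume "refl_subgroup n H"
    then obtain X where "X \<subseteq> reflections n" "H = gen X" by (auto simp: refl_subgroup_def)
    then obtain LA LD where pc: "pieces n LA LD" and H: "H = piece_group LA LD"
      using reflection_subgroup_pieces by blast
    obtain l1 l2 where l: "double_partition n (l1, l2)" "gt1 l2"
      "l2 \<noteq> [] \<or> \<not> even_part l1 \<Longrightarrow> conj_sub n (piece_group LA LD) (Wlam (l1, l2))"
      "l2 = [] \<Longrightarrow> even_part l1 \<Longrightarrow> conj_sub n (piece_group LA LD) (Wplus l1) \<or> conj_sub n (piece_group LA LD) (Wminus l1)"
      using pieces_conj_sub[OF pc n] by metis
    show "\<exists>K\<in>?R. conj_sub n H K"
    proof (cases "l2 \<noteq> [] \<or> \<not> even_part l1")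
      case True
      then have "Wlam (l1, l2) \<in> ?R" using l(1,2) by auto
      then show ?thesis using l(3)[OF True] H by blast
    next
      case False
      then have "Wplus l1 \<in> ?R" "Wminus l1 \<in> ?R" using l(1) partition_double by auto
      then show ?thesis using l(4) False H by blast
    qed
  next
    fix H K assume HR: "H \<in> ?R" and KR: "K \<in> ?R" and HK: "conj_sub n H K"
    obtain l1 l2 g where l: "double_partition n (l1, l2)" "gt1 l2" "g \<in> WB n" "H = conj g ` Wlam (l1, l2)"
      "H = Wlam (l1, l2) \<and> (l2 = [] \<longrightarrow> \<not> even_part l1) \<or> l2 = [] \<and> even_part l1 \<and> (H = Wplus l1 \<or> H = Wminus l1)"
      using shape[OF HR] by blast
    obtain m1 m2 h where m: "double_partition n (m1, m2)" "gt1 m2" "h \<in> WB n" "K = conj h ` Wlam (m1, m2)"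
      "K = Wlam (m1, m2) \<and> (m2 = [] \<longrightarrow> \<not> even_part m1) \<or> m2 = [] \<and> even_part m1 \<and> (K = Wplus m1 \<or> K = Wminus m1)"
      using shape[OF KR] by blast
    obtain f where f: "f \<in> WD n" "K = conj f ` H" using HK by (auto simp: conj_sub_def)
    have "Wlam (m1, m2) = conj (inv h) ` K"
      using m(3,4) by (simp add: image_image conj_inv WB_bij)
    also have "\<dots> = conj (inv h \<circ> (f \<circ> g)) ` Wlam (l1, l2)"
      unfolding f(2) l(4) using conj_image_comp WB_comp WB_inv l(3) m(3) WD_WB[OF f(1)] by metis
    finally have eq: "l1 = m1 \<and> l2 = m2"
      using Wlam_conj_eq[OF l(1,2) m(1,2), of "inv h \<circ> (f \<circ> g)"] WB_comp WB_inv l(3) m(3) WD_WB[OF f(1)]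
      by metis
    show "H = K"
    proof (rule ccontr)
      assume ne: "H \<noteq> K"
      then have e: "l2 = []" "even_part l1" "H = Wplus l1 \<and> K = Wminus l1 \<or> H = Wminus l1 \<and> K = Wplus l1"
        using l(5) m(5) eq by auto
      then have p: "partition_of n l1" using l(1) partition_double by blast
      then show False using e HK conj_sub_sym Wplus_not_conj_Wminus[OF n p e(2) p e(2)] by blast
    qed
  qed
qed

section \<open>Parabolic closures\<close>

lemma sext_pos: "0 < i \<Longrightarrow> sext v i = v (nat i)"
  by (simp add: sext_def)

lemma sext_uminus: "i \<noteq> 0 \<Longrightarrow> sext v (- i) = - sext v i"
  by (auto simp: sext_def)

text \<open>The definition tests positive coordinates only; oddness extends this to all signed
  points, which makes fixing a vector compatible with composition.\<close>

lemma fixes_vec_iff: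
  assumes "w \<in> WB n"
  shows "fixes_vec n w v \<longleftrightarrow> (\<forall>i\<in>pts n. sext v (w i) = sext v i)"
proof
  assume f: "fixes_vec n w v"
  show "\<forall>i\<in>pts n. sext v (w i) = sext v i"
  proof
    fix i assume i: "i \<in> pts n"
    have *: "sext v (w j) = sext v j" if "j \<in> pts n" "0 < j" for j
      using f that by (force simp: fixes_vec_def pts_def sext_pos dest: bspec[of _ _ "nat j"])
    show "sext v (w i) = sext v i"
    proof (cases "0 < i")
      case True then show ?thesis using * i by blast
    next
      case False
      then have "0 < - i" using pts_nz[OF i] by simp
      then have "sext v (w (- i)) = sext v (- i)" using * i by simp
      then show ?thesis
        using WB_odd[OF assms] sext_uminus pts_nz[OF i] WB_pts[OF assms, of i] i pts_nz[of "w i" n] by simp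
    qed
  qed
next
  assume "\<forall>i\<in>pts n. sext v (w i) = sext v i"
  then show "fixes_vec n w v" by (auto simp: fixes_vec_def pts_def sext_pos)
qed

lemma tp_fixes:
  assumes "adm x y" "sext v x = sext v y"
  shows "sext v (tp x y z) = sext v z"
  using assms sext_uminus[of x v] sext_uminus[of y v] by (auto simp: tp_def adm_def)

lemma gen_fixes:
  assumes X: "X \<subseteq> reflections n" and f: "\<And>s. s \<in> X \<Longrightarrow> fixes_vec n s v" and w: "w \<in> gen X"
  shows "fixes_vec n w v"
proof -
  let ?K = "{w \<in> WB n. fixes_vec n w v}"
  have "gen X \<subseteq> ?K"
  proof (rule gen_closed[OF invols_refl[OF X]])
    show "id \<in> ?K" by (simp add: WB_id fixes_vec_iff)
    fix s g assume s: "s \<in> X" and g: "g \<in> ?K"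
    have sW: "s \<in> WB n" using s X reflections_WD WD_WB by blast
    then show "s \<circ> g \<in> ?K"
      using g f[OF s] WB_comp[of s n g] fixes_vec_iff[of g n v] by (simp add: fixes_vec_iff WB_pts)
  qed
  then show ?thesis using w by blast
qed

text \<open>Steinberg's theorem on fixers, for one vector and W(D_n), by induction on the number of
  moved points. If \<open>w\<close> moves \<open>x\<close> to another line, the reflection
  exchanging \<open>x\<close> and \<open>w x\<close> fixes the vector and lowers the number;
  otherwise \<open>w\<close> is a diagonal sign change, and two lines are treated at once.\<close>

lemma WD_generated:
  assumes "w \<in> WD n" "\<And>i. i \<in> pts n \<Longrightarrow> sext v (w i) = sext v i"
    and gen: "\<And>x y. x \<in> pts n \<Longrightarrow> y \<in> pts n \<Longrightarrow> \<bar>x\<bar> \<noteq> \<bar>y\<bar> \<Longrightarrow> sext v x = sext v y \<Longrightarrow> tp x y \<in> gen X"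
  shows "w \<in> gen X"
  using assms(1,2)
proof (induction "card {x \<in> pts n. w x \<noteq> x}" arbitrary: w rule: less_induct)
  case (less w)
  note W = WD_WB[OF less.prems(1)]
  have step: "w \<in> gen X" if t: "t \<in> gen X" "t \<in> WD n" "t \<circ> t = id" "\<And>z. z \<in> pts n \<Longrightarrow> sext v (t z) = sext v z"
    and x: "x \<in> pts n" "w x \<noteq> x" "t (w x) = x"
    and fixed: "\<And>z. z \<in> pts n \<Longrightarrow> w z = z \<Longrightarrow> t z = z" for t x
  proof -
    have "{z \<in> pts n. (t \<circ> w) z \<noteq> z} \<subset> {x \<in> pts n. w x \<noteq> x}"
    proof
      show "{z \<in> pts n. (t \<circ> w) z \<noteq> z} \<subseteq> {x \<in> pts n. w x \<noteq> x}" using fixed by auto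
      show "{z \<in> pts n. (t \<circ> w) z \<noteq> z} \<noteq> {x \<in> pts n. w x \<noteq> x}" using x by auto
    qed
    then have "card {z \<in> pts n. (t \<circ> w) z \<noteq> z} < card {x \<in> pts n. w x \<noteq> x}"
      by (intro psubset_card_mono) (auto simp: finite_pts)
    moreover have "sext v ((t \<circ> w) i) = sext v i" if "i \<in> pts n" for i
      using t(4)[of "w i"] WB_pts[OF W] less.prems(2) that by simp
    ultimately have "t \<circ> w \<in> gen X" using less.hyps WD_comp[OF t(2) less.prems(1)] by blast
    then have "t \<circ> (t \<circ> w) \<in> gen X" using t(1) gen_comp by blast
    then show ?thesis using t(3) by (simp add: comp_assoc[symmetric])
  qed
  show ?case
  proof (cases "\<exists>x\<in>pts n. w x \<noteq> x \<and> \<bar>w x\<bar> \<noteq> \<bar>x\<bar>")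
    case True
    then obtain x where x: "x \<in> pts n" "w x \<noteq> x" "\<bar>x\<bar> \<noteq> \<bar>w x\<bar>" by metis
    have y: "w x \<in> pts n" using x WB_pts[OF W] by blast
    note a = adm_pts[OF x(1) y x(3)]
    have e: "sext v x = sext v (w x)" using less.prems(2) x by simp
    show ?thesis
    proof (rule step[of "tp x (w x)" x])
      show "tp x (w x) \<in> gen X" using gen x y e by blast
      show "tp x (w x) \<in> WD n" using WD_tp x y by blast
      show "tp x (w x) \<circ> tp x (w x) = id" using tp_invol a by blast
      show "sext v (tp x (w x) z) = sext v z" for z using tp_fixes[OF a e] .
      show "tp x (w x) (w x) = x" by simp
      fix z assume z: "z \<in> pts n" "w z = z"
      have "\<bar>z\<bar> \<noteq> \<bar>x\<bar>"
        using z(2) x(2) WB_odd[OF W, of x] by (auto simp: abs_eq_iff)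
      moreover have "\<bar>z\<bar> \<noteq> \<bar>w x\<bar>" using z(2) calculation WB_abs[OF W, of z x] by simp
      ultimately show "tp x (w x) z = z" by (simp add: tp_other)
    qed (use x in auto)
  next
    case False
    then have neg: "w x = x \<or> w x = - x" if "x \<in> pts n" for x using that by (metis abs_eq_iff)
    show ?thesis
    proof (cases "\<exists>x\<in>pts n. w x \<noteq> x")
      case False
      then have "w = id" using WB_out[OF W] by fastforce
      then show ?thesis using gen.gen_id by metis
    next
      case True
      then obtain x where x: "x \<in> pts n" "w x \<noteq> x" by blast
      let ?N = "{i \<in> {1..int n}. w i < 0}"
      have xp: "\<bar>x\<bar> \<in> {1..int n}" using x(1) by (auto simp: pts_def)
      have wx: "w x = - x" using neg[OF x(1)] x(2) by blast
      have "w \<bar>x\<bar> = - \<bar>x\<bar>" using wx WB_odd[OF W, of x] by (cases "0 \<le> x") auto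
      then have "\<bar>x\<bar> \<in> ?N" using xp pts_nz[OF x(1)] by simp
      moreover have "even (card ?N)" using less.prems(1) by (simp add: WD_def)
      \<comment> \<open>The lines whose sign changes are even in number, so besides the line of
        \<open>x\<close> there is a second one, \<open>z\<close>.\<close>
      ultimately have "?N \<noteq> {\<bar>x\<bar>}" "?N \<noteq> {}" by auto
      then obtain z where z: "z \<in> ?N" "z \<noteq> \<bar>x\<bar>" using \<open>\<bar>x\<bar> \<in> ?N\<close> by blast
      have zp: "z \<in> pts n" "0 < z" using z by (auto simp: pts_def)
      have wz: "w z = - z" using neg[OF zp(1)] z(1) by auto
      have xz: "\<bar>x\<bar> \<noteq> \<bar>z\<bar>" using z(2) zp(2) by simp
      note a = adm_pts[OF x(1) zp(1) xz]
      \<comment> \<open>The vector vanishes on both lines, so both reflections on them fix it; their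
        product \<open>t\<close> is the double sign change.\<close>
      have s0: "sext v x = 0" "sext v z = 0"
        using less.prems(2)[OF x(1)] less.prems(2)[OF zp(1)] wx wz
          sext_uminus[OF pts_nz[OF x(1)], of v] sext_uminus[OF pts_nz[OF zp(1)], of v] by simp_all
      then have s0': "sext v (- z) = 0" using sext_uminus[OF pts_nz[OF zp(1)], of v] by simp
      define t where "t = tp x z \<circ> tp x (- z)"
      have t: "t y = (if \<bar>y\<bar> = \<bar>x\<bar> \<or> \<bar>y\<bar> = \<bar>z\<bar> then - y else y)" for y
        using a by (auto simp: t_def tp_def adm_def abs_eq_iff)
      show ?thesis
      proof (rule step[of t x])
        have "tp x z \<in> gen X" "tp x (- z) \<in> gen X" using gen[OF x(1) zp(1) xz] gen[OF x(1), of "- z"] zp s0 s0' xz by auto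
        then show "t \<in> gen X" unfolding t_def by (rule gen_comp)
        show "t \<in> WD n" unfolding t_def using WD_comp[OF WD_tp[OF x(1) zp(1) xz] WD_tp[OF x(1), of "- z"]] zp xz by simp
        show "t \<circ> t = id" by (rule ext) (simp add: t)
        show "sext v (t y) = sext v y" if "y \<in> pts n" for y
          using tp_fixes[of x z v] tp_fixes[of x "- z" v] a s0 s0' by (simp add: t_def)
        show "t (w x) = x" using wx by (simp add: t)
        fix y assume y: "y \<in> pts n" "w y = y"
        have "\<bar>y\<bar> \<noteq> \<bar>x\<bar>" "\<bar>y\<bar> \<noteq> \<bar>z\<bar>"
          using y wx wz WB_odd[OF W, of x] WB_odd[OF W, of z] pts_nz[OF x(1)] pts_nz[OF zp(1)] by (auto simp: abs_eq_iff)
        then show "t y = y" by (simp add: t)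
      qed (use x in auto)
    qed
  qed
qed

text \<open>With a positive start \<open>c\<close>, successive blocks receive different absolute
  values, so equal nonzero values mean the same block and the same relative sign. Used with the type
  A blocks, it leaves 0 for the lines of type D.\<close>

fun level :: "int list list \<Rightarrow> int \<Rightarrow> int \<Rightarrow> int" where
  "level [] c x = 0"
| "level (p # L) c x = (if x \<in> set p then c else if - x \<in> set p then - c else level L (c + 1) x)"

lemma level_bound: "0 < c \<Longrightarrow> level L c x = 0 \<or> c \<le> \<bar>level L c x\<bar>"
  by (induction L c x rule: level.induct) auto

lemma level_odd: "good (set (concat L)) \<Longrightarrow> level L c (- x) = - level L c x"
proof (induction L c x rule: level.induct)
  case (2 p L c x)
  have "good (set p)" "good (set (concat L))" using 2(2) by (auto intro: good_subset)
  then show ?case using 2(1) good_no_neg[of "set p"] by auto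
qed simp

lemma level_0: "0 < c \<Longrightarrow> level L c x = 0 \<longleftrightarrow> x \<notin> set (concat L) \<and> - x \<notin> set (concat L)"
  by (induction L c x rule: level.induct) auto

lemma level_eq:
  "0 < c \<Longrightarrow> level L c x = level L c y \<Longrightarrow> level L c x \<noteq> 0 \<Longrightarrow>
    \<exists>p\<in>set L. x \<in> set p \<and> y \<in> set p \<or> - x \<in> set p \<and> - y \<in> set p"
proof (induction L arbitrary: c)
  case (Cons p L)
  have b: "level L (c + 1) x = 0 \<or> c + 1 \<le> \<bar>level L (c + 1) x\<bar>"
    "level L (c + 1) y = 0 \<or> c + 1 \<le> \<bar>level L (c + 1) y\<bar>" using level_bound Cons(2) by simp_all
  show ?case
  proof (cases "(x \<in> set p \<or> - x \<in> set p) \<or> (y \<in> set p \<or> - y \<in> set p)")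
    case True
    then have "x \<in> set p \<and> y \<in> set p \<or> - x \<in> set p \<and> - y \<in> set p"
      using Cons(2-4) b by (auto split: if_splits)
    then show ?thesis by auto
  next
    case False
    then show ?thesis using Cons(1)[of "c + 1"] Cons(2-4) by auto
  qed
qed simp

lemma level_const:
  assumes "good (set (concat L))" "distinct (concat L)" "p \<in> set L" "x \<in> set p" "y \<in> set p"
  shows "level L c x = level L c y"
  using assms
proof (induction L arbitrary: c)
  case (Cons q L)
  show ?case
  proof (cases "p = q")
    case False
    have "z \<notin> set q \<and> - z \<notin> set q" if "z \<in> set p" for z
    proof -
      have "z \<in> set (concat L)" "z \<in> set (concat (q # L))" using that Cons.prems(3) False by auto
      moreover have "set q \<inter> set (concat L) = {}" using Cons.prems(2) by simp
      ultimately show ?thesis using good_no_neg[OF Cons.prems(1)] by auto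
    qed
    then show ?thesis using Cons False by (auto intro: good_subset)
  qed (use Cons in auto)
qed simp

lemma sext_level: "x \<in> pts n \<Longrightarrow> good (set (concat L)) \<Longrightarrow>
    sext (\<lambda>i. real_of_int (level L c (int i))) x = real_of_int (level L c x)"
  using level_odd[of L c x] by (auto simp: sext_def pts_def)

text \<open>A vector taking different values on the blocks of type \<open>A\<close> and vanishing on those of type
  \<open>D\<close> is a generic fixed vector. On the other hand a fixed vector vanishes on the blocks of type
  \<open>D\<close>, so these can be joined.\<close>

lemma par_closure_piece_group:
  assumes pc: "pieces n LA LD"
  shows "par_closure n (piece_group LA LD) = piece_group LA (if LD = [] then [] else [concat LD])"
proof
  let ?Y = "gens_union (\<lambda>p. gA p) (\<lambda>q. gD q) LA (if LD = [] then [] else [concat LD])"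
  let ?X = "gens_union (\<lambda>p. gA p) (\<lambda>q. gD q) LA LD"
  have v: "valid n (LA @ LD)" using pc by (simp add: pieces_def)
  have vm: "valid n (LA @ (if LD = [] then [] else [concat LD]))"
  proof (cases "LD = []")
    case False
    then obtain q M where "LD = q # M" by (cases LD) auto
    moreover have "q \<noteq> []" using v calculation by (simp add: valid_def eq_commute[of "[]"])
    ultimately have "concat LD \<noteq> []" by simp
    then show ?thesis using v False by (simp add: valid_def eq_commute[of "[]"])
  qed (use v in simp)
  have X: "?X \<subseteq> reflections n" and Y: "?Y \<subseteq> reflections n"
    using gens_union_reflections[OF v] gens_union_reflections[OF vm] by auto
  have g: "good (set (concat LA))" and d: "distinct (concat LA)"
    using valid_good[OF v] valid_distinct[OF v] by (auto intro: good_subset)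
  define v0 where "v0 i = real_of_int (level LA 1 (int i))" for i
  have v0: "sext v0 x = real_of_int (level LA 1 x)" if "x \<in> pts n" for x
    using sext_level[OF that g, of 1] by (simp add: v0_def[abs_def])
  have Dz: "level LA 1 x = 0" if "x \<in> set (concat LD)" for x
  proof -
    have G: "good (set (concat LA) \<union> set (concat LD))" using valid_good[OF v] by simp
    have "set (concat LA) \<inter> set (concat LD) = {}" using valid_distinct[OF v] by simp
    then have "x \<notin> set (concat LA)" "- x \<notin> set (concat LA)" using that good_no_neg[OF G, of x] by auto
    then show ?thesis by (simp add: level_0)
  qed
  have fix0: "fixes_vec n s v0" if "s \<in> ?X" for s
  proof -
    have sW: "s \<in> WB n" using that X reflections_WD WD_WB by blast
    from that have "\<exists>x y. s = tp x y \<and> adm x y \<and> sext v0 x = sext v0 y"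
    proof (cases rule: gens_union_cases)
      case (A x y p)
      have p: "p \<in> set (LA @ LD)" using A by simp
      have "adm x y" using good_adm[OF valid_good1[OF v p] A(2-4)] .
      moreover have "sext v0 x = sext v0 y"
        using level_const[OF g d A(1-3)] v0 valid_pts[OF v p] A(2,3) by simp
      ultimately show ?thesis using A(5) by blast
    next
      case (D x y q)
      have q: "q \<in> set (LA @ LD)" using D by simp
      have a: "adm x y" using good_adm[OF valid_good1[OF v q] D(2-4)] .
      have "x \<in> set (concat LD)" "y \<in> set (concat LD)" using D by auto
      then have "sext v0 x = 0" "sext v0 y = 0"
        using Dz v0 valid_pts[OF v q] D(2,3) by simp_all
      moreover have "sext v0 (- y) = 0" using calculation sext_uminus[of y v0] a by (simp add: adm_def)
      ultimately show ?thesis using a D(5) adm_uminus(2)[of x y] by metis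
    qed
    then show ?thesis using tp_fixes sW by (auto simp: fixes_vec_iff)
  qed
  show "par_closure n (piece_group LA LD) \<subseteq> piece_group LA (if LD = [] then [] else [concat LD])"
  proof
    fix w assume w: "w \<in> par_closure n (piece_group LA LD)"
    then have wD: "w \<in> WD n" by (simp add: par_closure_def)
    have "fixes_vec n w v0" using w gen_fixes[OF X fix0] by (auto simp: par_closure_def piece_group_def)
    then have wf: "sext v0 (w i) = sext v0 i" if "i \<in> pts n" for i
      using fixes_vec_iff[OF WD_WB[OF wD]] that by blast
    show "w \<in> piece_group LA (if LD = [] then [] else [concat LD])"
      unfolding piece_group_def
    proof (rule WD_generated[OF wD wf])
      fix x y assume xy: "x \<in> pts n" "y \<in> pts n" "\<bar>x\<bar> \<noteq> \<bar>y\<bar>" "sext v0 x = sext v0 y"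
      note a = adm_pts[OF xy(1-3)]
      have e: "level LA 1 x = level LA 1 y" using xy v0 by simp
      show "tp x y \<in> gen ?Y"
      proof (cases "level LA 1 x = 0")
        case False
        then obtain p where p: "p \<in> set LA" "x \<in> set p \<and> y \<in> set p \<or> - x \<in> set p \<and> - y \<in> set p"
          using level_eq[OF _ e] by auto
        then have "tp x y \<in> gA p"
          using A_gensI[of x "set p" y] A_gensI[of "- x" "set p" "- y"] tp_uminus[OF a] xy(3) by auto
        then show ?thesis using p(1) by (intro gen_base) (auto simp: gens_union_def)
      next
        case True
        have D: "\<bar>z\<bar> \<in> abs ` set (concat LD)" if z: "z \<in> pts n" "level LA 1 z = 0" for z
        proof -
          have "z \<notin> set (concat LA)" "- z \<notin> set (concat LA)" using z(2) by (simp_all add: level_0)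
          moreover obtain q where "q \<in> set (LA @ LD)" "z \<in> set q \<or> - z \<in> set q"
            using valid_cover[OF v z(1)] by blast
          ultimately have "z \<in> set (concat LD) \<or> - z \<in> set (concat LD)" by auto
          then show ?thesis by (metis abs_minus_cancel imageI)
        qed
        have "LD \<noteq> []" using D[OF xy(1) True] by auto
        moreover have "tp x y \<in> D_gens (set (concat LD))"
        proof -
          have "good (set (concat LD))" using valid_good[OF v] by (auto intro: good_subset)
          then show ?thesis using D[OF xy(1) True] D[OF xy(2)] True e xy(3) by (auto simp: D_gens_eq)
        qed
        ultimately show ?thesis by (intro gen_base) (simp add: gens_union_def)
      qed
    qed
  qed
  show "piece_group LA (if LD = [] then [] else [concat LD]) \<subseteq> par_closure n (piece_group LA LD)"
  proof
    fix w assume w: "w \<in> piece_group LA (if LD = [] then [] else [concat LD])"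
    have "w \<in> WD n" using w gen_WD[OF Y] by (auto simp: piece_group_def)
    moreover have "fixes_vec n w u" if u: "\<forall>x\<in>piece_group LA LD. fixes_vec n x u" for u
    proof (rule gen_fixes[OF Y])
      show "w \<in> gen ?Y" using w by (simp add: piece_group_def)
      \<comment> \<open>The two reflections on the lines of \<open>x\<close> and \<open>y\<close> in
        a type D block give u_x = u_y and u_x = - u_y. The second line exists because such a block
        has at least two.\<close>
      have u0: "sext u x = 0" if "x \<in> set (concat LD)" for x
      proof -
        obtain q where q: "q \<in> set LD" "x \<in> set q" using \<open>x \<in> set (concat LD)\<close> by auto
        have q': "q \<in> set (LA @ LD)" using q by simp
        have l: "2 \<le> length q" using pc q(1) by (simp add: pieces_def)
        obtain y where y: "y \<in> set q" "x \<noteq> y" using two_elems[OF l valid_distinct1[OF v q'] q(2)] by blast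
        have a: "adm x y" using good_adm[OF valid_good1[OF v q'] q(2) y] .
        have p: "x \<in> pts n" using valid_pts[OF v q' q(2)] .
        have *: "sext u (s x) = sext u x" if "s \<in> piece_group LA LD" for s
        proof -
          have "s \<in> WB n" using piece_group_subset_WD[OF v] that WD_WB by blast
          then show ?thesis using fixes_vec_iff that u p by blast
        qed
        have "sext u y = sext u x" "sext u (- y) = sext u x"
          using *[OF piece_group_mem(2)[OF q(2) y q(1)]] *[OF piece_group_mem(3)[OF q(2) y q(1)]] by simp_all
        then show ?thesis using sext_uminus[of y u] a by (simp add: adm_def)
      qed
      fix s assume s: "s \<in> ?Y"
      then have sW: "s \<in> WB n" using Y reflections_WD WD_WB by blast
      from s show "fixes_vec n s u"
      proof (cases rule: gens_union_cases)
        case (A x y p)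
        then have "s \<in> piece_group LA LD" using piece_group_mem(1) by blast
        then show ?thesis using u by blast
      next
        case (D x y q)
        then have q: "q = concat LD" by (auto split: if_splits)
        have "good (set q)" unfolding q using valid_good[OF v] by (auto intro: good_subset)
        then have a: "adm x y" using good_adm D by blast
        have "sext u x = 0" "sext u y = 0" using u0 D(2,3) q by auto
        moreover have "sext u (- y) = 0" using calculation sext_uminus[of y u] a by (simp add: adm_def)
        ultimately have "sext u (s z) = sext u z" for z
          using D(5) tp_fixes[of x y u z] tp_fixes[of x "- y" u z] a by auto
        then show ?thesis using fixes_vec_iff[OF sW] by blast
      qed
    qed
    ultimately show "w \<in> par_closure n (piece_group LA LD)" by (simp add: par_closure_def)
  qed
qed

text \<open>The blocks of \<open>l2\<close> are consecutive, so joining them yields a standard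
  subgroup on the nose. The remainder \<open>n - sum_list l1\<close> is 0 or at least 2 because the
  parts of \<open>l2\<close> exceed 1.\<close>

lemma par_closure_Wlam:
  assumes "double_partition n (l1, l2)" "gt1 l2"
  shows "par_closure n (Wlam (l1, l2)) = Wlam (l1, if n - sum_list l1 = 0 then [] else [n - sum_list l1])"
proof -
  have s: "sum_list l1 + sum_list l2 = n" using assms(1) by (simp add: double_partition_def)
  have pos: "\<forall>x\<in>set l2. 0 < x" using assms(2) by (auto simp: gt1_def)
  have "l2 = [] \<longleftrightarrow> n - sum_list l1 = 0"
    using s pos by (cases l2) auto
  moreover have "blists k l2 = [] \<longleftrightarrow> l2 = []" for k by (cases l2) auto
  moreover have "concat (blists k l2) = [int k + 1..int (k + sum_list l2)]" for k by (rule concat_blists)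
  ultimately show ?thesis
    using par_closure_piece_group[OF blists_pieces[OF assms]] s by (auto simp: Wlam_piece_group)
qed

lemma par_closure_parabolic:
  assumes "pieces n LA []"
  shows "par_closure n (piece_group LA []) = piece_group LA []"
  using par_closure_piece_group[OF assms] by simp

lemma conj_sub_refl: "conj_sub n H H"
  unfolding conj_sub_def by (intro bexI[of _ id]) (auto simp: WD_id)

section \<open>The geometric representation of a Coxeter generating set\<close>

lemma tp_conj_tp:
  assumes "adm x y"
  shows "tp x y \<circ> tp a b \<circ> tp x y = tp (tp x y a) (tp x y b)"
  using conj_tp[OF bij_tp[OF assms] tp_odd[OF assms], of a b] by (simp add: conj_def inv_tp[OF assms])

text \<open>Reflections with no common line, or with both lines in common, commute. A noncommuting
  pair therefore shares exactly one line, and signs can be arranged so that the same signed point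
  \<open>y\<close> stands in both.\<close>

lemma reflections_commute_or:
  assumes "s \<in> reflections n" "t \<in> reflections n" "s \<circ> t \<noteq> t \<circ> s"
  obtains x y z where "s = tp x y" "t = tp y z" "adm x y" "adm y z" "adm x z"
proof -
  obtain x y where s: "s = tp x y" "adm x y" using assms(1) reflectionsE by metis
  obtain a b where t: "t = tp a b" "adm a b" using assms(2) reflectionsE by metis
  have comm: "s \<circ> t = t \<circ> s" if "s \<circ> t \<circ> s = t"
    using that s tp_invol by (metis comp_assoc comp_id)
  have conj: "s \<circ> t \<circ> s = tp (s a) (s b)" unfolding s(1) t(1) by (rule tp_conj_tp[OF s(2)])
  have nz: "x \<noteq> 0" "y \<noteq> 0" "a \<noteq> 0" "b \<noteq> 0" using s t by (auto simp: adm_def)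
  \<comment> \<open>Exactly one common line: if the shared point occurs with opposite signs, both
    arguments of the second reflection are negated.\<close>
  have key: thesis if "\<bar>a'\<bar> = \<bar>y'\<bar>" "\<bar>b'\<bar> \<noteq> \<bar>x'\<bar>" "s = tp x' y'" "t = tp a' b'" "adm x' y'" "adm a' b'"
    for x' y' a' b'
  proof -
    have "y' = a' \<or> y' = - a'" using that(1) by (auto simp: abs_eq_iff)
    then show thesis
    proof
      assume "y' = a'"
      then show thesis using assms that by (intro \<open>\<And>x y z. s = tp x y \<Longrightarrow> t = tp y z \<Longrightarrow> adm x y \<Longrightarrow> adm y z \<Longrightarrow> adm x z \<Longrightarrow> thesis\<close>[of x' y' b']) (auto simp: adm_def)
    next
      assume y: "y' = - a'"
      have "t = tp y' (- b')" using that(4,6) y tp_uminus[of a' b'] by simp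
      then show thesis using assms that y by (intro \<open>\<And>x y z. s = tp x y \<Longrightarrow> t = tp y z \<Longrightarrow> adm x y \<Longrightarrow> adm y z \<Longrightarrow> adm x z \<Longrightarrow> thesis\<close>[of x' y' "- b'"]) (auto simp: adm_def)
    qed
  qed
  have sy: "s = tp y x" "adm y x" and ty: "t = tp b a" "adm b a"
    using s t tp_sym adm_sym by blast+
  consider "\<bar>a\<bar> \<noteq> \<bar>x\<bar> \<and> \<bar>a\<bar> \<noteq> \<bar>y\<bar> \<and> \<bar>b\<bar> \<noteq> \<bar>x\<bar> \<and> \<bar>b\<bar> \<noteq> \<bar>y\<bar>"
    | "\<bar>a\<bar> = \<bar>y\<bar> \<and> \<bar>b\<bar> = \<bar>x\<bar>" | "\<bar>a\<bar> = \<bar>x\<bar> \<and> \<bar>b\<bar> = \<bar>y\<bar>"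
    | "\<bar>a\<bar> = \<bar>y\<bar> \<and> \<bar>b\<bar> \<noteq> \<bar>x\<bar>" | "\<bar>a\<bar> = \<bar>x\<bar> \<and> \<bar>b\<bar> \<noteq> \<bar>y\<bar>"
    | "\<bar>b\<bar> = \<bar>y\<bar> \<and> \<bar>a\<bar> \<noteq> \<bar>x\<bar>" | "\<bar>b\<bar> = \<bar>x\<bar> \<and> \<bar>a\<bar> \<noteq> \<bar>y\<bar>" by blast
  then show thesis
  proof cases
    case 1
    then have "s a = a" "s b = b" unfolding s(1) by (simp_all add: tp_other)
    then show thesis using comm conj assms(3) t(1) by simp
  next
    case 2
    then have "tp (s a) (s b) = tp b a \<or> tp (s a) (s b) = tp (- b) (- a)"
      using s nz by (auto simp: tp_def abs_eq_iff adm_def)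
    then have "tp (s a) (s b) = t" using tp_uminus[OF ty(2)] ty(1) by auto
    then show thesis using comm conj assms(3) by simp
  next
    case 3
    then have "tp (s a) (s b) = tp b a \<or> tp (s a) (s b) = tp (- b) (- a)"
      using s nz by (auto simp: tp_def abs_eq_iff adm_def)
    then have "tp (s a) (s b) = t" using tp_uminus[OF ty(2)] ty(1) by auto
    then show thesis using comm conj assms(3) by simp
  qed (use key[OF _ _ s(1) t(1) s(2) t(2)] key[OF _ _ sy(1) t(1) sy(2) t(2)]
      key[OF _ _ s(1) ty(1) s(2) ty(2)] key[OF _ _ sy(1) ty(1) sy(2) ty(2)] in blast)+
qed

lemma tp_noncomm:
  assumes "adm x y" "adm y z" "adm x z"
  shows "tp x y \<circ> tp y z \<noteq> tp y z \<circ> tp x y"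
proof
  assume "tp x y \<circ> tp y z = tp y z \<circ> tp x y"
  then have "tp x y (tp y z x) = tp y z (tp x y x)" by (metis comp_apply)
  moreover have "tp y z x = x" using assms by (intro tp_other) (auto simp: adm_def)
  ultimately show False using assms by (simp add: adm_def)
qed

lemma braid_tp:
  assumes "adm x y" "adm y z" "adm x z"
  shows "tp x y \<circ> tp y z \<circ> tp x y = tp y z \<circ> tp x y \<circ> tp y z"
proof -
  have "tp x y z = z" "tp y z x = x" using assms by (auto simp: tp_other adm_def)
  then show ?thesis by (simp add: tp_conj_tp[OF assms(1)] tp_conj_tp[OF assms(2)])
qed

text \<open>W(D_n) is simply laced: by the braid relation the product of a noncommuting pair of
  reflections has order 3.\<close>

lemma elem_order_eq:
  assumes s: "s \<in> reflections n" and t: "t \<in> reflections n"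
  shows "elem_order (s \<circ> t) = (if s = t then 1 else if s \<circ> t = t \<circ> s then 2 else 3)"
proof -
  have ss: "s \<circ> s = id" and tt: "t \<circ> t = id" using s t reflection_invol by auto
  have ssx: "s (s x) = x" and ttx: "t (t x) = x" for x using ss tt by (metis comp_apply id_apply)+
  have 1: "s = t" if "s \<circ> t = id" using that ss tt by (metis comp_assoc comp_id id_comp)
  have 2: "s \<circ> t = t \<circ> s" if "(s \<circ> t) \<circ> (s \<circ> t) = id"
    using that ss tt by (metis comp_assoc comp_id id_comp)
  consider "s = t" | "s \<noteq> t" "s \<circ> t = t \<circ> s" | "s \<noteq> t" "s \<circ> t \<noteq> t \<circ> s" by blast
  then show ?thesis
  proof cases
    case 1
    then show ?thesis unfolding elem_order_def using ss by (auto intro!: Least_equality)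
  next
    case 2
    have "s (t (s (t x))) = x" for x using 2(2) ssx ttx by (metis comp_apply)
    then have "(s \<circ> t) ^^ 2 = id" by (auto simp: numeral_2_eq_2)
    moreover have "2 \<le> k" if "0 < k \<and> (s \<circ> t) ^^ k = id" for k
      using that \<open>s \<circ> t = id \<Longrightarrow> s = t\<close> 2(1) by (cases "k = 1") auto
    ultimately show ?thesis unfolding elem_order_def using 2 by (auto intro!: Least_equality)
  next
    case 3
    obtain x y z where xyz: "s = tp x y" "t = tp y z" "adm x y" "adm y z" "adm x z"
      using reflections_commute_or[OF s t 3(2)] .
    have sts: "s (t (s u)) = t (s (t u))" for u
      using fun_cong[OF braid_tp[OF xyz(3-5)], of u] xyz by simp
    have "s (t (s (t (s (t u))))) = u" for u unfolding sts ttx ssx by (rule refl)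
    then have "(s \<circ> t) ^^ 3 = id" by (auto simp: numeral_3_eq_3)
    moreover have "3 \<le> k" if k: "0 < k \<and> (s \<circ> t) ^^ k = id" for k
    proof (rule ccontr)
      assume "\<not> 3 \<le> k"
      then have "k = 1 \<or> k = 2" using k by auto
      then show False
        using k \<open>s \<circ> t = id \<Longrightarrow> s = t\<close> \<open>(s \<circ> t) \<circ> (s \<circ> t) = id \<Longrightarrow> s \<circ> t = t \<circ> s\<close> 3
        by (auto simp: numeral_2_eq_2)
    qed
    ultimately show ?thesis unfolding elem_order_def using 3 by (auto intro!: Least_equality)
  qed
qed

section \<open>Words and their values\<close>

lemma eval_word_append: "eval_word (u @ v) = eval_word u \<circ> eval_word v"
  by (induction u) (auto simp: eval_word_def comp_assoc)

lemma eval_word_Cons: "eval_word (s # v) = s \<circ> eval_word v"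
  by (simp add: eval_word_def)

lemma eval_word_Nil: "eval_word [] = id"
  by (simp add: eval_word_def)

lemma eval_word_rev: "\<forall>s\<in>set ws. s \<circ> s = id \<Longrightarrow> eval_word (rev ws) \<circ> eval_word ws = id"
proof (induction ws)
  case (Cons s ws)
  have "eval_word (rev (s # ws)) \<circ> eval_word (s # ws) = eval_word (rev ws) \<circ> (s \<circ> s) \<circ> eval_word ws"
    by (simp add: eval_word_append eval_word_Cons eval_word_Nil comp_assoc)
  also have "\<dots> = eval_word (rev ws) \<circ> eval_word ws"
  proof -
    have "s \<circ> s = id" using Cons.prems by (meson list.set_intros(1))
    then show ?thesis by (simp only: comp_id)
  qed
  also have "\<dots> = id" by (rule Cons.IH) (use Cons.prems in \<open>meson list.set_intros(2)\<close>)
  finally show ?case .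
qed (simp add: eval_word_Nil)

lemma eval_word_gen: "set ws \<subseteq> X \<Longrightarrow> eval_word ws \<in> gen X"
  by (induction ws) (auto simp: eval_word_Nil eval_word_Cons intro: gen.intros)

lemma gen_eval_word:
  assumes "invols X" "g \<in> gen X"
  shows "\<exists>ws. set ws \<subseteq> X \<and> eval_word ws = g"
proof -
  have "gen X \<subseteq> {g. \<exists>ws. set ws \<subseteq> X \<and> eval_word ws = g}"
  proof (rule gen_closed[OF assms(1)])
    show "id \<in> {g. \<exists>ws. set ws \<subseteq> X \<and> eval_word ws = g}"
      using eval_word_Nil by (intro CollectI exI[of _ "[]"]) simp
    fix x g assume x: "x \<in> X" and "g \<in> {g. \<exists>ws. set ws \<subseteq> X \<and> eval_word ws = g}"
    then obtain ws where "set ws \<subseteq> X" "eval_word ws = g" by blast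
    then show "x \<circ> g \<in> {g. \<exists>ws. set ws \<subseteq> X \<and> eval_word ws = g}"
      using x by (intro CollectI exI[of _ "x # ws"]) (simp add: eval_word_Cons)
  qed
  then show ?thesis using assms(2) by blast
qed

text \<open>The action on \<open>\<real>\<^sup>S\<close> by \<open>x \<mapsto> x - 2 B(x, \<alpha>\<^sub>s) \<alpha>\<^sub>s\<close>, where \<open>2 B(\<alpha>\<^sub>s, \<alpha>\<^sub>t)\<close> is \<open>-1\<close> or \<open>0\<close>
  according as \<open>s\<close> and \<open>t\<close> fail to commute or commute.\<close>

type_synonym vec = "(int \<Rightarrow> int) \<Rightarrow> real"

definition nbr_sum :: "(int \<Rightarrow> int) set \<Rightarrow> (int \<Rightarrow> int) \<Rightarrow> vec \<Rightarrow> real" where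
  "nbr_sum S s x = (\<Sum>t\<in>{t \<in> S. s \<circ> t \<noteq> t \<circ> s}. x t)"

definition refl_act :: "(int \<Rightarrow> int) set \<Rightarrow> (int \<Rightarrow> int) \<Rightarrow> vec \<Rightarrow> vec" where
  "refl_act S s x = x(s := nbr_sum S s x - x s)"

definition act :: "(int \<Rightarrow> int) set \<Rightarrow> (int \<Rightarrow> int) list \<Rightarrow> vec \<Rightarrow> vec" where
  "act S ws x = foldr (refl_act S) ws x"

lemma act_simps [simp]: "act S [] x = x" "act S (s # ws) x = refl_act S s (act S ws x)"
  by (simp_all add: act_def)

lemma act_append: "act S (u @ v) x = act S u (act S v x)"
  by (induction u) auto

lemma nbr_sum_upd:
  assumes "finite S" "t \<in> S"
  shows "nbr_sum S s (x(t := c)) = nbr_sum S s x + (if s \<circ> t \<noteq> t \<circ> s then c - x t else 0)"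
proof -
  let ?A = "{t \<in> S. s \<circ> t \<noteq> t \<circ> s}"
  have fin: "finite ?A" using assms by simp
  show ?thesis
  proof (cases "s \<circ> t \<noteq> t \<circ> s")
    case True
    then have "t \<in> ?A" using assms by simp
    then have "nbr_sum S s (x(t := c)) = c + sum (x(t := c)) (?A - {t})" "nbr_sum S s x = x t + sum x (?A - {t})"
      unfolding nbr_sum_def by (simp_all only: sum.remove[OF fin] fun_upd_same)
    moreover have "sum (x(t := c)) (?A - {t}) = sum x (?A - {t})" by (rule sum.cong) auto
    ultimately show ?thesis using True by simp
  next
    case False
    then have "nbr_sum S s (x(t := c)) = nbr_sum S s x"
      unfolding nbr_sum_def by (intro sum.cong) auto
    then show ?thesis using False by simp
  qed
qed

lemma refl_act_invol:
  assumes "finite S" "s \<in> S"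
  shows "refl_act S s (refl_act S s x) = x"
  by (rule ext) (simp add: refl_act_def nbr_sum_upd[OF assms])

lemma refl_act_commute:
  assumes "finite S" "s \<in> S" "t \<in> S" "s \<noteq> t" "s \<circ> t = t \<circ> s"
  shows "refl_act S s (refl_act S t (refl_act S s (refl_act S t x))) = x"
  by (rule ext) (use assms in \<open>simp add: refl_act_def nbr_sum_upd[OF assms(1,2)] nbr_sum_upd[OF assms(1,3)]\<close>)

lemma refl_act_braid:
  assumes "finite S" "s \<in> S" "t \<in> S" "s \<noteq> t" "s \<circ> t \<noteq> t \<circ> s"
  shows "refl_act S s (refl_act S t (refl_act S s (refl_act S t (refl_act S s (refl_act S t x))))) = x"
  by (rule ext) (use assms assms(5)[symmetric] in
    \<open>simp add: refl_act_def nbr_sum_upd[OF assms(1,2)] nbr_sum_upd[OF assms(1,3)]\<close>)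

text \<open>As all bonds are 2 or 3, a relator is a square or the second or third power of a product
  of two letters, and each is checked in coordinates.\<close>

lemma act_relator:
  assumes S: "S \<subseteq> reflections n" and r: "r \<in> cox_rels S"
  shows "act S r x = x"
proof -
  have fin: "finite S" using S finite_reflections finite_subset by blast
  obtain s t where st: "s \<in> S" "t \<in> S" "r = concat (replicate (elem_order (s \<circ> t)) [s, t])"
    using r by (auto simp: cox_rels_def)
  have o: "elem_order (s \<circ> t) = (if s = t then 1 else if s \<circ> t = t \<circ> s then 2 else 3)"
    by (rule elem_order_eq) (use S st in auto)
  consider "s = t" | "s \<noteq> t" "s \<circ> t = t \<circ> s" | "s \<noteq> t" "s \<circ> t \<noteq> t \<circ> s" by blast
  then show ?thesis
  proof cases
    case 1 then show ?thesis using st o refl_act_invol[OF fin] by simp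
  next
    case 2
    then have "r = [s, t, s, t]" using st(3) o by (simp add: numeral_2_eq_2)
    then show ?thesis using refl_act_commute[OF fin st(1,2) 2] by simp
  next
    case 3
    then have "r = [s, t, s, t, s, t]" using st(3) o by (simp add: numeral_3_eq_3)
    then show ?thesis using refl_act_braid[OF fin st(1,2) 3] by simp
  qed
qed

lemma equivclp_invariant:
  assumes "equivclp r a b" "\<And>x y. r x y \<Longrightarrow> f x = f y"
  shows "f a = f b"
  using assms(1) by (induction rule: equivclp_induct) (use assms(2) in auto)

lemma act_rev:
  assumes "finite S" "set ws \<subseteq> S"
  shows "act S (rev ws) (act S ws x) = x"
  using assms(2) by (induction ws arbitrary: x) (auto simp: act_append refl_act_invol[OF assms(1)])

text \<open>Here the presentation enters: \<open>rev v @ u\<close> has value \<open>id\<close>,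
  hence is related to the empty word by relators, and these act trivially. So the reflection group
  itself acts, without a detour through the abstract Coxeter group.\<close>

lemma act_cong:
  assumes cox: "coxeter_gen_set n R S" and uv: "set u \<subseteq> S" "set v \<subseteq> S" "eval_word u = eval_word v"
  shows "act S u x = act S v x"
proof -
  have S: "S \<subseteq> reflections n" using cox by (simp add: coxeter_gen_set_def)
  have fin: "finite S" using S finite_reflections finite_subset by blast
  have inv: "s \<circ> s = id" if "s \<in> S" for s using that S reflection_invol by blast
  have "eval_word (rev v @ u) = id"
    unfolding eval_word_append uv(3) by (rule eval_word_rev) (use uv inv in auto)
  moreover have "set (rev v @ u) \<subseteq> S" using uv by auto
  ultimately have "equivclp (cox_step S) (rev v @ u) []" using cox by (simp add: coxeter_gen_set_def)
  then have "act S (rev v @ u) = act S []"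
  proof (rule equivclp_invariant)
    fix a b assume "cox_step S a b"
    then show "act S a = act S b" by cases (auto simp: act_append act_relator[OF S])
  qed
  then have "act S (rev v) (act S u x) = x" by (simp add: act_append[symmetric])
  then show ?thesis using act_rev[OF fin, of "rev v" "act S u x"] uv by simp
qed

text \<open>Letters other than \<open>s\<close> do not touch the coordinate at \<open>s\<close>,
  while \<open>s\<close> negates it on the basis vector at \<open>s\<close>.\<close>

lemma coxeter_minimal:
  assumes cox: "coxeter_gen_set n R S" and s: "s \<in> S"
  shows "s \<notin> gen (S - {s})"
proof
  assume "s \<in> gen (S - {s})"
  have S: "S \<subseteq> reflections n" using cox by (simp add: coxeter_gen_set_def)
  have "invols (S - {s})" by (rule invols_refl) (use S in auto)
  then obtain ws where ws: "set ws \<subseteq> S - {s}" "eval_word ws = s"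
    using gen_eval_word \<open>s \<in> gen (S - {s})\<close> by blast
  let ?x = "\<lambda>u. if u = s then 1 else 0 :: real"
  have coeff: "act S ws x s = x s" for x
    using ws(1) by (induction ws arbitrary: x) (auto simp: refl_act_def)
  have "act S ws ?x = act S [s] ?x"
    by (rule act_cong[OF cox]) (use ws s in \<open>auto simp: eval_word_Cons eval_word_Nil\<close>)
  moreover have "nbr_sum S s ?x = 0" unfolding nbr_sum_def by (rule sum.neutral) auto
  then have "act S [s] ?x s = -1" by (simp add: refl_act_def)
  ultimately have "act S ws ?x s = -1" by simp
  then show False using coeff[of ?x] by simp
qed

lemma nbr_sum_linear: "nbr_sum S s (\<lambda>u. x u + c * y u) = nbr_sum S s x + c * nbr_sum S s y"
  by (simp add: nbr_sum_def sum.distrib sum_distrib_left)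

lemma act_linear: "act S ws (\<lambda>u. x u + c * y u) = (\<lambda>u. act S ws x u + c * act S ws y u)"
proof (induction ws)
  case (Cons s ws)
  show ?case
    by (rule ext) (simp add: Cons refl_act_def nbr_sum_linear algebra_simps)
qed simp

lemma act_sum:
  assumes "finite T"
  shows "act S ws (\<lambda>u. \<Sum>t\<in>T. f t u) = (\<lambda>u. \<Sum>t\<in>T. act S ws (f t) u)"
  using assms
proof (induction T rule: finite_induct)
  case empty
  show ?case using act_linear[of S ws "\<lambda>u. 0" "-1" "\<lambda>u. 0"] by simp
next
  case (insert a T)
  then show ?case using act_linear[of S ws "f a" 1 "\<lambda>u. \<Sum>t\<in>T. f t u"] by simp
qed

text \<open>Averaging over the finite group \<open>gen S\<close> yields an invariant inner product \<open>Q\<close>, and then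
  \<open>Q(x, \<alpha>\<^sub>s) = Q(\<alpha>\<^sub>s, \<alpha>\<^sub>s) B(x, \<alpha>\<^sub>s)\<close>. If every element of \<open>T\<close> has two neighbours in \<open>T\<close>, the sum
  \<open>\<delta>\<close> of the \<open>\<alpha>\<^sub>s\<close> with \<open>s \<in> T\<close> would satisfy \<open>Q(\<delta>, \<delta>) \<le> 0\<close>.\<close>

lemma coxeter_forest:
  assumes cox: "coxeter_gen_set n R S" and T: "T \<subseteq> S" "T \<noteq> {}"
    and nbrs: "\<And>s. s \<in> T \<Longrightarrow> \<exists>t\<in>T. \<exists>u\<in>T. t \<noteq> u \<and> s \<circ> t \<noteq> t \<circ> s \<and> s \<circ> u \<noteq> u \<circ> s"
  shows False
proof -
  have S: "S \<subseteq> reflections n" and R: "gen S = R" using cox by (simp_all add: coxeter_gen_set_def)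
  have fin: "finite S" using S finite_reflections finite_subset by blast
  have finT: "finite T" using fin T finite_subset by blast
  have finR: "finite (gen S)" using gen_WD[OF S] finite_WB[of n] WD_WB by (meson finite_subset subsetI subset_iff)
  have invS: "invols S" by (rule invols_refl[OF S])
  \<comment> \<open>Any word for \<open>g\<close> will do, as by \<open>act_cong\<close> its action
    depends on \<open>g\<close> only.\<close>
  define wd where "wd g = (SOME ws. set ws \<subseteq> S \<and> eval_word ws = g)" for g
  have wd: "set (wd g) \<subseteq> S \<and> eval_word (wd g) = g" if "g \<in> gen S" for g
    unfolding wd_def using someI_ex[OF gen_eval_word[OF invS that]] .
  define Q where "Q x y = (\<Sum>g\<in>gen S. \<Sum>u\<in>S. act S (wd g) x u * act S (wd g) y u)" for x y
  have Qinv: "Q (refl_act S s x) (refl_act S s y) = Q x y" if s: "s \<in> S" for s x y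
  proof -
    have ss: "s \<circ> s = id" using s invS by (simp add: invols_def)
    have mem: "g \<circ> s \<in> gen S" if "g \<in> gen S" for g using that s gen_base gen_comp by blast
    \<comment> \<open>Right translation by \<open>s\<close> permutes the group and absorbs the
      reflection, which makes \<open>Q\<close> invariant.\<close>
    have bij: "bij_betw (\<lambda>g. g \<circ> s) (gen S) (gen S)"
    proof (rule bij_betw_byWitness[of _ "\<lambda>g. g \<circ> s"])
      show "\<forall>a\<in>gen S. a \<circ> s \<circ> s = a" "\<forall>a'\<in>gen S. a' \<circ> s \<circ> s = a'" using ss by (simp_all add: comp_assoc)
    qed (use mem in auto)
    have a: "act S (wd g) (refl_act S s z) = act S (wd (g \<circ> s)) z" if g: "g \<in> gen S" for g z
    proof -
      have "act S (wd g @ [s]) z = act S (wd (g \<circ> s)) z"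
        by (rule act_cong[OF cox]) (use wd[OF g] wd[OF mem[OF g]] s in
          \<open>auto simp: eval_word_append eval_word_Cons eval_word_Nil\<close>)
      then show ?thesis by (simp add: act_append)
    qed
    have "Q (refl_act S s x) (refl_act S s y)
        = (\<Sum>g\<in>gen S. \<Sum>u\<in>S. act S (wd (g \<circ> s)) x u * act S (wd (g \<circ> s)) y u)"
      unfolding Q_def by (intro sum.cong refl) (simp add: a)
    also have "\<dots> = Q x y" unfolding Q_def
      by (rule sum.reindex_bij_betw[OF bij, of "\<lambda>g. \<Sum>u\<in>S. act S (wd g) x u * act S (wd g) y u"])
    finally show ?thesis .
  qed
  have Qlin: "Q (\<lambda>u. x u + c * y u) z = Q x z + c * Q y z" for x y z c
    unfolding Q_def act_linear by (simp add: algebra_simps sum.distrib sum_distrib_left)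
  have Qsym: "Q x y = Q y x" for x y unfolding Q_def by (simp add: mult.commute)
  have Qpos: "0 < Q x x" if "s \<in> S" "x s \<noteq> 0" for x s
  proof -
    have id: "id \<in> gen S" by (rule gen.gen_id)
    have "act S (wd id) x = act S [] x" by (rule act_cong[OF cox]) (use wd[OF id] in \<open>auto simp: eval_word_Nil\<close>)
    then have "0 < (\<Sum>u\<in>S. act S (wd id) x u * act S (wd id) x u)"
      using that fin by (intro sum_pos2[of _ s]) (auto simp: zero_less_mult_iff)
    then show ?thesis unfolding Q_def by (rule sum_pos2[OF finR id]) (auto intro: sum_nonneg)
  qed
  define alpha where "alpha s = (\<lambda>u. if u = s then 1 else 0 :: real)" for s :: "int \<Rightarrow> int"
  define delta where "delta = (\<lambda>u. if u \<in> T then 1 else 0 :: real)"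
  have delta_sum: "delta = (\<lambda>u. \<Sum>t\<in>T. alpha t u)" unfolding delta_def alpha_def using finT by simp
  have le: "Q (alpha s) delta \<le> 0" if s: "s \<in> T" for s
  proof -
    have sS: "s \<in> S" using s T by blast
    obtain t u where tu: "t \<in> T" "u \<in> T" "t \<noteq> u" "s \<circ> t \<noteq> t \<circ> s" "s \<circ> u \<noteq> u \<circ> s" using nbrs[OF s] by blast
    \<comment> \<open>\<open>s\<close> maps \<open>delta\<close> to \<open>delta\<close> plus
      \<open>c\<close> times \<open>alpha s\<close>: the new coordinate at \<open>s\<close> is
      \<open>nbr_sum S s delta - 1\<close>, the old one is 1. Two neighbours in \<open>T\<close>
      make \<open>c\<close> nonnegative.\<close>
    define c where "c = nbr_sum S s delta - 2"
    have "(\<Sum>v\<in>{t, u}. delta v) \<le> nbr_sum S s delta"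
      unfolding nbr_sum_def by (rule sum_mono2) (use fin tu T in \<open>auto simp: delta_def\<close>)
    moreover have "(\<Sum>v\<in>{t, u}. delta v) = 2" using tu by (simp add: delta_def)
    ultimately have c: "0 \<le> c" by (simp add: c_def)
    have "nbr_sum S s (alpha s) = 0" unfolding nbr_sum_def alpha_def by (rule sum.neutral) auto
    then have a1: "refl_act S s (alpha s) = (\<lambda>u. 0 + (-1) * alpha s u)"
      by (intro ext) (simp add: refl_act_def alpha_def)
    have a2: "refl_act S s delta = (\<lambda>u. delta u + c * alpha s u)"
      by (rule ext) (use s in \<open>simp add: refl_act_def alpha_def c_def delta_def\<close>)
    have z: "Q (\<lambda>u. 0) x = 0" for x
      using Qlin[of "\<lambda>u. 0" 1 "\<lambda>u. 0" x] by simp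
    \<comment> \<open>Invariance under \<open>s\<close>, which negates \<open>alpha s\<close>,
      determines this product in terms of \<open>c\<close>.\<close>
    have "Q delta (alpha s) = Q (refl_act S s delta) (refl_act S s (alpha s))" using Qinv[OF sS] by simp
    also have "\<dots> = Q delta (refl_act S s (alpha s)) + c * Q (alpha s) (refl_act S s (alpha s))" unfolding a2 by (rule Qlin)
    also have "\<dots> = - Q delta (alpha s) - c * Q (alpha s) (alpha s)"
      unfolding a1 Qsym[of _ "\<lambda>u. 0 + (-1) * alpha s u"] Qlin z by (simp add: Qsym[of "alpha s" delta])
    finally have "2 * Q (alpha s) delta = - (c * Q (alpha s) (alpha s))" using Qsym[of delta "alpha s"] by simp
    moreover have "0 < Q (alpha s) (alpha s)" by (rule Qpos[OF sS]) (simp add: alpha_def)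
    ultimately show ?thesis using c by (smt (verit) mult_nonneg_nonneg)
  qed
  have "Q delta delta = (\<Sum>t\<in>T. Q (alpha t) delta)"
    unfolding Q_def delta_sum act_sum[OF finT]
    by (subst sum.swap, simp add: sum_distrib_right sum.swap[of _ S T] sum.swap[of _ "gen S" T])
  also have "\<dots> \<le> 0" by (rule sum_nonpos) (rule le)
  finally have "Q delta delta \<le> 0" .
  moreover obtain s where "s \<in> T" using T by blast
  then have "0 < Q delta delta" using Qpos[of s delta] T by (auto simp: delta_def)
  ultimately show False by simp
qed

section \<open>The shape of a Coxeter generating set\<close>

fun path_edges :: "int list \<Rightarrow> (int \<Rightarrow> int) set" where
  "path_edges (x # y # r) = insert (tp x y) (path_edges (y # r))"
| "path_edges p = {}"

text \<open>Simple reflections of type D: the doubled first edge is the fork of the Dynkin diagram,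
  its two reflections commuting with each other. Two points give A_1 x A_1, three give A_3.\<close>

fun fork_edges :: "int list \<Rightarrow> (int \<Rightarrow> int) set" where
  "fork_edges (x # y # r) = insert (tp x (- y)) (path_edges (x # y # r))"
| "fork_edges p = {}"

lemma path_edges_append: "path_edges (us @ x # y # vs) = insert (tp x y) (path_edges (us @ [x]) \<union> path_edges (y # vs))"
proof (induction us)
  case (Cons u us)
  then show ?case by (cases us) auto
qed simp

lemma fork_edges_append: "us \<noteq> [] \<Longrightarrow> fork_edges (us @ x # y # vs) = insert (tp x y) (fork_edges (us @ [x]) \<union> path_edges (y # vs))"
proof -
  assume "us \<noteq> []"
  then obtain u vs' where us: "us = u # vs'" by (cases us) auto
  show ?thesis
  proof (cases vs')
    case Nil then show ?thesis using us by auto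
  next
    case (Cons u' ws)
    then show ?thesis using path_edges_append[of us x y vs] us by auto
  qed
qed

lemma good_ConsD: "good (insert x A) \<Longrightarrow> good A"
  by (rule good_subset) auto

lemma path_edges_rev: "distinct p \<Longrightarrow> good (set p) \<Longrightarrow> path_edges (rev p) = path_edges p"
proof (induction p rule: path_edges.induct)
  case (1 x y r)
  have "adm x y" using 1(2,3) good_adm[of "set (x # y # r)" x y] by simp
  moreover have "path_edges (rev (y # r)) = path_edges (y # r)" using 1(1,2) good_ConsD[of x "set (y # r)"] 1(3) by simp
  ultimately show ?case using path_edges_append[of "rev r" y x "[]"] tp_sym[of x y] by simp
qed auto

lemma neg_inv_path_edges: "neg_inv path_edges"
  unfolding neg_inv_def
proof (intro allI impI)
  fix p assume "distinct p \<and> good (set p)"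
  then show "path_edges (map uminus p) = path_edges p"
  proof (induction p rule: path_edges.induct)
    case (1 x y r)
    have "adm x y" using 1(2) good_adm[of "set (x # y # r)" x y] by simp
    then show ?case using 1 good_ConsD[of x "set (y # r)"] by (simp add: tp_uminus)
  qed auto
qed

lemma neg_inv_fork_edges: "neg_inv fork_edges"
  unfolding neg_inv_def
proof (intro allI impI)
  fix p assume p: "distinct p \<and> good (set p)"
  show "fork_edges (map uminus p) = fork_edges p"
  proof (cases p rule: fork_edges.cases)
    case (1 x y r)
    have "adm x y" using 1 p good_adm[of "set p" x y] by simp
    then have "tp (- x) y = tp x (- y)" by (rule tp_uminus')
    then show ?thesis using 1 neg_invD[OF neg_inv_path_edges, of p] p by simp
  qed auto
qed

lemma pe_A_gens: "distinct p \<Longrightarrow> path_edges p \<subseteq> A_gens (set p)"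
proof (induction p rule: path_edges.induct)
  case (1 x y r)
  then show ?case using A_gens_mono[of "set (y # r)" "set (x # y # r)"] A_gensI[of x "set (x # y # r)" y] by auto
qed auto

lemma de_D_gens: "distinct p \<Longrightarrow> fork_edges p \<subseteq> D_gens (set p)"
proof (cases p rule: fork_edges.cases)
  case (1 x y r)
  assume "distinct p"
  then show ?thesis using 1 pe_A_gens[of p] A_gens_D_gens[of "set p"] D_gensI(2)[of x "set p" y] by auto
qed auto

lemma A_gens_path_edges: "distinct p \<Longrightarrow> good (set p) \<Longrightarrow> A_gens (set p) \<subseteq> gen (path_edges p)"
proof (induction p rule: path_edges.induct)
  case (1 x y r)
  have g: "good ({x} \<union> set (y # r))" using 1(3) by (auto intro: good_subset)
  have un: "set (x # y # r) = {x} \<union> set (y # r)" by auto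
  show ?case
    unfolding un
  proof (rule A_merge[OF g])
    show "{x} \<inter> set (y # r) = {}" using 1(2) by simp
    show "A_gens {x} \<subseteq> gen (path_edges (x # y # r))" by (auto simp: A_gens_def)
    have "A_gens (set (y # r)) \<subseteq> gen (path_edges (y # r))" using 1 good_ConsD[of x "set (y # r)"] by simp
    also have "\<dots> \<subseteq> gen (path_edges (x # y # r))" by (rule gen_mono) auto
    finally show "A_gens (set (y # r)) \<subseteq> gen (path_edges (x # y # r))" .
    show "tp x y \<in> gen (path_edges (x # y # r))" by (rule gen_base) simp
  qed auto
qed (auto simp: A_gens_def)

lemma D_gens_fork_edges: "distinct p \<Longrightarrow> good (set p) \<Longrightarrow> 2 \<le> length p \<Longrightarrow> D_gens (set p) \<subseteq> gen (fork_edges p)"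
proof (cases p rule: fork_edges.cases)
  case (1 x y r)
  assume p: "distinct p" "good (set p)"
  show ?thesis
  proof (rule D_make[OF p(2)])
    show "A_gens (set p) \<subseteq> gen (fork_edges p)"
      using A_gens_path_edges[OF p] gen_mono[of "path_edges p" "fork_edges p"] 1 by auto
    show "tp x (- y) \<in> gen (fork_edges p)" using 1 by (intro gen_base) simp
    show "x \<in> set p" "y \<in> set p" "x \<noteq> y" using 1 p by auto
  qed
qed auto

lemma path_edges_nth: "path_edges p = {tp (p ! i) (p ! Suc i) | i. Suc i < length p}"
proof (induction p rule: path_edges.induct)
  case (1 x y r)
  have "{tp ((x # y # r) ! i) ((x # y # r) ! Suc i) | i. Suc i < length (x # y # r)}
     = insert (tp x y) {tp ((y # r) ! i) ((y # r) ! Suc i) | i. Suc i < length (y # r)}" (is "?L = ?R")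
  proof
    show "?L \<subseteq> ?R"
    proof
      fix w assume "w \<in> ?L"
      then obtain i where i: "w = tp ((x # y # r) ! i) ((x # y # r) ! Suc i)" "Suc i < length (x # y # r)" by blast
      then show "w \<in> ?R" by (cases i) auto
    qed
    show "?R \<subseteq> ?L"
    proof
      fix w assume "w \<in> ?R"
      then consider "w = tp x y" | i where "w = tp ((y # r) ! i) ((y # r) ! Suc i)" "Suc i < length (y # r)" by blast
      then show "w \<in> ?L"
      proof cases
        case 1 then show ?thesis by (intro CollectI exI[of _ 0]) simp
      next
        case (2 i) then show ?thesis by (intro CollectI exI[of _ "Suc i"]) simp
      qed
    qed
  qed
  then show ?case using 1 by simp
qed auto

lemma decomp_gen:
  assumes "decomp n path_edges fork_edges S LA LD"
  shows "pieces n LA LD" "gen S = piece_group LA LD" "S \<subseteq> reflections n"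
proof -
  let ?G = "gens_union (\<lambda>p. gA p) (\<lambda>q. gD q) LA LD"
  have v: "valid n (LA @ LD)" and l: "\<forall>q\<in>set LD. 2 \<le> length q" and S: "S = gens_union path_edges fork_edges LA LD"
    using assms by (auto simp: decomp_def)
  note dg = valid_distinct1[OF v] valid_good1[OF v]
  show "pieces n LA LD" using v l by (simp add: pieces_def)
  have "path_edges p \<subseteq> gA p" if "p \<in> set LA" for p using pe_A_gens dg that by simp
  moreover have "fork_edges q \<subseteq> gD q" if "q \<in> set LD" for q using de_D_gens dg that by simp
  ultimately have SG: "S \<subseteq> ?G" unfolding S gens_union_def by blast
  show SR: "S \<subseteq> reflections n" using SG gens_union_reflections[OF v] by blast
  have "gA p \<subseteq> gen S" if "p \<in> set LA" for p
    using A_gens_path_edges[of p] gen_mono[of "path_edges p" S] dg that unfolding S gens_union_def by fastforce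
  moreover have "gD q \<subseteq> gen S" if "q \<in> set LD" for q
    using D_gens_fork_edges[of q] gen_mono[of "fork_edges q" S] dg that l unfolding S gens_union_def by fastforce
  ultimately have "?G \<subseteq> gen S" unfolding gens_union_def by blast
  then show "gen S = piece_group LA LD" unfolding piece_group_def
    using gen_eqI[of S ?G] invols_refl[OF SR] invols_refl[OF gens_union_reflections[OF v]] gen_superset[OF SG] by blast
qed

text \<open>Paths are symmetric, so the end at which the next edge is attached can be made the last
  point. A fork on more than two points has only one free end.\<close>

lemma decomp_revA: "decomp n path_edges fork_edges S (p # LA) LD \<Longrightarrow> decomp n path_edges fork_edges S (rev p # LA) LD"
  using valid_rev[of n p "LA @ LD"] path_edges_rev[of p] valid_distinct1[of n "p # LA @ LD" p] valid_good1[of n "p # LA @ LD" p]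
  by (simp add: decomp_def gens_union_def)

section \<open>Forbidden configurations of edges\<close>

lemma tp_noncomm':
  assumes "\<bar>x\<bar> \<noteq> \<bar>y\<bar>" "\<bar>y\<bar> \<noteq> \<bar>z\<bar>" "\<bar>x\<bar> \<noteq> \<bar>z\<bar>" "x \<noteq> 0" "y \<noteq> 0" "z \<noteq> 0"
  shows "tp x y \<circ> tp y z \<noteq> tp y z \<circ> tp x y" "tp y z \<circ> tp x y \<noteq> tp x y \<circ> tp y z"
    "tp y x \<circ> tp y z \<noteq> tp y z \<circ> tp y x" "tp x y \<circ> tp z y \<noteq> tp z y \<circ> tp x y"
proof -
  have a: "adm x y" "adm y z" "adm x z" using assms by (auto simp: adm_def)
  show "tp x y \<circ> tp y z \<noteq> tp y z \<circ> tp x y" using tp_noncomm[OF a] .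
  then show "tp y z \<circ> tp x y \<noteq> tp x y \<circ> tp y z" "tp y x \<circ> tp y z \<noteq> tp y z \<circ> tp y x"
    "tp x y \<circ> tp z y \<noteq> tp z y \<circ> tp x y"
    using tp_sym[OF a(1)] tp_sym[OF a(2)] by metis+
qed

lemma tp_neqI: "s x \<noteq> t x \<Longrightarrow> s \<noteq> t"
  by auto

text \<open>Minimality and acyclicity are all that is retained of the Coxeter presentation; from
  these two the shape of the graph follows by combinatorics.\<close>

locale forest_set =
  fixes n :: nat and S :: "(int \<Rightarrow> int) set"
  assumes refl: "S \<subseteq> reflections n"
    and minimal: "\<And>s. s \<in> S \<Longrightarrow> s \<notin> gen (S - {s})"
    and forest: "\<And>T. T \<subseteq> S \<Longrightarrow> T \<noteq> {} \<Longrightarrow>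
      (\<And>s. s \<in> T \<Longrightarrow> \<exists>t\<in>T. \<exists>u\<in>T. t \<noteq> u \<and> s \<circ> t \<noteq> t \<circ> s \<and> s \<circ> u \<noteq> u \<circ> s) \<Longrightarrow> False"
begin

text \<open>Edges from one vertex to distinct lines pairwise fail to commute, so three of them form
  a 3-cycle. A vertex thus has at most two neighbouring lines.\<close>

lemma triangle:
  assumes "tp a x \<in> S" "tp a y \<in> S" "tp a z \<in> S"
    and "a \<noteq> 0" "x \<noteq> 0" "y \<noteq> 0" "z \<noteq> 0" "\<bar>a\<bar> \<noteq> \<bar>x\<bar>" "\<bar>a\<bar> \<noteq> \<bar>y\<bar>" "\<bar>a\<bar> \<noteq> \<bar>z\<bar>"
      "\<bar>x\<bar> \<noteq> \<bar>y\<bar>" "\<bar>x\<bar> \<noteq> \<bar>z\<bar>" "\<bar>y\<bar> \<noteq> \<bar>z\<bar>"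
  shows False
proof (rule forest[of "{tp a x, tp a y, tp a z}"])
  have nc: "tp a u \<circ> tp a v \<noteq> tp a v \<circ> tp a u" if "\<bar>a\<bar> \<noteq> \<bar>u\<bar>" "\<bar>a\<bar> \<noteq> \<bar>v\<bar>" "\<bar>u\<bar> \<noteq> \<bar>v\<bar>" "u \<noteq> 0" "v \<noteq> 0" for u v
    using tp_noncomm'(3)[of u a v] that assms(4) by simp
  have ne: "tp a x \<noteq> tp a y" "tp a x \<noteq> tp a z" "tp a y \<noteq> tp a z"
    using assms by (auto intro!: tp_neqI[of _ a])
  fix s assume "s \<in> {tp a x, tp a y, tp a z}"
  then consider "s = tp a x" | "s = tp a y" | "s = tp a z" by blast
  then show "\<exists>t\<in>{tp a x, tp a y, tp a z}. \<exists>u\<in>{tp a x, tp a y, tp a z}.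
      t \<noteq> u \<and> s \<circ> t \<noteq> t \<circ> s \<and> s \<circ> u \<noteq> u \<circ> s"
  proof cases
    case 1 then show ?thesis using nc[of x y] nc[of x z] ne assms by blast
  next
    case 2 then show ?thesis using nc[of y x] nc[of y z] ne assms by (metis insertCI)
  next
    case 3 then show ?thesis using nc[of z x] nc[of z y] ne assms by (metis insertCI)
  qed
qed (use assms in auto)

lemma square:
  assumes "{s1, s2, s3, s4} \<subseteq> S" "s1 \<noteq> s3" "s2 \<noteq> s4"
    and "s1 \<circ> s2 \<noteq> s2 \<circ> s1" "s1 \<circ> s4 \<noteq> s4 \<circ> s1" "s3 \<circ> s2 \<noteq> s2 \<circ> s3" "s3 \<circ> s4 \<noteq> s4 \<circ> s3"
  shows False
proof (rule forest[OF assms(1)])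
  fix s assume "s \<in> {s1, s2, s3, s4}"
  then consider "s = s1 \<or> s = s3" | "s = s2 \<or> s = s4" by blast
  then show "\<exists>t\<in>{s1, s2, s3, s4}. \<exists>u\<in>{s1, s2, s3, s4}. t \<noteq> u \<and> s \<circ> t \<noteq> t \<circ> s \<and> s \<circ> u \<noteq> u \<circ> s"
  proof cases
    case 1
    then show ?thesis by (intro bexI[of _ s2] bexI[of _ s4]) (use assms in auto)
  next
    case 2
    then show ?thesis by (intro bexI[of _ s1] bexI[of _ s3]) (use assms(2) assms(4-7)[THEN not_sym] in auto)
  qed
qed simp

text \<open>Neither of the two parallel edges commutes with the outer edge at \<open>a\<close> or
  with the one at \<open>b\<close>, which makes a 4-cycle. A doubled edge thus sits at an
  end.\<close>

lemma bridged_square: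
  assumes "tp x a \<in> S" "tp a b \<in> S" "tp a (- b) \<in> S" "tp b y \<in> S"
    and nz: "a \<noteq> 0" "x \<noteq> 0" "y \<noteq> 0" "b \<noteq> 0"
    and d: "\<bar>a\<bar> \<noteq> \<bar>x\<bar>" "\<bar>a\<bar> \<noteq> \<bar>y\<bar>" "\<bar>a\<bar> \<noteq> \<bar>b\<bar>" "\<bar>x\<bar> \<noteq> \<bar>y\<bar>" "\<bar>x\<bar> \<noteq> \<bar>b\<bar>" "\<bar>y\<bar> \<noteq> \<bar>b\<bar>"
  shows False
proof (rule square[of "tp x a" "tp a b" "tp b y" "tp a (- b)"])
  show "tp x a \<noteq> tp b y" by (rule tp_neqI[of _ x]) (use d in \<open>auto simp: tp_other\<close>)
  show "tp a b \<noteq> tp a (- b)" by (rule tp_neqI[of _ a]) (use nz in simp)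
  show "tp x a \<circ> tp a b \<noteq> tp a b \<circ> tp x a" "tp x a \<circ> tp a (- b) \<noteq> tp a (- b) \<circ> tp x a"
    by (rule tp_noncomm'(1); use nz d in simp)+
  show "tp b y \<circ> tp a b \<noteq> tp a b \<circ> tp b y" by (rule tp_noncomm'(2)) (use nz d in auto)
  have "tp a (- b) = tp (- a) b" using tp_uminus'[of a b] nz d by (simp add: adm_def)
  then show "tp b y \<circ> tp a (- b) \<noteq> tp a (- b) \<circ> tp b y"
    using tp_noncomm'(2)[of "- a" b y] nz d by simp
qed (use assms in auto)

text \<open>Consecutive edges around the cycle share exactly one line, so each edge has two
  noncommuting neighbours. On two points the closing edge would instead be a parallel edge, which
  commutes.\<close>

lemma long_cycle:
  assumes c: "distinct c" "good (set c)" "2 < length c" and path_edges: "path_edges c \<subseteq> S"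
    and e: "tp (hd c) (- last c) \<in> S"
  shows False
proof -
  define k where "k = length c - 1"
  have k: "2 \<le> k" "length c = Suc k" using c(3) by (auto simp: k_def)
  have ne: "c \<noteq> []" using c(3) by auto
  define E where "E i = tp (c ! i) (c ! Suc i)" for i
  let ?e = "tp (hd c) (- last c)"
  have hd: "hd c = c ! 0" and la: "last c = c ! k" using ne k by (simp_all add: hd_conv_nth last_conv_nth)
  have ab: "\<bar>c ! i\<bar> \<noteq> \<bar>c ! j\<bar>" if "i < Suc k" "j < Suc k" "i \<noteq> j" for i j
    using c(1,2) that k nth_eq_iff_index_eq[of c i j] by (auto simp: good_def inj_on_def)
  have nz: "c ! i \<noteq> 0" if "i < Suc k" for i using c(2) that k by (metis good_def nth_mem)
  have peE: "path_edges c = {E i | i. i < k}" unfolding path_edges_nth E_def using k by simp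
  have adj: "E i \<circ> E (Suc i) \<noteq> E (Suc i) \<circ> E i" if "Suc i < k" for i
    unfolding E_def by (rule tp_noncomm'(1)) (use ab nz that in auto)
  \<comment> \<open>The closing edge is rewritten so that the point shared with the first,
    respectively the last, edge of the path has the same sign in both.\<close>
  have ee: "?e = tp (- last c) (hd c)" "?e = tp (- hd c) (last c)"
    using tp_sym[of "hd c" "- last c"] tp_uminus'[of "hd c" "last c"] ab[of 0 k] nz k hd la by (auto simp: adm_def)
  have e1: "?e = tp (- c ! k) (c ! 0)" and e2: "?e = tp (- c ! 0) (c ! k)"
    using ee by (simp_all only: hd la)
  have adj0: "?e \<circ> E 0 \<noteq> E 0 \<circ> ?e"
    unfolding e1 E_def by (rule tp_noncomm'(1)) (use ab nz k in auto)
  have adjk: "E (k - 1) \<circ> ?e \<noteq> ?e \<circ> E (k - 1)"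
  proof -
    have "Suc (k - 1) = k" using k by simp
    then show ?thesis unfolding e2 E_def
      using tp_noncomm'(4)[of "c ! (k - 1)" "c ! k" "- c ! 0"] ab nz k by simp
  qed
  have fixed: "E i (c ! j) = c ! j" if "j < Suc k" "i < k" "j \<noteq> i" "j \<noteq> Suc i" for i j
    unfolding E_def using ab that by (intro tp_other) auto
  have Em: "E i (c ! i) = c ! Suc i" for i by (simp add: E_def)
  have cne: "c ! i \<noteq> c ! j" if "i < Suc k" "j < Suc k" "i \<noteq> j" for i j using ab[OF that] by auto
  have EE: "E i \<noteq> E j" if "i < k" "j < k" "i + 1 < j" for i j
    by (rule tp_neqI[of _ "c ! i"]) (use fixed[of i j] that Em[of i] cne[of i "Suc i"] in auto)
  have e0: "?e (c ! 0) = - (c ! k)" "?e (c ! k) = - (c ! 0)"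
    by (simp add: hd la) (simp only: e2 tp_right)
  have eE: "?e \<noteq> E i" if "0 < i" "i < k" for i
    by (rule tp_neqI[of _ "c ! 0"]) (use fixed[of 0 i] that e0 ab[of 0 k] k in auto)
  have eE': "?e \<noteq> E i" if "i < k - 1" for i
    by (rule tp_neqI[of _ "c ! k"]) (use fixed[of k i] that e0 ab[of 0 k] k in auto)
  show False
  proof (rule forest[of "insert ?e (path_edges c)"])
    let ?T = "insert ?e (path_edges c)"
    have ET: "E i \<in> ?T" if "i < k" for i using peE that by blast
    fix s assume "s \<in> ?T"
    then consider "s = ?e" | i where "s = E i" "i < k" using peE by blast
    then show "\<exists>t\<in>?T. \<exists>u\<in>?T. t \<noteq> u \<and> s \<circ> t \<noteq> t \<circ> s \<and> s \<circ> u \<noteq> u \<circ> s"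
    proof cases
      case 1
      have "E 0 \<noteq> E (k - 1)"
        by (rule tp_neqI[of _ "c ! 0"]) (use fixed[of 0 "k - 1"] Em[of 0] cne[of 0 1] k in auto)
      then show ?thesis using 1 adj0 adjk k ET
        by (intro bexI[of _ "E 0"] bexI[of _ "E (k - 1)"]) auto
    next
      case (2 i)
      consider "i = 0" | "i = k - 1" | "0 < i" "i < k - 1" using 2(2) by linarith
      then show ?thesis
      proof cases
        assume i: "i = 0"
        show ?thesis
          by (intro bexI[of _ ?e] bexI[of _ "E 1"]) (use 2 i not_sym[OF adj0] adj[of 0] eE[of 1] ET[of 1] k in auto)
      next
        assume i: "i = k - 1"
        have "E (k - 2) \<circ> E (k - 1) \<noteq> E (k - 1) \<circ> E (k - 2)"
          using adj[of "k - 2"] k by (simp add: Suc_diff_Suc numeral_2_eq_2)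
        note not_sym[OF this]
        then show ?thesis
          by (intro bexI[of _ ?e] bexI[of _ "E (k - 2)"]) (use 2 i adjk eE'[of "k - 2"] ET k in auto)
      next
        assume i: "0 < i" "i < k - 1"
        have "E (i - 1) \<circ> E i \<noteq> E i \<circ> E (i - 1)" using adj[of "i - 1"] i by simp
        note not_sym[OF this]
        moreover have "E i \<circ> E (Suc i) \<noteq> E (Suc i) \<circ> E i" using adj[of i] i by simp
        ultimately show ?thesis
          by (intro bexI[of _ "E (i - 1)"] bexI[of _ "E (Suc i)"])
            (use 2 i EE[of "i - 1" "Suc i"] ET in auto)
      qed
    qed
  qed (use path_edges e in auto)
qed

text \<open>At an inner point of the path the line of \<open>b\<close> would be a third neighbour,
  excluded by \<open>triangle\<close>; a first point becomes a last one by reversal.\<close>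

lemma end_of_A:
  assumes s: "decomp n path_edges fork_edges S' (p # LA) LD" "S' \<subseteq> S" and a: "a \<in> set p"
    and e: "tp a b \<in> S" "b \<noteq> 0" "\<And>x. x \<in> set p \<Longrightarrow> \<bar>x\<bar> \<noteq> \<bar>b\<bar>"
  shows "\<exists>us. decomp n path_edges fork_edges S' ((us @ [a]) # LA) LD"
proof -
  obtain us vs where p: "p = us @ a # vs" using split_list[OF a] by blast
  have v: "valid n (p # LA @ LD)" and S': "path_edges p \<subseteq> S'" using s by (auto simp: decomp_def gens_union_def)
  note dg = valid_distinct1[OF v, of p, simplified] valid_good1[OF v, of p, simplified]
  show ?thesis
  proof (cases "us = [] \<or> vs = []")
    case True
    then show ?thesis using s(1) decomp_revA[OF s(1)] p by auto
  next
    case False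
    then obtain us' x y vs' where us: "us = us' @ [x]" "vs = y # vs'" by (metis neq_Nil_conv rev_exhaust)
    have p': "p = us' @ x # a # y # vs'" using p us by simp
    have pes: "tp x a \<in> path_edges p" "tp a y \<in> path_edges p" unfolding p' path_edges_append by auto
    have ad: "adm x a" "adm a y" "adm x y" using good_adm[OF dg(2)] dg(1) p' by auto
    then have "tp a x \<in> S" "tp a y \<in> S" using pes tp_sym[OF ad(1)] S' s(2) by auto
    then show ?thesis using triangle[of a x y b] ad e p' by (auto simp: adm_def)
  qed
qed

text \<open>Inner points are excluded by \<open>triangle\<close>, as for paths. At the head of a
  longer fork the new edge would make the doubled edge an inner one, excluded by
  \<open>bridged_square\<close>; a fork on two points can be reversed instead.\<close>

lemma end_of_D:
  assumes s: "decomp n path_edges fork_edges S' LA (q # LD)" "S' \<subseteq> S" and a: "a \<in> set q"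
    and e: "tp a b \<in> S" "b \<noteq> 0" "\<And>x. x \<in> set q \<Longrightarrow> \<bar>x\<bar> \<noteq> \<bar>b\<bar>"
  shows "\<exists>us. us \<noteq> [] \<and> decomp n path_edges fork_edges S' LA ((us @ [a]) # LD)"
proof -
  have v: "valid n (q # LA @ LD)" and S': "fork_edges q \<subseteq> S'" and l: "2 \<le> length q"
    using s(1) by (auto simp: decomp_def gens_union_def valid_front)
  note dg = valid_distinct1[OF v, of q, simplified] valid_good1[OF v, of q, simplified]
  obtain x y r where q: "q = x # y # r" using l by (cases q rule: fork_edges.cases) auto
  have pde: "path_edges q \<subseteq> S" using q S' s(2) by auto
  show ?thesis
  proof (cases "a = x")
    case True
    have xy: "adm x y" using good_adm[OF dg(2)] dg(1) q by auto
    show ?thesis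
    proof (cases r)
      case Nil
      have "fork_edges [y, x] = fork_edges [x, y]"
        using tp_sym[OF xy] tp_sym[of x "- y"] tp_uminus'[OF adm_sym[OF xy]] xy by (simp add: insert_commute)
      moreover have "valid n ([y, x] # LA @ LD)" using valid_rev[OF v] q Nil by simp
      ultimately have "decomp n path_edges fork_edges S' LA ([y, x] # LD)"
        using s(1) q Nil by (simp add: decomp_def gens_union_def valid_front)
      then show ?thesis using True by (intro exI[of _ "[y]"]) simp
    next
      case (Cons z r')
      have "adm x z" "adm y z" using good_adm[OF dg(2)] dg(1) q Cons by auto
      moreover have "\<bar>b\<bar> \<noteq> \<bar>x\<bar>" "\<bar>b\<bar> \<noteq> \<bar>y\<bar>" "\<bar>b\<bar> \<noteq> \<bar>z\<bar>" using e(3)[of x] e(3)[of y] e(3)[of z] q Cons by auto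
      moreover have "tp x y \<in> S" "tp x (- y) \<in> S" "tp y z \<in> S" using q Cons S' s(2) by auto
      moreover have "tp b x \<in> S" using e True tp_sym[of b x] calculation by (auto simp: adm_def)
      ultimately show ?thesis using bridged_square[of b x y z] xy e(2) by (auto simp: adm_def)
    qed
  next
    case False
    obtain us vs where us: "q = us @ a # vs" using split_list[OF a] by blast
    then have "us \<noteq> []" using False q by (cases us) auto
    then obtain us' w where us': "us = us' @ [w]" by (metis rev_exhaust)
    show ?thesis
    proof (cases vs)
      case Nil
      then show ?thesis using us s(1) \<open>us \<noteq> []\<close> by auto
    next
      case (Cons z vs')
      have q': "q = us' @ w # a # z # vs'" using us us' Cons by simp
      have pes: "tp w a \<in> path_edges q" "tp a z \<in> path_edges q" unfolding q' path_edges_append by auto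
      have ad: "adm w a" "adm a z" "adm w z" using good_adm[OF dg(2)] dg(1) q' by auto
      then have "tp a w \<in> S" "tp a z \<in> S" using pes tp_sym[OF ad(1)] pde by auto
      then show ?thesis using triangle[of a w z b] ad e q' by (auto simp: adm_def)
    qed
  qed
qed

text \<open>Two forks joined at their ends form an affine diagram of type D, a tree, so acyclicity
  says nothing. But one fork, the joining edge and the plain path of the other fork already generate
  type D on the union, and with it the doubling edge of the other fork, against minimality.\<close>

lemma no_two_D:
  assumes s: "decomp n path_edges fork_edges S' LA (p # q # LD)" "S' \<subseteq> S" and ab: "a \<in> set p" "b \<in> set q" "tp a b \<in> S"
  shows False
proof -
  have v: "valid n (p # q # LA @ LD)"
    using s(1) valid_perm[of "LA @ p # q # LD" "p # q # LA @ LD" n] by (simp add: decomp_def)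
  have sub: "fork_edges p \<subseteq> S" "fork_edges q \<subseteq> S" and l: "2 \<le> length p" "2 \<le> length q" using s by (auto simp: decomp_def gens_union_def)
  note dp = valid_distinct1[OF v, of p, simplified] valid_good1[OF v, of p, simplified]
  note dq = valid_distinct1[OF v, of q, simplified] valid_good1[OF v, of q, simplified]
  note dis = valid_disjoint[OF v, of q, simplified]
  obtain x y r where q: "q = x # y # r" using l by (cases q rule: fork_edges.cases) auto
  let ?s = "tp x (- y)" and ?T = "fork_edges p \<union> {tp a b} \<union> path_edges q"
  have xy: "adm x y" using good_adm[OF dq(2)] dq(1) q by auto
  have "?s \<notin> ?T"
  proof
    assume "?s \<in> ?T"
    then consider "?s \<in> fork_edges p" | "?s = tp a b" | "?s \<in> path_edges q" by blast
    then show False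
    proof cases
      case 1
      then have "?s \<in> D_gens (set p)" using de_D_gens[OF dp(1)] by blast
      then obtain u w where uw: "u \<in> set p" "w \<in> set p" "?s = tp u w \<or> ?s = tp u (- w)"
        unfolding D_gens_def A_gens_def by blast
      have "\<bar>x\<bar> \<noteq> \<bar>u\<bar>" "\<bar>x\<bar> \<noteq> \<bar>w\<bar>" using dis[of u x] dis[of w x] uw q by auto
      then have "tp u w x = x" "tp u (- w) x = x" by (simp_all add: tp_other)
      then have "?s x = x" using uw(3) by metis
      then have "- y = x" by simp
      then show False using xy by (auto simp: adm_def)
    next
      case 2
      have ax: "\<bar>x\<bar> \<noteq> \<bar>a\<bar>" "\<bar>y\<bar> \<noteq> \<bar>a\<bar>" using dis[of a x] dis[of a y] ab q by auto
      have "tp a b x = - y" using 2 tp_left by metis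
      then show False using ax xy by (auto simp: tp_def adm_def split: if_splits)
    next
      case 3
      then have "?s \<in> A_gens (set q)" using pe_A_gens[OF dq(1)] by blast
      then obtain u w where uw: "u \<in> set q" "w \<in> set q" "?s = tp u w" unfolding A_gens_def by blast
      have "tp u w x = - y" using uw(3) tp_left by metis
      moreover have "x \<in> set q" "y \<in> set q" using q by auto
      moreover note good_no_neg[OF dq(2) uw(1)] good_no_neg[OF dq(2) uw(2)] good_no_neg[OF dq(2), of y]
      ultimately show False using uw by (auto simp: tp_def split: if_splits)
    qed
  qed
  moreover have "path_edges q \<subseteq> S" using sub(2) q by auto
  ultimately have T: "?T \<subseteq> S - {?s}" using sub ab by blast
  have D: "D_gens (set p \<union> set q) \<subseteq> gen ?T"
  proof -
    obtain a' where a': "a' \<in> set p" "a \<noteq> a'" using two_elems[OF l(1) dp(1) ab(1)] by blast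
    show ?thesis
    proof (rule D_merge[OF merge_good[OF v] _ _ ab(1) a' ab(2)])
      show "D_gens (set p) \<subseteq> gen ?T" using D_gens_fork_edges[OF dp l(1)] gen_mono[of "fork_edges p" ?T] by blast
      show "A_gens (set q) \<subseteq> gen ?T" using A_gens_path_edges[OF dq] gen_mono[of "path_edges q" ?T] by blast
      show "tp a b \<in> gen ?T" by (rule gen_base) simp
    qed
  qed
  have "?s \<in> D_gens (set p \<union> set q)" by (rule D_gensI(2)) (use q dq in auto)
  then have "?s \<in> gen (S - {?s})" using D gen_mono[OF T] by blast
  moreover have "?s \<in> S" using q sub(2) by auto
  ultimately show False using minimal by blast
qed

text \<open>Minimality keeps the new edge out of the group of \<open>S'\<close>, which excludes
  positive edges inside a path and all edges inside a fork. A negative edge inside a path can only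
  double an end edge, and an edge between two blocks attaches at free ends.\<close>

lemma extend:
  assumes st: "decomp n path_edges fork_edges S' LA LD" and S': "S' \<subseteq> S" and e: "e \<in> S" "e \<notin> S'"
  shows "\<exists>LA' LD'. decomp n path_edges fork_edges (insert e S') LA' LD'"
proof -
  obtain a b where ab: "e = tp a b" "a \<in> pts n" "b \<in> pts n" "\<bar>a\<bar> \<noteq> \<bar>b\<bar>" "adm a b"
    using e refl reflectionsE by blast
  have min: "e \<notin> gen S'"
    using minimal[OF e(1)] gen_mono[of S' "S - {e}"] S' e(2) by blast
  have nz: "a \<noteq> 0" "b \<noteq> 0" using ab(5) by (auto simp: adm_def)
  have e': "tp a b \<in> S" "tp b a \<in> S" using e(1) ab(1) tp_sym[OF ab(5)] by simp_all
  have away: "\<bar>x\<bar> \<noteq> \<bar>b\<bar>" if "x \<in> set p" "\<not> (b \<in> set p \<or> - b \<in> set p)" for x p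
    using that by (auto simp: abs_eq_iff)
  show ?thesis
    using st neg_inv_path_edges neg_inv_fork_edges ab(2)
  proof (cases rule: decomp_pick)
    case (A p LA')
    have v: "valid n (p # LA' @ LD)" and SU: "S' = path_edges p \<union> gens_union path_edges fork_edges LA' LD" using A(1) by (auto simp: decomp_def gens_union_def)
    note dg = valid_distinct1[OF v, of p, simplified] valid_good1[OF v, of p, simplified]
    show ?thesis
    proof (cases "b \<in> set p \<or> - b \<in> set p")
      case True
      have "b \<notin> set p"
      proof
        assume "b \<in> set p"
        then have "e \<in> gA p" unfolding ab(1) using A(2) ab(4) by (intro A_gensI) auto
        then show False using A_gens_path_edges[OF dg] gen_mono[of "path_edges p" S'] SU min by blast
      qed
      then have b: "- b \<in> set p" using True by blast
      \<comment> \<open>It is enough to treat \<open>- b\<close> behind \<open>a\<close>, since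
        reversing the path exchanges the two situations.\<close>
      have main: ?thesis if s: "decomp n path_edges fork_edges S' ((us @ a # vs) # LA') LD" and b: "- b \<in> set vs" for us vs
      proof -
        obtain m ws where vs: "vs = m @ (- b) # ws" using split_list[OF b] by blast
        let ?p = "us @ a # m @ (- b) # ws"
        have s: "decomp n path_edges fork_edges S' (?p # LA') LD" using s vs by simp
        have v: "valid n (?p # LA' @ LD)" and SU: "S' = path_edges ?p \<union> gens_union path_edges fork_edges LA' LD" using s by (auto simp: decomp_def gens_union_def)
        note dg = valid_distinct1[OF v, of ?p, simplified] valid_good1[OF v, of ?p, simplified]
        show ?thesis
        proof (cases m)
          \<comment> \<open>Some point lies between \<open>a\<close> and \<open>- b\<close>: the new
            edge closes this stretch of the path to a negative cycle.\<close>
          case (Cons z m')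
          have sub: "path_edges (a # m @ [- b]) \<subseteq> path_edges ?p"
          proof -
            have "path_edges ?p \<supseteq> path_edges (a # m @ (- b) # ws)" by (cases us rule: rev_cases) (auto simp: path_edges_append)
            moreover have "path_edges ((a # m) @ (- b) # ws) \<supseteq> path_edges ((a # m) @ [- b])"
            proof (cases ws)
              case (Cons y ws')
              show ?thesis unfolding Cons path_edges_append[of "a # m" "- b" y ws'] by blast
            qed simp
            ultimately show ?thesis by simp
          qed
          have "False"
            by (rule long_cycle[of "a # m @ [- b]"])
              (use sub SU S' e' Cons dg in \<open>auto intro: good_subset[OF valid_good1[OF v, of ?p]]\<close>)
          then show ?thesis ..
        next
          \<comment> \<open>Now the new edge doubles an edge of the path, which has to be the first
            or the last one.\<close>
          case Nil
          have D: ?thesis if "decomp n path_edges fork_edges S' ((a # (- b) # ws) # LA') LD" for ws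
          proof -
            have "decomp n path_edges fork_edges (insert e S') LA' ((a # (- b) # ws) # LD)"
              using that ab(1) by (auto simp: decomp_def gens_union_def valid_front)
            then show ?thesis by blast
          qed
          show ?thesis
          proof (cases "us = [] \<or> ws = []")
            case True
            then show ?thesis
            proof
              assume "us = []" then show ?thesis using D[of ws] s Nil by simp
            next
              assume w: "ws = []"
              have "decomp n path_edges fork_edges S' (((- b) # a # rev us) # LA') LD"
                using decomp_revA[OF s] Nil w by simp
              then have "decomp n path_edges fork_edges (insert e S') LA' (((- b) # a # rev us) # LD)"
                using ab(1) tp_sym[OF ab(5)] tp_uminus[OF adm_sym[OF ab(5)]] by (auto simp: decomp_def gens_union_def valid_front)
              then show ?thesis by blast
            qed
          next
            case False
            then obtain us' x y ws' where us: "us = us' @ [x]" "ws = y # ws'" by (metis neq_Nil_conv rev_exhaust)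
            have p': "?p = us' @ x # a # (- b) # y # ws'" using us Nil by simp
            have pes: "tp x a \<in> path_edges ?p" "tp a (- b) \<in> path_edges ?p" "tp (- b) y \<in> path_edges ?p"
              unfolding p' using path_edges_append[of "us'" x a] path_edges_append[of "us' @ [x]" a "- b"]
                path_edges_append[of "us' @ [x, a]" "- b" y] by auto
            have inS: "tp x a \<in> S" "tp a (- b) \<in> S" "tp a (- (- b)) \<in> S" "tp (- b) y \<in> S"
              using pes SU S' e'(1) by auto
            have "adm x a" "adm a y" "adm x y" "adm x (- b)" "adm (- b) y"
            proof -
              have "good (set (us' @ x # a # (- b) # y # ws'))"
                using valid_good1[OF v, of ?p] unfolding p' by simp
              note ga = good_adm[OF this]
              have "distinct (us' @ x # a # (- b) # y # ws')"
                using valid_distinct1[OF v, of ?p] unfolding p' by simp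
              then show "adm x a" "adm a y" "adm x y" "adm x (- b)" "adm (- b) y"
                by (auto intro!: ga simp del: adm_uminus)
            qed
            then show ?thesis
              using bridged_square[OF inS] ab(5) by (auto simp: adm_def)
          qed
        qed
      qed
      obtain us vs where p: "p = us @ a # vs" using split_list[OF A(2)] by blast
      have "- b \<noteq> a" using ab(4) by auto
      then have "- b \<in> set us \<or> - b \<in> set vs" using b p by auto
      then show ?thesis
      proof
        assume "- b \<in> set vs" then show ?thesis using main A(1) p by blast
      next
        assume "- b \<in> set us"
        then show ?thesis using main[of "rev vs" "rev us"] decomp_revA[OF A(1)] p by simp
      qed
    next
      case False
      obtain us where us: "decomp n path_edges fork_edges S' ((us @ [a]) # LA') LD"
        using end_of_A[OF A(1) S' A(2) e'(1) nz(2)] away False by blast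
      \<comment> \<open>Moving \<open>a\<close> to the end may have changed the list, but its lines
        are still those of \<open>p\<close>, being the complement of the other blocks.\<close>
      have setp: "\<not> (b \<in> set (us @ [a]) \<or> - b \<in> set (us @ [a]))"
      proof -
        have vu: "valid n ((us @ [a]) # LA' @ LD)" using us by (simp add: decomp_def)
        have "abs ` set (us @ [a]) = abs ` set p"
        proof -
          have split: "abs ` set p' = {1..int n} - abs ` set (concat (LA' @ LD))"
            if vq: "valid n (p' # LA' @ LD)" for p'
          proof -
            have d: "distinct (map abs p' @ map abs (concat (LA' @ LD)))" and
              u: "abs ` set p' \<union> abs ` set (concat (LA' @ LD)) = {1..int n}"
              using vq by (simp_all add: valid_def image_Un Un_assoc)
            have "abs ` set p' \<inter> abs ` set (concat (LA' @ LD)) = {}"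
              using d unfolding distinct_append set_map by blast
            then show ?thesis using u by blast
          qed
          show ?thesis using split[OF vu] split[OF v] by simp
        qed
        moreover have "\<bar>b\<bar> \<notin> abs ` set p" using away[OF _ False] by force
        ultimately show ?thesis by (metis abs_minus_cancel imageI)
      qed
      show ?thesis using us neg_inv_path_edges neg_inv_fork_edges ab(3) setp
      proof (cases rule: decomp_pickA)
        case A': (A q LA'')
        have s2: "decomp n path_edges fork_edges S' (q # (us @ [a]) # LA'') LD"
          using decomp_perm[OF A'(1), of "q # (us @ [a]) # LA''" LD] by simp
        have v2: "valid n (q # (us @ [a]) # LA'' @ LD)" using s2 by (simp add: decomp_def)
        have "\<bar>x\<bar> \<noteq> \<bar>a\<bar>" if "x \<in> set q" for x
          using valid_disjoint[OF v2, of "us @ [a]" x a] that by simp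
        then obtain ws where ws: "decomp n path_edges fork_edges S' ((ws @ [b]) # (us @ [a]) # LA'') LD"
          using end_of_A[OF s2 S' A'(2) e'(2) nz(1)] by blast
        have "decomp n path_edges fork_edges S' ((b # rev ws) # (us @ [a]) # LA'') LD" using decomp_revA[OF ws] by simp
        then have s3: "decomp n path_edges fork_edges S' ((us @ [a]) # (b # rev ws) # LA'') LD"
          using decomp_perm[of n path_edges fork_edges S' "(b # rev ws) # (us @ [a]) # LA''" LD "(us @ [a]) # (b # rev ws) # LA''" LD]
          by simp
        then have "decomp n path_edges fork_edges (insert e S') ((us @ a # b # rev ws) # LA'') LD"
          using valid_merge[of n "us @ [a]" "b # rev ws" "LA'' @ LD"] ab(1)
          by (auto simp: decomp_def gens_union_def path_edges_append)
        then show ?thesis by blast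
      next
        case (D q LD')
        have v2: "valid n (q # (us @ [a]) # LA' @ LD')"
          using D(1) valid_perm[of "(us @ [a]) # LA' @ q # LD'" "q # (us @ [a]) # LA' @ LD'" n] by (simp add: decomp_def)
        have "\<bar>x\<bar> \<noteq> \<bar>a\<bar>" if "x \<in> set q" for x
          using valid_disjoint[OF v2, of "us @ [a]" x a] that by simp
        then obtain ws where ws: "ws \<noteq> []" "decomp n path_edges fork_edges S' ((us @ [a]) # LA') ((ws @ [b]) # LD')"
          using end_of_D[OF D(1) S' D(2) e'(2) nz(1)] by blast
        \<comment> \<open>In the merged list the fork has to come first, so the path is reversed to
          start at \<open>a\<close>.\<close>
        have s3: "decomp n path_edges fork_edges S' ((a # rev us) # LA') ((ws @ [b]) # LD')" using decomp_revA[OF ws(2)] by simp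
        have v3: "valid n ((ws @ [b]) # (a # rev us) # LA' @ LD')"
          using s3 valid_perm[of "(a # rev us) # LA' @ (ws @ [b]) # LD'" "(ws @ [b]) # (a # rev us) # LA' @ LD'" n]
          by (simp add: decomp_def)
        have "decomp n path_edges fork_edges (insert e S') LA' ((ws @ b # a # rev us) # LD')"
          using s3 valid_merge[OF v3] ab(1) tp_sym[OF ab(5)]
          by (auto simp: decomp_def gens_union_def fork_edges_append[OF ws(1)] valid_front)
        then show ?thesis by blast
      qed
    qed
  next
    case (D p LD')
    have v: "valid n (p # LA @ LD')" and SU: "S' = fork_edges p \<union> gens_union path_edges fork_edges LA LD'" and l: "2 \<le> length p"
      using D(1) by (auto simp: decomp_def gens_union_def valid_front)
    note dg = valid_distinct1[OF v, of p, simplified] valid_good1[OF v, of p, simplified]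
    show ?thesis
    proof (cases "b \<in> set p \<or> - b \<in> set p")
      case True
      then have "e \<in> gD p"
        using D_gensI(1)[of a "set p" b] D_gensI(2)[of a "set p" "- b"] ab(1,4) D(2) by auto
      then have "e \<in> gen S'" using D_gens_fork_edges[OF dg l] gen_mono[of "fork_edges p" S'] SU by blast
      then show ?thesis using min by blast
    next
      case False
      show ?thesis using D(1) neg_inv_path_edges neg_inv_fork_edges ab(3) False
      proof (cases rule: decomp_pickD)
        case (A q LA')
        have v1: "valid n (p # q # LA' @ LD')"
          using A(1) valid_perm[of "q # LA' @ p # LD'" "p # q # LA' @ LD'" n] by (simp add: decomp_def)
        have "\<bar>x\<bar> \<noteq> \<bar>a\<bar>" if "x \<in> set q" for x
          using valid_disjoint[OF v1, of q a x] that D(2) by simp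
        then obtain us where us: "decomp n path_edges fork_edges S' ((us @ [b]) # LA') (p # LD')"
          using end_of_A[OF A(1) S' A(2) e'(2) nz(1)] by blast
        obtain ws where ws: "ws \<noteq> []" "decomp n path_edges fork_edges S' ((us @ [b]) # LA') ((ws @ [a]) # LD')"
          using end_of_D[OF us S' D(2) e'(1) nz(2)] away False by blast
        have s3: "decomp n path_edges fork_edges S' ((b # rev us) # LA') ((ws @ [a]) # LD')" using decomp_revA[OF ws(2)] by simp
        have v3: "valid n ((ws @ [a]) # (b # rev us) # LA' @ LD')"
          using s3 valid_perm[of "(b # rev us) # LA' @ (ws @ [a]) # LD'" "(ws @ [a]) # (b # rev us) # LA' @ LD'" n]
          by (simp add: decomp_def)
        have "decomp n path_edges fork_edges (insert e S') LA' ((ws @ a # b # rev us) # LD')"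
          using s3 valid_merge[OF v3] ab(1)
          by (auto simp: decomp_def gens_union_def fork_edges_append[OF ws(1)] valid_front)
        then show ?thesis by blast
      next
        case D': (D q LD'')
        then show ?thesis using no_two_D[OF D'(1) S' D(2) D'(2) e'(1)] by blast
      qed
    qed
  qed
qed

lemma decompose: "\<exists>LA LD. decomp n path_edges fork_edges S LA LD"
proof -
  have "finite S" using refl finite_reflections finite_subset by blast
  have "\<exists>LA LD. decomp n path_edges fork_edges T LA LD" if "T \<subseteq> S" for T
    using finite_subset[OF that \<open>finite S\<close>] that
  proof (induction T rule: finite_induct)
    case empty
    have "decomp n path_edges fork_edges {} (map (\<lambda>i. [i]) [1..int n]) []"
      using valid_singletons[of n] by (simp add: decomp_def gens_union_def)
    then show ?case by blast
  next
    case (insert e T)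
    then show ?case using extend[of T _ _ e] by blast
  qed
  then show ?thesis by blast
qed

end

lemma coxeter_gen_set_pieces:
  assumes "coxeter_gen_set n R S"
  obtains LA LD where "decomp n path_edges fork_edges S LA LD" "pieces n LA LD" "R = piece_group LA LD"
proof -
  interpret forest_set n S
  proof
    show "S \<subseteq> reflections n" using assms by (simp add: coxeter_gen_set_def)
    show "s \<notin> gen (S - {s})" if "s \<in> S" for s using coxeter_minimal[OF assms that] .
    show False if "T \<subseteq> S" "T \<noteq> {}"
      "\<And>s. s \<in> T \<Longrightarrow> \<exists>t\<in>T. \<exists>u\<in>T. t \<noteq> u \<and> s \<circ> t \<noteq> t \<circ> s \<and> s \<circ> u \<noteq> u \<circ> s" for T
      by (rule coxeter_forest[OF assms that])
  qed
  obtain LA LD where st: "decomp n path_edges fork_edges S LA LD" using decompose by blast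
  have "gen S = R" using assms by (simp add: coxeter_gen_set_def)
  then show ?thesis using that[OF st] decomp_gen[OF st] by simp
qed

section \<open>Cycles of Coxeter elements\<close>

text \<open>Signed representatives are chosen along the cycle, so that \<open>c\<close> moves each
  exactly to the next and the whole sign is collected in the last step; \<open>e\<close> is 1 for a
  positive and -1 for a negative cycle.\<close>

definition signed_cycle :: "(int \<Rightarrow> int) \<Rightarrow> int \<Rightarrow> int list \<Rightarrow> bool" where
  "signed_cycle c e xs \<longleftrightarrow> xs \<noteq> [] \<and> map c xs = tl xs @ [e * hd xs]"

definition cycle_decomp :: "nat \<Rightarrow> (int \<Rightarrow> int) \<Rightarrow> int list list \<Rightarrow> int list list \<Rightarrow> bool" where
  "cycle_decomp n c P N \<longleftrightarrow> valid n (P @ N) \<and> (\<forall>p\<in>set P. signed_cycle c 1 p) \<and> (\<forall>q\<in>set N. signed_cycle c (-1) q)"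

lemma signed_cycle_nth: "signed_cycle c e xs \<Longrightarrow> Suc i < length xs \<Longrightarrow> c (xs ! i) = xs ! Suc i"
proof -
  assume s: "signed_cycle c e xs" and i: "Suc i < length xs"
  have i': "i < length (tl xs)" using i by simp
  have "c (xs ! i) = map c xs ! i" using i by simp
  also have "\<dots> = (tl xs @ [e * hd xs]) ! i" using s by (simp add: signed_cycle_def)
  also have "\<dots> = xs ! Suc i" using i' by (simp only: nth_append nth_tl if_True)
  finally show ?thesis .
qed

lemma signed_cycle_last: "signed_cycle c e xs \<Longrightarrow> c (last xs) = e * hd xs"
  by (metis last_map last_snoc signed_cycle_def)

lemma signed_cycle_mem: "signed_cycle c e xs \<Longrightarrow> x \<in> set xs \<Longrightarrow> c x \<in> set xs \<or> c x = e * hd xs"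
proof -
  assume s: "signed_cycle c e xs" and "x \<in> set xs"
  then have "c x \<in> set (map c xs)" by simp
  moreover have "map c xs = tl xs @ [e * hd xs]" "xs \<noteq> []" using s by (simp_all add: signed_cycle_def)
  ultimately have "c x \<in> set (tl xs @ [e * hd xs])" by (simp only:)
  then show ?thesis using \<open>xs \<noteq> []\<close> by (auto dest: list.set_sel(2))
qed

lemma signed_cycle_funpow: "signed_cycle c e xs \<Longrightarrow> i + k < length xs \<Longrightarrow> (c ^^ k) (xs ! i) = xs ! (i + k)"
  by (induction k) (auto simp: signed_cycle_nth)

lemma signed_cycle_reach:
  assumes s: "signed_cycle c e xs" and e: "e = 1 \<or> e = -1" and c: "\<And>i. c (- i) = - c i"
    and xy: "x \<in> set xs" "y \<in> set xs"
  shows "\<exists>k. \<bar>(c ^^ k) x\<bar> = \<bar>y\<bar>"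
proof -
  have co: "(c ^^ k) (- i) = - (c ^^ k) i" for k i using c by (induction k) auto
  have ne: "xs \<noteq> []" using s by (simp add: signed_cycle_def)
  obtain i j where ij: "x = xs ! i" "y = xs ! j" "i < length xs" "j < length xs"
    using xy by (auto simp: in_set_conv_nth)
  have "(c ^^ (length xs - 1 - i)) x = xs ! (length xs - 1)"
    using signed_cycle_funpow[OF s, of i "length xs - 1 - i"] ij by simp
  then have "(c ^^ (length xs - i)) x = e * hd xs"
    using signed_cycle_last[OF s] ij last_conv_nth[OF ne] Suc_diff_Suc[of i "length xs"]
    by (metis Suc_diff_1 comp_apply diff_Suc_eq_diff_pred diff_commute funpow.simps(2) length_greater_0_conv ne zero_less_diff)
  moreover have "(c ^^ j) (hd xs) = y" using signed_cycle_funpow[OF s, of 0 j] ij ne by (simp add: hd_conv_nth)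
  ultimately have "\<bar>(c ^^ (j + (length xs - i))) x\<bar> = \<bar>y\<bar>"
    using e co[of j "hd xs"] by (auto simp: funpow_add)
  then show ?thesis by blast
qed

lemma WB_funpow: "c \<in> WB n \<Longrightarrow> c ^^ k \<in> WB n"
proof (induction k)
  case 0 show ?case using WB_id by (simp add: id_def)
next
  case (Suc k) then show ?case by (metis WB_comp funpow.simps(2))
qed

text \<open>Applying \<open>c\<close> to the list rotates it and multiplies one entry by
  \<open>e\<close>.\<close>

lemma prod_list_sgn_signed_cycle:
  assumes "signed_cycle c e xs" "e = 1 \<or> e = -1"
  shows "prod_list (map (\<lambda>x. sgn (c x)) xs) = e * prod_list (map sgn xs)"
proof -
  have "prod_list (map (\<lambda>x. sgn (c x)) xs) = prod_list (map sgn (map c xs))" by (simp add: comp_def)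
  also have "\<dots> = prod_list (map sgn (tl xs @ [e * hd xs]))" using assms(1) by (simp only: signed_cycle_def)
  also have "\<dots> = e * prod_list (map sgn xs)"
    using assms by (cases xs) (auto simp: signed_cycle_def sgn_mult)
  finally show ?thesis .
qed

lemma cycle_type_cycle_decomp:
  assumes c: "c \<in> WB n" and dec: "cycle_decomp n c P N"
  shows "cycle_type n c = (mset (map length P), mset (map length N))"
proof -
  have v: "valid n (P @ N)" using dec by (simp add: cycle_decomp_def)
  have sc: "\<exists>e. (e = 1 \<or> e = -1) \<and> signed_cycle c e p" if "p \<in> set (P @ N)" for p
    using dec that unfolding cycle_decomp_def by fastforce
  have orb: "line_orbit c (nat \<bar>x\<bar>) = {nat \<bar>(c ^^ k) x\<bar> | k. True}" for x
    unfolding line_orbit_def by (simp add: WB_abs'[OF WB_funpow[OF c]])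
  have F: "line_orbit c (nat \<bar>x\<bar>) = supp p" if p: "p \<in> set (P @ N)" "x \<in> set p" for p x
  proof
    obtain e where e: "e = 1 \<or> e = -1" "signed_cycle c e p" using sc p(1) by blast
    have step: "\<bar>c y\<bar> \<in> abs ` set p" if y: "\<bar>y\<bar> \<in> abs ` set p" for y
    proof -
      obtain z where z: "z \<in> set p" "\<bar>y\<bar> = \<bar>z\<bar>" using y by blast
      then have "\<bar>c y\<bar> = \<bar>c z\<bar>" using WB_abs[OF c] by blast
      moreover have "c z \<in> set p \<or> c z = e * hd p" by (rule signed_cycle_mem[OF e(2) z(1)])
      moreover have "hd p \<in> set p" using e(2) by (simp add: signed_cycle_def)
      ultimately show ?thesis using e(1) by auto
    qed
    have "\<bar>(c ^^ k) x\<bar> \<in> abs ` set p" for k using p(2) step by (induction k) auto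
    moreover have "supp p = nat ` (abs ` set p)" by (simp add: supp_def image_image)
    ultimately show "line_orbit c (nat \<bar>x\<bar>) \<subseteq> supp p" unfolding orb by blast
    show "supp p \<subseteq> line_orbit c (nat \<bar>x\<bar>)"
    proof
      fix y assume "y \<in> supp p"
      then obtain z where z: "z \<in> set p" "y = nat \<bar>z\<bar>" by (auto simp: supp_def)
      obtain k where "\<bar>(c ^^ k) x\<bar> = \<bar>z\<bar>" using signed_cycle_reach[OF e(2,1) WB_odd[OF c] p(2) z(1)] by blast
      then show "y \<in> line_orbit c (nat \<bar>x\<bar>)" unfolding orb z(2) by (intro CollectI exI[of _ k]) simp
    qed
  qed
  \<comment> \<open>\<open>neg_cycle\<close> counts signs on positive representatives, whereas the
    list has signed ones. As \<open>sgn (c \<bar>x\<bar>) = sgn (c x) * sgn x\<close>, the product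
    in question is that of the signs of the images times that of the signs of the entries, and these
    cancel up to \<open>e\<close>.\<close>
  have parity: "(-1 :: int) ^ card {j \<in> supp p. c (int j) < 0} = e"
    if p: "p \<in> set (P @ N)" and e: "signed_cycle c e p" "e = 1 \<or> e = -1" for p e
  proof -
    have nz: "x \<noteq> 0" "c x \<noteq> 0" if "x \<in> set p" for x
      using valid_pts[OF v p that] WB_pts[OF c, of x] pts_nz by blast+
    have inj: "inj_on (\<lambda>x. nat \<bar>x\<bar>) (set p)"
      using valid_good1[OF v p] by (auto simp: good_def inj_on_def)
    have sq: "prod_list (map sgn p) * prod_list (map sgn p) = 1" using nz(1)
    proof (induction p)
      case (Cons x p)
      have "sgn x * sgn x = 1" using Cons.prems[of x] by (auto simp: sgn_if)
      then show ?case using Cons by (simp add: algebra_simps)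
    qed simp
    have "(-1) ^ card {j \<in> supp p. c (int j) < 0} = (\<Prod>j\<in>{j \<in> supp p. c (int j) < 0}. -1)" by simp
    also have "\<dots> = (\<Prod>j\<in>supp p. sgn (c (int j)))"
    proof (rule prod.mono_neutral_cong_left)
      show "finite (supp p)" by (simp add: supp_def)
      show "\<forall>i\<in>supp p - {j \<in> supp p. c (int j) < 0}. sgn (c (int i)) = 1"
      proof
        fix i assume i: "i \<in> supp p - {j \<in> supp p. c (int j) < 0}"
        then obtain x where "x \<in> set p" "i = nat \<bar>x\<bar>" by (auto simp: supp_def)
        then have "\<bar>c (int i)\<bar> = \<bar>c x\<bar>" "c x \<noteq> 0" using WB_abs'[OF c] nz by simp_all
        then show "sgn (c (int i)) = 1" using i by (auto simp: sgn_if)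
      qed
    qed auto
    also have "\<dots> = (\<Prod>x\<in>set p. sgn (c \<bar>x\<bar>))"
      unfolding supp_def by (simp add: prod.reindex[OF inj])
    also have "\<dots> = (\<Prod>x\<in>set p. sgn (c x) * sgn x)"
    proof (rule prod.cong)
      fix x assume "x \<in> set p"
      then show "sgn (c \<bar>x\<bar>) = sgn (c x) * sgn x"
        using nz[of x] WB_odd[OF c, of x] by (cases "x > 0") auto
    qed simp
    also have "\<dots> = prod_list (map (\<lambda>x. sgn (c x)) p) * prod_list (map sgn p)"
      using valid_distinct1[OF v p] by (simp add: prod.distrib prod.distinct_set_conv_list)
    also have "\<dots> = e" unfolding prod_list_sgn_signed_cycle[OF e] using sq by simp
    finally show ?thesis .
  qed
  have N1: "\<not> neg_cycle c (supp p)" if "p \<in> set P" for p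
    using parity[of p 1] dec that unfolding cycle_decomp_def neg_cycle_def
    by (metis Un_iff neg_one_odd_power one_neq_neg_one set_append)
  have N2: "neg_cycle c (supp p)" if "p \<in> set N" for p
    using parity[of p "-1"] dec that unfolding cycle_decomp_def neg_cycle_def
    by (metis Un_iff neg_one_even_power one_neq_neg_one set_append)
  show ?thesis unfolding cycle_type_def cycles_def
    using type_of_pieces[where F = "line_orbit c" and N = "neg_cycle c", OF v F N1 N2] by simp
qed

lemma signed_cycle_conj:
  assumes "g \<in> WB n" "signed_cycle c e xs" "e = 1 \<or> e = -1"
  shows "signed_cycle (conj g c) e (map g xs)"
proof -
  have ne: "xs \<noteq> []" using assms by (simp add: signed_cycle_def)
  have "map (conj g c) (map g xs) = map g (map c xs)" using conj_apply[OF WB_bij[OF assms(1)]] by simp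
  also have "\<dots> = map g (tl xs) @ [g (e * hd xs)]" using assms(2) by (simp add: signed_cycle_def)
  also have "g (e * hd xs) = e * g (hd xs)" using assms(3) WB_odd[OF assms(1)] by auto
  finally show ?thesis using ne unfolding signed_cycle_def by (simp add: map_tl hd_map)
qed

lemma cycle_decomp_conj:
  assumes "g \<in> WB n" "cycle_decomp n c P N"
  shows "cycle_decomp n (conj g c) (map (map g) P) (map (map g) N)"
  using assms valid_map[OF assms(1), of "P @ N"] signed_cycle_conj[OF assms(1)] by (auto simp: cycle_decomp_def)

lemma signed_cycle_rotate: "signed_cycle c 1 (us @ x # vs) \<Longrightarrow> signed_cycle c 1 (x # vs @ us)"
proof (induction us arbitrary: vs)
  case (Cons u us)
  have "map c (us @ x # vs) = tl (us @ x # vs) @ [u]" "c u = hd (us @ x # vs)"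
    using Cons.prems by (cases us, auto simp: signed_cycle_def)+
  then have "signed_cycle c 1 (us @ x # (vs @ [u]))" by (cases us) (auto simp: signed_cycle_def)
  then show ?case using Cons.IH[of "vs @ [u]"] by simp
qed simp

section \<open>Products over a path and over a fork\<close>

lemma eval_word_fix: "(\<And>w. w \<in> set ws \<Longrightarrow> w x = x) \<Longrightarrow> eval_word ws x = x"
  by (induction ws) (auto simp: eval_word_Nil eval_word_Cons)

lemma path_edges_other: "w \<in> path_edges p \<Longrightarrow> \<bar>x\<bar> \<notin> abs ` set p \<Longrightarrow> w x = x"
  by (induction p rule: path_edges.induct) (auto simp: tp_other)

lemma path_edges_preserves: "good (set p) \<Longrightarrow> w \<in> path_edges p \<Longrightarrow> x \<in> set p \<Longrightarrow> w x \<in> set p"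
  unfolding path_edges_nth
proof -
  assume g: "good (set p)" and w: "w \<in> {tp (p ! i) (p ! Suc i) | i. Suc i < length p}" and x: "x \<in> set p"
  then obtain a b where ab: "w = tp a b" "a \<in> set p" "b \<in> set p" by force
  have "x \<noteq> - a" "x \<noteq> - b" using good_no_neg[OF g] ab x by auto
  then show "w x \<in> set p" using ab x by (auto simp: tp_def)
qed

lemma fork_edges_cases: "w \<in> fork_edges q \<Longrightarrow> \<exists>a\<in>set q. \<exists>b\<in>set q. w = tp a b \<or> w = tp a (- b)"
proof (cases q rule: fork_edges.cases)
  case (1 x y r)
  assume "w \<in> fork_edges q"
  then have "w = tp x (- y) \<or> w \<in> path_edges q" using 1 by auto
  then show ?thesis
  proof
    assume "w = tp x (- y)" then show ?thesis using 1 by auto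
  next
    assume "w \<in> path_edges q" then show ?thesis unfolding path_edges_nth by force
  qed
qed auto

lemma fork_edges_other: "w \<in> fork_edges q \<Longrightarrow> \<bar>x\<bar> \<notin> abs ` set q \<Longrightarrow> w x = x"
proof -
  assume "w \<in> fork_edges q" and x: "\<bar>x\<bar> \<notin> abs ` set q"
  then obtain a b where ab: "a \<in> set q" "b \<in> set q" "w = tp a b \<or> w = tp a (- b)"
    using fork_edges_cases by blast
  then have "\<bar>x\<bar> \<noteq> \<bar>a\<bar>" "\<bar>x\<bar> \<noteq> \<bar>b\<bar>" using x by auto
  then show ?thesis using ab(3) by (auto simp: tp_other)
qed

lemma fork_edges_preserves: "w \<in> fork_edges q \<Longrightarrow> \<bar>x\<bar> \<in> abs ` set q \<Longrightarrow> \<bar>w x\<bar> \<in> abs ` set q"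
  using fork_edges_cases[of w q] by (auto simp: tp_def)

lemma eval_word_preserves: "(\<And>w x. w \<in> set ws \<Longrightarrow> x \<in> A \<Longrightarrow> w x \<in> A) \<Longrightarrow> x \<in> A \<Longrightarrow> eval_word ws x \<in> A"
  by (induction ws) (auto simp: eval_word_Nil eval_word_Cons)

lemma eval_word_inv:
  assumes "\<And>w. w \<in> set ws \<Longrightarrow> w \<circ> w = id"
  shows "eval_word (rev ws) \<circ> eval_word ws = id" "eval_word ws \<circ> eval_word (rev ws) = id"
  using eval_word_rev[of ws] eval_word_rev[of "rev ws"] assms by auto

text \<open>Cyclic rotation of a word is a conjugation.\<close>

lemma signed_cycle_eval_rotate:
  assumes inv: "\<And>w. w \<in> set (u @ e # v) \<Longrightarrow> w \<circ> w = id"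
    and odd: "\<And>i. eval_word (rev v) (- i) = - eval_word (rev v) i"
    and s: "signed_cycle (eval_word (v @ u) \<circ> e) d ys" "d = 1 \<or> d = -1"
  shows "signed_cycle (eval_word (u @ e # v)) d (map (eval_word (rev v)) ys)"
proof -
  let ?g = "eval_word (rev v)"
  have vv: "eval_word v (?g x) = x" "?g (eval_word v x) = x" for x
    using eval_word_inv[of v] inv by (auto simp: fun_eq_iff)
  have "eval_word (u @ e # v) (?g y) = ?g ((eval_word (v @ u) \<circ> e) y)" for y
    by (simp add: eval_word_append eval_word_Cons vv)
  then have "map (eval_word (u @ e # v)) (map ?g ys) = map ?g (map (eval_word (v @ u) \<circ> e) ys)"
    by simp
  also have "\<dots> = map ?g (tl ys) @ [?g (d * hd ys)]" using s(1) by (simp add: signed_cycle_def)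
  also have "?g (d * hd ys) = d * ?g (hd ys)" using s(2) odd by auto
  finally show ?thesis using s(1) unfolding signed_cycle_def by (simp add: map_tl hd_map)
qed

lemma path_edges_invol: "distinct p \<Longrightarrow> good (set p) \<Longrightarrow> w \<in> path_edges p \<Longrightarrow> w \<circ> w = id \<and> (\<forall>i. w (- i) = - w i) \<and> inj w"
proof -
  assume p: "distinct p" "good (set p)" "w \<in> path_edges p"
  then obtain a b where ab: "w = tp a b" "a \<in> set p" "b \<in> set p" "a \<noteq> b"
    using pe_A_gens[OF p(1)] unfolding A_gens_def by blast
  have "adm a b" using good_adm[OF p(2)] ab by blast
  then show ?thesis using ab(1) tp_invol tp_odd bij_is_inj[OF bij_tp] by blast
qed

lemma fork_edges_invol: "distinct p \<Longrightarrow> good (set p) \<Longrightarrow> w \<in> fork_edges p \<Longrightarrow> w \<circ> w = id \<and> (\<forall>i. w (- i) = - w i) \<and> inj w"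
proof -
  assume p: "distinct p" "good (set p)" "w \<in> fork_edges p"
  then obtain a b where ab: "w = tp a b \<or> w = tp a (- b)" "a \<in> set p" "b \<in> set p" "a \<noteq> b"
    using de_D_gens[OF p(1)] unfolding A_gens_def D_gens_def by blast
  have "adm a b" "adm a (- b)" using good_adm[OF p(2)] ab by auto
  then show ?thesis using ab(1) tp_invol tp_odd bij_is_inj[OF bij_tp] by blast
qed

lemma eval_word_odd: "(\<And>w i. w \<in> set ws \<Longrightarrow> w (- i) = - w i) \<Longrightarrow> eval_word ws (- i) = - eval_word ws i"
  by (induction ws) (auto simp: eval_word_Nil eval_word_Cons)

lemma eval_word_inj: "(\<And>w. w \<in> set ws \<Longrightarrow> inj w) \<Longrightarrow> inj (eval_word ws)"
  by (induction ws) (auto simp: eval_word_Nil eval_word_Cons inj_compose)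

lemma map_perm_set:
  assumes "inj g" "\<And>x. x \<in> A \<Longrightarrow> g x \<in> A" "finite A"
  shows "g ` A = A"
  by (rule endo_inj_surj[OF assms(3)]) (use assms in \<open>auto intro: inj_on_subset\<close>)

text \<open>A leaf of the path is inserted into the cycle obtained for the rest.\<close>

lemma path_product_cycle:
  assumes "distinct p" "good (set p)" "p \<noteq> []" "distinct ws" "set ws = path_edges p"
  shows "\<exists>ys. signed_cycle (eval_word ws) 1 ys \<and> set ys = set p \<and> distinct ys"
  using assms
proof (induction p arbitrary: ws rule: rev_induct)
  case (snoc z p)
  show ?case
  proof (cases "p = []")
    case True
    then have "ws = []" using snoc.prems by simp
    then show ?thesis using True by (intro exI[of _ "[z]"]) (simp add: signed_cycle_def eval_word_Nil)
  next
    case False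
    then obtain p' y where p: "p = p' @ [y]" by (metis rev_exhaust)
    have pez: "path_edges (p @ [z]) = insert (tp y z) (path_edges p)" using path_edges_append[of p' y z "[]"] p by simp
    have gp: "good (set p)" "distinct p" using snoc.prems by (auto intro: good_subset)
    have z: "\<bar>z\<bar> \<notin> abs ` set p"
    proof
      assume "\<bar>z\<bar> \<in> abs ` set p"
      then obtain t where "t \<in> set p" "\<bar>z\<bar> = \<bar>t\<bar>" by blast
      moreover have "inj_on abs (set (p @ [z]))" using snoc.prems(2) by (simp only: good_def)
      ultimately have "z = t" unfolding inj_on_def by auto
      then show False using snoc.prems(1) \<open>t \<in> set p\<close> by simp
    qed
    have yz: "adm y z" using good_adm[OF snoc.prems(2), of y z] snoc.prems(1) p by auto
    have nin: "tp y z \<notin> path_edges p"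
    proof
      assume "tp y z \<in> path_edges p"
      then have "tp y z z = z" using path_edges_other z by blast
      then show False using yz by (simp add: adm_def)
    qed
    have "tp y z \<in> set ws" using snoc.prems(5) pez by simp
    \<comment> \<open>Up to conjugation the product is
      \<open>eval_word (v @ u) \<circ> tp y z\<close>, where \<open>v @ u\<close> is a word for the
      path without \<open>z\<close>.\<close>
    then obtain u v where ws: "ws = u @ tp y z # v" using split_list by metis
    have vu: "distinct (v @ u)" using snoc.prems(4) ws by auto
    have "tp y z \<notin> set (v @ u)" using snoc.prems(4) ws by auto
    moreover have "insert (tp y z) (set (v @ u)) = insert (tp y z) (path_edges p)"
      using snoc.prems(5) pez ws by auto
    ultimately have vu: "distinct (v @ u)" "set (v @ u) = path_edges p"
      using vu nin by (metis insert_ident)+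
    obtain ys where ys: "signed_cycle (eval_word (v @ u)) 1 ys" "set ys = set p" "distinct ys"
      using snoc.IH[OF gp(2,1) False vu] by blast
    let ?c = "eval_word (v @ u)"
    have cz: "?c z = z" by (rule eval_word_fix) (use vu(2) path_edges_other[OF _ z] in blast)
    obtain a b where ab: "ys = a @ y # b" using split_list[of y ys] ys(2) p by auto
    have ef: "tp y z t = t" if "t \<in> set ys" "t \<noteq> y" for t
    proof -
      have "adm t z" "adm t y"
        using good_adm[OF snoc.prems(2), of t] that ys(2) snoc.prems(1) p by auto
      then show ?thesis by (intro tp_other) (auto simp: adm_def)
    qed
    have "tp y z t = t" if "t \<in> set a" for t by (rule ef) (use that ab ys(3) in auto)
    moreover have "tp y z t = t" if "t \<in> set b" for t by (rule ef) (use that ab ys(3) in auto)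
    \<comment> \<open>The product sends \<open>y\<close> to \<open>z\<close>, and \<open>z\<close>
      to the old image of \<open>y\<close>: the leaf enters the cycle right behind
      \<open>y\<close>.\<close>
    ultimately have m: "map (?c \<circ> tp y z) (a @ y # z # b) = map ?c a @ [z, ?c y] @ map ?c b"
      using cz by simp
    have m': "map ?c a @ ?c y # map ?c b = tl (a @ y # b) @ [hd (a @ y # b)]"
      using ys(1) ab by (simp add: signed_cycle_def)
    have "signed_cycle (?c \<circ> tp y z) 1 (a @ y # z # b)"
    proof (cases a)
      case (Cons a1 a')
      have "(map ?c (a1 # a')) @ (?c y # map ?c b) = (a' @ [y]) @ (b @ [a1])"
        using m' Cons by simp
      then have "map ?c (a1 # a') = a' @ [y] \<and> ?c y # map ?c b = b @ [a1]"
        by (subst (asm) append_eq_append_conv) auto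
      then show ?thesis using m Cons by (simp add: signed_cycle_def)
    next
      case Nil
      then show ?thesis unfolding signed_cycle_def m using m' by simp
    qed
    moreover have inv: "w \<circ> w = id \<and> (\<forall>i. w (- i) = - w i) \<and> inj w" if "w \<in> set (u @ tp y z # v)" for w
      using path_edges_invol[OF snoc.prems(1,2)] that snoc.prems(5) ws by blast
    ultimately have sc: "signed_cycle (eval_word ws) 1 (map (eval_word (rev v)) (a @ y # z # b))"
      unfolding ws by (intro signed_cycle_eval_rotate) (use inv eval_word_odd[of "rev v"] in auto)
    let ?g = "eval_word (rev v)"
    have ginj: "inj ?g" by (rule eval_word_inj) (use inv in auto)
    \<comment> \<open>The conjugating element is a product of path edges, so it permutes the signed
      points of the path.\<close>
    have "?g ` set (p @ [z]) = set (p @ [z])"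
    proof (rule map_perm_set[OF ginj])
      fix x assume "x \<in> set (p @ [z])"
      then show "?g x \<in> set (p @ [z])"
        by (rule eval_word_preserves[rotated]) (use path_edges_preserves[OF snoc.prems(2)] snoc.prems(5) ws in auto)
    qed simp
    moreover have "set (a @ y # z # b) = set (p @ [z])" using ab ys(2) by auto
    ultimately have "set (map ?g (a @ y # z # b)) = set (p @ [z])" by (simp only: set_map)
    moreover have "distinct (map ?g (a @ y # z # b))"
    proof -
      have "z \<notin> set ys" using ys(2) snoc.prems(1) by simp
      then have "distinct (a @ y # z # b)" using ys(3) ab by auto
      then show ?thesis using ginj by (simp only: distinct_map inj_on_subset[OF ginj subset_UNIV] simp_thms)
    qed
    ultimately show ?thesis using sc by blast
  qed
qed simp

text \<open>Only the edge to \<open>y\<close> moves the end point \<open>x\<close>. If the next edge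
  at \<open>y\<close> is not to the left of it in the word, then \<open>x\<close> goes to
  \<open>y\<close>; otherwise it is not to the right, and \<open>y\<close> goes to
  \<open>x\<close>.\<close>

lemma path_product_adjacent:
  assumes p: "distinct (x # y # r)" "good (set (x # y # r))" and ws: "distinct ws" "set ws = path_edges (x # y # r)"
  shows "eval_word ws x = y \<or> eval_word ws y = x"
proof -
  have ab: "\<bar>s\<bar> \<noteq> \<bar>t\<bar>" if "s \<in> set (x # y # r)" "t \<in> set (x # y # r)" "s \<noteq> t" for s t
    using good_adm[OF p(2) that] by (simp add: adm_def)
  have fx: "w x = x" if "w \<in> path_edges (y # r)" for w
    by (rule path_edges_other[OF that]) (use ab[of x] p(1) in auto)
  have "tp x y \<in> set ws" using ws(2) by simp
  then obtain u v where uv: "ws = u @ tp x y # v" using split_list by metis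
  have "tp x y \<notin> set u" "tp x y \<notin> set v" using ws(1) uv by auto
  moreover have "set u \<subseteq> path_edges (x # y # r)" "set v \<subseteq> path_edges (x # y # r)" using ws(2)[symmetric] uv by auto
  ultimately have sub: "set u \<subseteq> path_edges (y # r)" "set v \<subseteq> path_edges (y # r)" by auto
  have vx: "eval_word v x = x" "eval_word u x = x" by (rule eval_word_fix, use sub fx in blast)+
  have c: "eval_word ws t = eval_word u (tp x y (eval_word v t))" for t
    by (simp add: uv eval_word_append eval_word_Cons)
  show ?thesis
  proof (cases r)
    case Nil
    then have "u = []" using sub by simp
    then show ?thesis using c[of x] vx by (simp add: eval_word_Nil)
  next
    case (Cons z r')
    have fy: "w y = y" if "w \<in> path_edges (z # r')" for w
      by (rule path_edges_other[OF that]) (use ab[of y] p(1) Cons in auto)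
    show ?thesis
    proof (cases "tp y z \<in> set u")
      case False
      then have "eval_word u y = y" using sub Cons by (intro eval_word_fix fy) auto
      then show ?thesis using c[of x] vx by simp
    next
      case True
      then have "tp y z \<notin> set v" using ws(1) uv by auto
      then have "eval_word v y = y" using sub Cons by (intro eval_word_fix fy) auto
      then show ?thesis using c[of y] vx by simp
    qed
  qed
qed

text \<open>Since \<open>c x = y\<close>, the composite sends \<open>y\<close> to
  \<open>- y\<close>, a negative cycle of length 1. It sends \<open>x\<close> to
  \<open>- c y\<close>, so the rest of the cycle is run through with opposite signs and returns to
  \<open>- x\<close>; hence \<open>map uminus zs\<close>.\<close>

lemma split_cycle:
  assumes s: "signed_cycle c 1 ys" "x \<in> set ys" "distinct ys" "good (set ys)" and cx: "c x = y" "y \<noteq> x"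
    and odd: "\<And>i. c (- i) = - c i" "\<And>i. f (- i) = - f i"
    and f: "f x = - y" "f y = - x" "\<And>t. t \<in> set ys \<Longrightarrow> t \<noteq> x \<Longrightarrow> t \<noteq> y \<Longrightarrow> f t = t"
  shows "\<exists>zs. signed_cycle (c \<circ> f) (-1) [y] \<and> signed_cycle (c \<circ> f) (-1) (x # map uminus zs) \<and> distinct (y # x # zs)
    \<and> set (y # x # zs) = set ys"
proof -
  obtain us vs where ys: "ys = us @ x # vs" using split_list[OF s(2)] by blast
  have s1: "signed_cycle c 1 (x # vs @ us)" using signed_cycle_rotate s(1) ys by blast
  then have "map c (x # vs @ us) = (vs @ us) @ [x]" by (simp add: signed_cycle_def)
  then obtain zs where zs: "vs @ us = y # zs" using cx by (cases "vs @ us") auto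
  have m: "c y # map c zs = zs @ [x]" using s1 zs by (simp add: signed_cycle_def)
  have st: "set (y # x # zs) = set ys" using ys zs by (metis set_append list.set(2) Un_commute insert_commute Un_insert_right)
  have d: "distinct (x # vs @ us)" using s(3) ys by auto
  then have d: "distinct (y # x # zs)" using zs by auto
  have "f t = t" if "t \<in> set zs" for t
    by (rule f(3)) (use that d st in auto)
  then have "map (c \<circ> f) (map uminus zs) = map (\<lambda>t. - c t) zs"
    using odd by simp
  moreover have "(c \<circ> f) x = - c y" using f(1) odd by simp
  ultimately have "map (c \<circ> f) (x # map uminus zs) = map uminus (c y # map c zs)" by simp
  also have "\<dots> = map uminus zs @ [- x]" unfolding m by simp
  finally have "signed_cycle (c \<circ> f) (-1) (x # map uminus zs)" by (simp add: signed_cycle_def)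
  moreover have "signed_cycle (c \<circ> f) (-1) [y]" using f(2) cx odd by (simp add: signed_cycle_def)
  ultimately show ?thesis using d st by blast
qed

lemma D_product_cycles:
  assumes q: "distinct q" "good (set q)" "2 \<le> length q" and ws: "distinct ws" "set ws = fork_edges q"
  shows "\<exists>a b. signed_cycle (eval_word ws) (-1) a \<and> signed_cycle (eval_word ws) (-1) b \<and> length a = 1 \<and> length b = length q - 1
    \<and> distinct (map abs (a @ b)) \<and> abs ` set (a @ b) = abs ` set q"
proof -
  obtain x y r where xy: "q = x # y # r" using q(3) by (cases q rule: fork_edges.cases) auto
  let ?f = "tp x (- y)"
  have a: "adm x y" using good_adm[OF q(2)] q(1) xy by auto
  have "?f \<notin> path_edges q"
  proof
    assume "?f \<in> path_edges q"
    from path_edges_preserves[OF q(2) this, of x] have "- y \<in> set q" using xy by simp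
    then show False using good_no_neg[OF q(2), of y] xy by simp
  qed
  have "?f \<in> set ws" using ws xy by simp
  then obtain u v where uv: "ws = u @ ?f # v" using split_list by metis
  have "?f \<notin> set (v @ u)" using ws(1) uv by auto
  moreover have "insert ?f (set (v @ u)) = insert ?f (path_edges q)" using ws(2) uv xy by auto
  moreover have "distinct (v @ u)" using ws(1) uv by auto
  ultimately have vu: "distinct (v @ u)" "set (v @ u) = path_edges q"
    using \<open>?f \<notin> path_edges q\<close> by (metis insert_ident)+
  let ?c = "eval_word (v @ u)"
  obtain ys where ys: "signed_cycle ?c 1 ys" "set ys = set q" "distinct ys"
    using path_product_cycle[OF q(1,2) _ vu] xy by auto
  \<comment> \<open>The order of the word decides which point of the doubled edge is split off;
    \<open>split_cycle\<close> covers both, as \<open>tp x (- y)\<close> acts symmetrically on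
    \<open>x\<close> and \<open>y\<close>.\<close>
  have adj: "?c x = y \<or> ?c y = x" using path_product_adjacent[of x y r "v @ u"] q vu xy by simp
  have inv: "w \<circ> w = id \<and> (\<forall>i. w (- i) = - w i) \<and> inj w" if "w \<in> set ws" for w
    using fork_edges_invol[OF q(1,2)] that ws(2) by blast
  have codd: "?c (- i) = - ?c i" for i by (rule eval_word_odd) (use inv uv in auto)
  have fodd: "?f (- i) = - ?f i" for i by (rule tp_odd) (use a in simp)
  have fo: "?f t = t" if "t \<in> set ys" "t \<noteq> x" "t \<noteq> y" for t
    using good_adm[OF q(2), of t x] good_adm[OF q(2), of t y] that ys(2) xy by (auto simp: tp_other adm_def)
  have f: "?f x = - y" "?f y = - x" using fodd[of "- y"] by simp_all
  have ne: "x \<noteq> y" using a by (auto simp: adm_def)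
  have gys: "good (set ys)" using q(2) ys(2) by simp
  have "\<exists>z t zs. signed_cycle (?c \<circ> ?f) (-1) [z] \<and> signed_cycle (?c \<circ> ?f) (-1) (t # map uminus zs) \<and> distinct (z # t # zs)
    \<and> set (z # t # zs) = set q"
  proof (cases "?c x = y")
    case True
    then show ?thesis
      using split_cycle[OF ys(1) _ ys(3) gys True not_sym[OF ne] codd fodd f fo] ys(2) xy by auto
  next
    case False
    then have "?c y = x" using adj by blast
    then show ?thesis
      using split_cycle[OF ys(1) _ ys(3) gys _ ne codd fodd f(2,1) fo] ys(2) xy by auto
  qed
  then obtain z t zs where z: "signed_cycle (?c \<circ> ?f) (-1) [z]" "signed_cycle (?c \<circ> ?f) (-1) (t # map uminus zs)"
    "distinct (z # t # zs)" "set (z # t # zs) = set q" by blast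
  let ?g = "eval_word (rev v)"
  have godd: "?g (- i) = - ?g i" for i by (rule eval_word_odd) (use inv uv in auto)
  have ginj: "inj ?g" by (rule eval_word_inj) (use inv uv in auto)
  have rot: "signed_cycle (eval_word ws) (-1) (map ?g b)" if "signed_cycle (?c \<circ> ?f) (-1) b" for b
    unfolding uv by (rule signed_cycle_eval_rotate[OF _ godd that]) (use inv uv in auto)
  let ?a = "map ?g [z]" and ?b = "map ?g (t # map uminus zs)"
  have gabs: "\<bar>?g i\<bar> = \<bar>?g j\<bar> \<longleftrightarrow> \<bar>i\<bar> = \<bar>j\<bar>" for i j
    unfolding abs_eq_iff using godd inj_eq[OF ginj] by metis
  have "length q = length (z # t # zs)" using z(3,4) q(1) by (metis distinct_card)
  then have len: "length ?b = length q - 1" by simp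
  have dz: "distinct (map abs (z # t # zs))"
    using z(3,4) q(2) by (simp only: distinct_map good_def simp_thms)
  have e: "map abs (?a @ ?b) = map (\<lambda>i. \<bar>?g i\<bar>) (z # t # zs)" using godd by simp
  have "distinct (map (\<lambda>i. \<bar>?g i\<bar>) (z # t # zs))"
    using dz gabs unfolding distinct_map inj_on_def by blast
  then have dab: "distinct (map abs (?a @ ?b))" unfolding e .
  \<comment> \<open>\<open>?g\<close> may change signs inside the fork, so the argument takes all
    signed points over the lines of \<open>q\<close>, a set that it permutes.\<close>
  have "?g ` (abs -` (abs ` set q)) = abs -` (abs ` set q)"
  proof (rule map_perm_set[OF ginj])
    have "w \<in> fork_edges q" if "w \<in> set (rev v)" for w using that ws(2) uv by auto
    then show "?g i \<in> abs -` (abs ` set q)" if "i \<in> abs -` (abs ` set q)" for i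
      using that by (intro eval_word_preserves) (blast dest: fork_edges_preserves)+
    have "abs -` (abs ` set q) \<subseteq> set q \<union> uminus ` set q" by (auto simp: abs_eq_iff)
    then show "finite (abs -` (abs ` set q))" by (rule finite_subset) simp
  qed
  then have "(\<lambda>i. \<bar>?g i\<bar>) ` (abs -` (abs ` set q)) = abs ` (abs -` (abs ` set q))" by (metis image_image)
  moreover have "abs ` (abs -` (abs ` set q)) = abs ` set q" by blast
  moreover have "(\<lambda>i. \<bar>?g i\<bar>) ` (abs -` (abs ` set q)) = (\<lambda>i. \<bar>?g i\<bar>) ` set q"
    using gabs by force
  moreover have "abs ` set (?a @ ?b) = (\<lambda>i. \<bar>?g i\<bar>) ` set q"
    using arg_cong[OF e, of set] z(4) by (simp only: set_map)
  ultimately have "abs ` set (?a @ ?b) = abs ` set q" by simp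
  then show ?thesis using rot[OF z(1)] rot[OF z(2)] len dab by (intro exI[of _ ?a] exI[of _ ?b]) simp
qed

text \<open>Factors of other blocks fix the points of \<open>A\<close>, and the remaining factors
  keep them in \<open>A\<close>. So on one block a product over all generators is the product over
  those of the block, in the same order.\<close>

lemma eval_word_filter:
  assumes "\<And>w x. w \<in> set ws \<Longrightarrow> \<not> Q w \<Longrightarrow> x \<in> A \<Longrightarrow> w x = x"
    "\<And>w x. w \<in> set ws \<Longrightarrow> Q w \<Longrightarrow> x \<in> A \<Longrightarrow> w x \<in> A" "x \<in> A"
  shows "eval_word ws x = eval_word (filter Q ws) x"
proof -
  have "eval_word ws x = eval_word (filter Q ws) x \<and> eval_word (filter Q ws) x \<in> A"
    using assms by (induction ws) (auto simp: eval_word_Nil eval_word_Cons)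
  then show ?thesis ..
qed

lemma signed_cycle_cong: "(\<And>x. x \<in> set xs \<Longrightarrow> c x = d x) \<Longrightarrow> signed_cycle d e xs \<Longrightarrow> signed_cycle c e xs"
  unfolding signed_cycle_def by (metis map_cong)

lemma valid_refine:
  assumes v: "valid n L" and g: "\<And>p. p \<in> set L \<Longrightarrow> distinct (map abs (concat (g p)))
      \<and> abs ` set (concat (g p)) = abs ` set p \<and> [] \<notin> set (g p)"
  shows "valid n (concat (map g L))"
proof -
  have "distinct (map abs (concat L)) \<Longrightarrow>
      distinct (map abs (concat (concat (map g L)))) \<and>
      abs ` set (concat (concat (map g L))) = abs ` set (concat L) \<and> [] \<notin> set (concat (map g L))"
    using g
  proof (induction L)
    case (Cons p L)
    have 1: "distinct (map abs (concat (g p)))" "abs ` set (concat (g p)) = abs ` set p" "[] \<notin> set (g p)"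
      using Cons.prems(2)[of p] by auto
    have 2: "distinct (map abs (concat (concat (map g L))))"
      "abs ` set (concat (concat (map g L))) = abs ` set (concat L)" "[] \<notin> set (concat (map g L))"
      using Cons by auto
    have 3: "abs ` set p \<inter> abs ` set (concat L) = {}" using Cons.prems(1) by simp
    have c: "concat (concat (map g (p # L))) = concat (g p) @ concat (concat (map g L))" by simp
    show ?case unfolding c map_append distinct_append set_append image_Un set_map
      using 1 2 3 by (simp add: image_Un)
  qed simp
  then show ?thesis using v unfolding valid_def by blast
qed

text \<open>A path gives one positive cycle, a fork on k lines gives negative cycles of lengths 1
  and k - 1. In \<open>ws\<close> the generators of different blocks are interleaved arbitrarily,
  which \<open>eval_word_filter\<close> disentangles.\<close>

lemma coxeter_element_cycles:
  assumes "coxeter_element n R c"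
  obtains LA LD P N where "pieces n LA LD" "R = piece_group LA LD" "c \<in> R" "cycle_decomp n c P N"
    "map length P = map length LA"
    "mset (map length N) = mset (map (\<lambda>q. length q - 1) LD) + replicate_mset (length LD) 1"
proof -
  obtain S ws where S: "coxeter_gen_set n R S" and ws: "distinct ws" "set ws = S" and c: "c = eval_word ws"
    using assms by (auto simp: coxeter_element_def)
  obtain LA LD where st: "decomp n path_edges fork_edges S LA LD" and pc: "pieces n LA LD" and R: "R = piece_group LA LD"
    using coxeter_gen_set_pieces[OF S] .
  have v: "valid n (LA @ LD)" and l: "\<And>q. q \<in> set LD \<Longrightarrow> 2 \<le> length q" and SU: "S = gens_union path_edges fork_edges LA LD"
    using st by (auto simp: decomp_def)
  note dg = valid_distinct1[OF v] valid_good1[OF v]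
  have other: "w x = x" if p: "p \<in> set (LA @ LD)" "q \<in> set (LA @ LD)" "p \<noteq> q"
    and w: "w \<in> path_edges q \<or> w \<in> fork_edges q" and x: "x \<in> abs -` (abs ` set p)" for p q w x
  proof -
    have "\<bar>x\<bar> \<notin> abs ` set q" using x valid_disjoint2[OF v p] by (metis imageE vimageE)
    then show ?thesis using w path_edges_other fork_edges_other by blast
  qed
  have AD: "p \<notin> set LD" if "p \<in> set LA" for p
  proof -
    have "distinct (LA @ LD)" by (rule disjoint_lists[OF valid_distinct[OF v]]) (use v in \<open>simp add: valid_def\<close>)
    then show ?thesis using that by auto
  qed
  have A: "\<exists>ys. signed_cycle c 1 ys \<and> length ys = length p \<and> distinct (map abs ys) \<and> abs ` set ys = abs ` set p"
    if p: "p \<in> set LA" for p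
  proof -
    let ?fw = "filter (\<lambda>w. w \<in> path_edges p) ws"
    have sub: "path_edges p \<subseteq> S" using p unfolding SU gens_union_def by blast
    have d: "distinct p" "good (set p)" "p \<noteq> []" using dg[of p] p v by (auto simp: valid_def)
    obtain ys where ys: "signed_cycle (eval_word ?fw) 1 ys" "set ys = set p" "distinct ys"
      using path_product_cycle[OF d, of ?fw] ws sub by auto
    have "c x = eval_word ?fw x" if x: "x \<in> set ys" for x
      unfolding c
    proof (rule eval_word_filter[where A = "set p"])
      fix w x assume w: "w \<in> set ws" "w \<notin> path_edges p" "x \<in> set p"
      then obtain q where q: "q \<in> set (LA @ LD)" "w \<in> path_edges q \<or> w \<in> fork_edges q" "p \<noteq> q"
        using ws(2) AD[OF p] unfolding SU gens_union_def by auto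
      have "p \<in> set (LA @ LD)" using p by simp
      from other[OF this q(1,3,2)] show "w x = x" using w(3) by simp
    next
      fix w x assume "w \<in> path_edges p" "x \<in> set p"
      then show "w x \<in> set p" using path_edges_preserves[OF d(2)] by blast
    qed (use x ys in auto)
    then have "signed_cycle c 1 ys" using signed_cycle_cong ys(1) by blast
    moreover have "length ys = length p" using ys d(1) by (metis distinct_card)
    moreover have "distinct (map abs ys)" using ys d(2) by (simp add: distinct_map good_def)
    ultimately show ?thesis using ys(2) by blast
  qed
  have D: "\<exists>ab. signed_cycle c (-1) (fst ab) \<and> signed_cycle c (-1) (snd ab) \<and> length (fst ab) = 1 \<and> length (snd ab) = length q - 1
    \<and> distinct (map abs (fst ab @ snd ab)) \<and> abs ` set (fst ab @ snd ab) = abs ` set q"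
    if q: "q \<in> set LD" for q
  proof -
    let ?fw = "filter (\<lambda>w. w \<in> fork_edges q) ws"
    have sub: "fork_edges q \<subseteq> S" using q unfolding SU gens_union_def by blast
    have d: "distinct q" "good (set q)" using dg[of q] q by auto
    have fw: "distinct ?fw" "set ?fw = fork_edges q" using ws sub by auto
    obtain a b where ab: "signed_cycle (eval_word ?fw) (-1) a" "signed_cycle (eval_word ?fw) (-1) b" "length a = 1"
      "length b = length q - 1" "distinct (map abs (a @ b))" "abs ` set (a @ b) = abs ` set q"
      using D_product_cycles[OF d l[OF q] fw] by blast
    have "c x = eval_word ?fw x" if x: "x \<in> set (a @ b)" for x
      unfolding c
    proof (rule eval_word_filter[where A = "abs -` (abs ` set q)"])
      fix w x assume w: "w \<in> set ws" "w \<notin> fork_edges q" "x \<in> abs -` (abs ` set q)"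
      then obtain p where p: "p \<in> set (LA @ LD)" "w \<in> path_edges p \<or> w \<in> fork_edges p" "q \<noteq> p"
        using ws(2) AD q unfolding SU gens_union_def by auto
      have "q \<in> set (LA @ LD)" using q by simp
      from other[OF this p(1,3,2)] show "w x = x" using w(3) by blast
    next
      fix w x assume "w \<in> fork_edges q" "x \<in> abs -` (abs ` set q)"
      then show "w x \<in> abs -` (abs ` set q)" using fork_edges_preserves by blast
    next
      show "x \<in> abs -` (abs ` set q)" using ab(6) x by blast
    qed
    then have "signed_cycle c (-1) a" "signed_cycle c (-1) b" using signed_cycle_cong[of a] signed_cycle_cong[of b] ab(1,2) by auto
    then show ?thesis using ab by (intro exI[of _ "(a, b)"]) simp
  qed
  obtain f where f: "\<And>p. p \<in> set LA \<Longrightarrow> signed_cycle c 1 (f p) \<and> length (f p) = length p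
      \<and> distinct (map abs (f p)) \<and> abs ` set (f p) = abs ` set p" using A by metis
  obtain h where h: "\<And>q. q \<in> set LD \<Longrightarrow> signed_cycle c (-1) (fst (h q)) \<and> signed_cycle c (-1) (snd (h q))
      \<and> length (fst (h q)) = 1 \<and> length (snd (h q)) = length q - 1
      \<and> distinct (map abs (fst (h q) @ snd (h q))) \<and> abs ` set (fst (h q) @ snd (h q)) = abs ` set q"
    using D by metis
  let ?P = "map f LA" and ?N = "concat (map (\<lambda>q. [fst (h q), snd (h q)]) LD)"
  let ?g = "\<lambda>p. if p \<in> set LD then [fst (h p), snd (h p)] else [f p]"
  have "valid n (concat (map ?g (LA @ LD)))"
  proof (rule valid_refine[OF v])
    fix p assume p: "p \<in> set (LA @ LD)"
    show "distinct (map abs (concat (?g p))) \<and> abs ` set (concat (?g p)) = abs ` set p \<and> [] \<notin> set (?g p)"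
    proof (cases "p \<in> set LD")
      case True
      then show ?thesis using h[OF True] by (auto simp: signed_cycle_def)
    next
      case False
      then have "p \<in> set LA" using p by simp
      then show ?thesis using f[of p] False by (auto simp: signed_cycle_def)
    qed
  qed
  moreover have "concat (map ?g LA) = ?P" using AD by (induction LA) auto
  moreover have "map ?g LD = map (\<lambda>q. [fst (h q), snd (h q)]) LD" by simp
  ultimately have "valid n (?P @ ?N)" by (simp only: map_append concat_append)
  then have dec: "cycle_decomp n c ?P ?N" using f h by (auto simp: cycle_decomp_def)
  have lenP: "map length ?P = map length LA" using f by simp
  have lenN: "mset (map length ?N) = mset (map (\<lambda>q. length q - 1) LD) + replicate_mset (length LD) 1"
    using h by (induction LD) auto
  have "c \<in> R" using eval_word_gen[of ws S] ws(2) c S by (auto simp: coxeter_gen_set_def)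
  then show ?thesis using that[OF pc R _ dec lenP lenN] by blast
qed

section \<open>Coxeter presentations of products of symmetric groups\<close>

lemma word_over_image: "set ws \<subseteq> f ` A \<Longrightarrow> \<exists>vs. ws = map f vs \<and> set vs \<subseteq> A"
proof (induction ws)
  case (Cons a ws)
  then obtain vs x where "ws = map f vs" "set vs \<subseteq> A" "a = f x" "x \<in> A" by auto
  then show ?case by (intro exI[of _ "x # vs"]) simp
qed simp

lemma cox_step_context:
  assumes "cox_step S a b" "set x \<subseteq> S" "set y \<subseteq> S"
  shows "cox_step S (x @ a @ y) (x @ b @ y)"
  using assms(1)
proof cases
  case (1 r u v)
  then show ?thesis using cox_step.intros[of r S "x @ u" "v @ y"] assms(2,3) by simp
qed

lemma equivclp_map:
  assumes "equivclp r a b" "\<And>x y. r x y \<Longrightarrow> r' (f x) (f y)"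
  shows "equivclp r' (f a) (f b)"
  using assms(1)
proof (induction rule: equivclp_induct)
  case (step y z)
  then have "r' (f y) (f z) \<or> r' (f z) (f y)" using assms(2) by blast
  then have "equivclp r' (f y) (f z)"
    using r_into_equivclp equivclp_sym by metis
  then show ?case using step.IH equivclp_trans by metis
qed simp

lemma WB_finite_order:
  assumes "f \<in> WB n"
  shows "\<exists>k>0. f ^^ k = id"
proof -
  have "range (\<lambda>k. f ^^ k) \<subseteq> WB n" using WB_funpow[OF assms] by blast
  then have "finite (range (\<lambda>k. f ^^ k))" using finite_WB finite_subset by blast
  then have "\<not> inj (\<lambda>k. f ^^ k)" using finite_imageD infinite_UNIV_nat by blast
  then obtain i j where ij: "i < j" "f ^^ i = f ^^ j" unfolding inj_def by (metis nat_neq_iff)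
  have "f ^^ j = f ^^ i \<circ> f ^^ (j - i)" using ij(1) by (metis funpow_add le_add_diff_inverse less_imp_le)
  then have "(f ^^ i) ((f ^^ (j - i)) x) = (f ^^ i) x" for x using ij(2) by (metis comp_apply)
  then have "(f ^^ (j - i)) x = x" for x using WB_inj[OF WB_funpow[OF assms]] by blast
  then show ?thesis using ij(1) by (intro exI[of _ "j - i"]) (simp add: fun_eq_iff)
qed

lemma elem_order_pow: "f \<in> WB n \<Longrightarrow> f ^^ elem_order f = id"
  unfolding elem_order_def using LeastI_ex[OF WB_finite_order] by blast

lemma eval_replicate: "eval_word (concat (replicate k [s, t])) = (s \<circ> t) ^^ k"
proof (induction k)
  case (Suc k)
  have "eval_word (concat (replicate (Suc k) [s, t])) = s \<circ> t \<circ> eval_word (concat (replicate k [s, t]))"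
    by (simp add: eval_word_Cons comp_assoc)
  then show ?case using Suc by (metis funpow.simps(2))
qed (simp add: eval_word_Nil)

lemma eval_word_cong:
  assumes S: "S \<subseteq> reflections n" and "equivclp (cox_step S) u v"
  shows "eval_word u = eval_word v"
  using assms(2)
proof (rule equivclp_invariant)
  fix a b assume "cox_step S a b"
  then show "eval_word a = eval_word b"
  proof cases
    case (1 r u v)
    then obtain s t where st: "s \<in> S" "t \<in> S" "r = concat (replicate (elem_order (s \<circ> t)) [s, t])"
      by (auto simp: cox_rels_def)
    have "s \<circ> t \<in> WB n" using st S reflections_WD WD_WB WB_comp by blast
    then have "eval_word r = id" unfolding st(3) eval_replicate by (rule elem_order_pow)
    then show ?thesis using 1 by (simp add: eval_word_append)
  qed
qed

definition simple :: "int \<Rightarrow> int \<Rightarrow> int" where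
  "simple i = tp i (i + 1)"

text \<open>The existence of Coxeter elements of \<open>Wplus\<close> and \<open>Wminus\<close>
  requires reflections that satisfy the presentation. Adjacent transpositions are taken over an
  arbitrary index set \<open>J\<close>, whose gaps are the block boundaries, so that a product of
  symmetric groups is handled as one group.\<close>

locale simple_set =
  fixes n :: nat and J :: "int set"
  assumes J: "J \<subseteq> {1..<int n}"
begin

abbreviation S where "S \<equiv> simple ` J"

definition eqv :: "int list \<Rightarrow> int list \<Rightarrow> bool" where
  "eqv u v \<longleftrightarrow> equivclp (cox_step S) (map simple u) (map simple v)"

lemma eqv_refl [simp]: "eqv u u"
  by (simp add: eqv_def)

lemma eqv_sym: "eqv u v \<Longrightarrow> eqv v u"
  by (simp add: eqv_def equivclp_sym)

lemma eqv_trans: "eqv u v \<Longrightarrow> eqv v w \<Longrightarrow> eqv u w"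
  unfolding eqv_def by (rule equivclp_trans)

lemma eqv_context:
  assumes "eqv u v" "set x \<subseteq> J" "set y \<subseteq> J"
  shows "eqv (x @ u @ y) (x @ v @ y)"
proof -
  have "set (map simple x) \<subseteq> S" "set (map simple y) \<subseteq> S" using assms(2,3) by auto
  then show ?thesis
    using equivclp_map[of "cox_step S" "map simple u" "map simple v" "cox_step S" "\<lambda>w. map simple x @ w @ map simple y"]
      assms(1) cox_step_context unfolding eqv_def map_append by blast
qed

lemma simple_refl: "i \<in> J \<Longrightarrow> simple i \<in> reflections n"
  using J by (auto simp: simple_def pts_def intro!: reflectionsI)

lemma S_refl: "S \<subseteq> reflections n"
  using simple_refl by blast

lemma adm_simple: "i \<in> J \<Longrightarrow> adm i (i + 1)"
  using J by (auto simp: adm_def)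

lemma relator:
  assumes "i \<in> J" "j \<in> J"
  shows "eqv (concat (replicate (elem_order (simple i \<circ> simple j)) [i, j])) []"
proof -
  have "cox_step S ([] @ concat (replicate (elem_order (simple i \<circ> simple j)) [simple i, simple j]) @ []) ([] @ [])"
    by (rule cox_step.intros) (use assms in \<open>auto simp: cox_rels_def\<close>)
  then show ?thesis unfolding eqv_def by (simp add: map_concat r_into_equivclp)
qed

lemma eqv_cancel: "i \<in> J \<Longrightarrow> eqv [i, i] []"
  using relator[of i i] elem_order_eq[OF simple_refl simple_refl, of i i] by simp

lemma eqv_rev: "set w \<subseteq> J \<Longrightarrow> eqv (w @ rev w) []"
proof (induction w)
  case (Cons i w)
  have "eqv ([i] @ (w @ rev w) @ [i]) ([i] @ [] @ [i])"
    by (rule eqv_context) (use Cons in auto)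
  then have "eqv ((i # w) @ rev (i # w)) [i, i]" by simp
  then show ?case using eqv_cancel[of i] Cons.prems eqv_trans by (metis insert_subset list.set(2))
qed simp

text \<open>Turns a relator into the relation between its two halves, the letters being their own
  inverses.\<close>

lemma eqv_half:
  assumes "eqv (a @ b) []" "set a \<subseteq> J" "set b \<subseteq> J"
  shows "eqv a (rev b)"
proof -
  have "eqv (a @ b @ rev b) a" using eqv_context[OF eqv_rev[OF assms(3)] assms(2), of "[]"] by simp
  moreover have "eqv (a @ b @ rev b) (rev b)" using eqv_context[OF assms(1), of "[]" "rev b"] assms(3) by simp
  ultimately show ?thesis using eqv_trans[OF eqv_sym] by metis
qed

lemma eqv_commute:
  assumes "i \<in> J" "j \<in> J" "2 \<le> \<bar>i - j\<bar>"
  shows "eqv [i, j] [j, i]"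
proof -
  have p: "1 \<le> i" "1 \<le> j" using assms J by auto
  then have "simple i j = j" "simple i (j + 1) = j + 1"
    using assms(3) unfolding simple_def by (intro tp_other; simp)+
  then have sij: "simple i \<circ> simple j \<circ> simple i = simple j"
    using tp_conj_tp[OF adm_simple[OF assms(1)], of j "j + 1"] by (simp add: simple_def)
  have inv: "simple i \<circ> simple i = id" using simple_refl assms reflection_invol by blast
  have comm: "simple i \<circ> simple j = simple j \<circ> simple i"
    using sij inv by (metis comp_assoc comp_id)
  have "simple j j = j + 1" by (simp add: simple_def)
  then have "simple i \<noteq> simple j" using \<open>simple i j = j\<close> by auto
  then have "elem_order (simple i \<circ> simple j) = 2"
    using comm elem_order_eq[OF simple_refl[OF assms(1)] simple_refl[OF assms(2)]] by simp
  then have "eqv ([i, j] @ [i, j]) []" using relator[OF assms(1,2)] by (simp add: numeral_2_eq_2)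
  from eqv_half[OF this] show ?thesis using assms by simp
qed

lemma eqv_braid:
  assumes "i \<in> J" "i + 1 \<in> J"
  shows "eqv [i + 1, i, i + 1] [i, i + 1, i]"
proof -
  have p: "1 \<le> i" using assms J by auto
  have "simple (i + 1) \<circ> simple i \<noteq> simple i \<circ> simple (i + 1)"
    using tp_noncomm'(2)[of i "i + 1" "i + 1 + 1"] p by (simp add: simple_def)
  then have "elem_order (simple (i + 1) \<circ> simple i) = 3"
    using elem_order_eq[OF simple_refl[OF assms(2)] simple_refl[OF assms(1)]] by (auto split: if_splits)
  then have "eqv ([i + 1, i, i + 1] @ [i, i + 1, i]) []" using relator[OF assms(2,1)] by (simp add: numeral_3_eq_3)
  from eqv_half[OF this] show ?thesis using assms by simp
qed

lemma eqv_commute_list: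
  assumes "\<And>i. i \<in> set c \<Longrightarrow> 2 \<le> \<bar>i - j\<bar>" "set c \<subseteq> J" "j \<in> J"
  shows "eqv (c @ [j]) (j # c)"
  using assms
proof (induction c)
  case (Cons i c)
  have "eqv ([i] @ (c @ [j]) @ []) ([i] @ (j # c) @ [])" by (rule eqv_context) (use Cons in auto)
  moreover have "eqv ([] @ [i, j] @ c) ([] @ [j, i] @ c)"
    by (rule eqv_context) (use Cons.prems eqv_commute in auto)
  ultimately show ?case using eqv_trans[of "i # c @ [j]" "i # j # c" "j # i # c"] by simp
qed simp

lemma rev_upto_extend: "k \<le> m + 1 \<Longrightarrow> rev [k - 1..m] = rev [k..m] @ [k - 1]"
  using upto_rec1[of "k - 1" m] by simp

text \<open>Coset representatives for the subgroup with indices below \<open>m\<close>: what is left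
  on the right is a descending run from \<open>m\<close> to \<open>k\<close>, empty for
  \<open>k = m + 1\<close>. A further letter extends the run, shortens it, or passes through it into
  \<open>u\<close>.\<close>

lemma normal_form:
  assumes "set w \<subseteq> J \<inter> {..m}"
  shows "\<exists>u k. set u \<subseteq> J \<inter> {..<m} \<and> k \<le> m + 1 \<and> {k..m} \<subseteq> J \<and> eqv w (u @ rev [k..m])"
  using assms
proof (induction w rule: rev_induct)
  case Nil
  then show ?case by (intro exI[of _ "[]"] exI[of _ "m + 1"]) simp
next
  case (snoc j w)
  then obtain u k where u: "set u \<subseteq> J \<inter> {..<m}" and k: "k \<le> m + 1" "{k..m} \<subseteq> J" and w: "eqv w (u @ rev [k..m])"
    by auto
  have j: "j \<in> J" "j \<le> m" using snoc.prems by auto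
  have uJ: "set u \<subseteq> J" using u by auto
  have w': "eqv (w @ [j]) (u @ rev [k..m] @ [j])"
    using eqv_context[OF w, of "[]" "[j]"] j by simp
  have move: "eqv (w @ [j]) (u @ v)" if "eqv (rev [k..m] @ [j]) v" for v
    using eqv_trans[OF w'] eqv_context[OF that uJ, of "[]"] by simp
  consider "j < k - 1" | "j = k - 1" | "j = k" | "k < j" by linarith
  then show ?case
  proof cases
    case 1
    have "eqv (rev [k..m] @ [j]) (j # rev [k..m])"
      by (rule eqv_commute_list) (use 1 k j in auto)
    then have "eqv (w @ [j]) ((u @ [j]) @ rev [k..m])" using move by fastforce
    then show ?thesis using u k j 1 by (intro exI[of _ "u @ [j]"] exI[of _ k]) auto
  next
    case 2
    then have e: "rev [k..m] @ [j] = rev [k - 1..m]" using rev_upto_extend k(1) by simp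
    then have "eqv (w @ [j]) (u @ rev [k - 1..m])" using move[of "rev [k - 1..m]"] by simp
    moreover have "{k - 1..m} \<subseteq> J"
    proof
      fix x assume "x \<in> {k - 1..m}"
      then have "x = k - 1 \<or> x \<in> {k..m}" by auto
      then show "x \<in> J" using k(2) j(1) 2 by blast
    qed
    ultimately show ?thesis using u k by (intro exI[of _ u] exI[of _ "k - 1"]) auto
  next
    case 3
    have "rev [k..m] @ [j] = rev [k + 1..m] @ [k, k] @ []" using rev_upto_extend[of "k + 1" m] 3 j by simp
    moreover have "eqv (rev [k + 1..m] @ [k, k] @ []) (rev [k + 1..m] @ [] @ [])"
      by (rule eqv_context) (use 3 j k eqv_cancel in auto)
    ultimately have "eqv (w @ [j]) (u @ rev [k + 1..m])" using move by simp
    moreover have "{k + 1..m} \<subseteq> J" using k(2) by auto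
    ultimately show ?thesis using u 3 j by (intro exI[of _ u] exI[of _ "k + 1"]) auto
  next
    \<comment> \<open>The letter commutes with the lower part of the run. The braid relation turns
      \<open>j, j - 1, j\<close> into \<open>j - 1, j, j - 1\<close>, and the leading
      \<open>j - 1\<close> commutes with the upper part.\<close>
    case 4
    let ?a = "rev [j + 1..m]" and ?b = "rev [k..j - 2]"
    have j1: "j - 1 \<in> J" using k(2) 4 j by auto
    have ab: "set ?a \<subseteq> J" "set ?b \<subseteq> J" using k(2) 4 j by auto
    have "[k..m] = [k..j - 2] @ [j - 1..m]" using upto_split1[of k "j - 1" m] 4 j by simp
    also have "[j - 1..m] = [j - 1, j] @ [j + 1..m]" using upto_rec1[of "j - 1" m] upto_rec1[of j m] j by simp
    finally have split: "rev [k..m] = ?a @ [j, j - 1] @ ?b" by simp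
    have 1: "eqv ((?a @ [j, j - 1]) @ (?b @ [j]) @ []) ((?a @ [j, j - 1]) @ (j # ?b) @ [])"
      by (rule eqv_context[OF eqv_commute_list]) (use ab j j1 in auto)
    have 2: "eqv (?a @ [j, j - 1, j] @ ?b) (?a @ [j - 1, j, j - 1] @ ?b)"
      using eqv_context[OF eqv_braid[of "j - 1"] ab] j j1 by simp
    have 3: "eqv ([] @ (?a @ [j - 1]) @ ([j, j - 1] @ ?b)) ([] @ ((j - 1) # ?a) @ ([j, j - 1] @ ?b))"
      by (rule eqv_context[OF eqv_commute_list]) (use ab j j1 in auto)
    have "eqv (rev [k..m] @ [j]) ((j - 1) # rev [k..m])"
      unfolding split using eqv_trans[OF _ eqv_trans[OF 2]] 1 3 by simp
    then have "eqv (w @ [j]) ((u @ [j - 1]) @ rev [k..m])" using move by fastforce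
    then show ?thesis using u k j j1 4 by (intro exI[of _ "u @ [j - 1]"] exI[of _ k]) auto
  qed
qed

lemma chain_eval: "k \<le> m + 1 \<Longrightarrow> eval_word (map simple (rev [k..m])) k = m + 1"
proof (induction "nat (m + 1 - k)" arbitrary: k)
  case 0
  then show ?case by (simp add: eval_word_Nil)
next
  case (Suc d)
  then have "k \<le> m" by simp
  then have "rev [k..m] = rev [k + 1..m] @ [k]" using rev_upto_extend[of "k + 1" m] by simp
  then show ?case using Suc(1)[of "k + 1"] Suc(2) \<open>k \<le> m\<close>
    by (simp add: eval_word_append eval_word_Cons eval_word_Nil simple_def)
qed

lemma eqv_eval: "eqv u v \<Longrightarrow> eval_word (map simple u) = eval_word (map simple v)"
  unfolding eqv_def by (rule eval_word_cong[OF S_refl])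

text \<open>The part \<open>u\<close> of the normal form fixes the top point, and the run sends
  \<open>k\<close> there. For a word with trivial value the run is therefore empty, which lowers the
  top index.\<close>

lemma trivial_word:
  assumes "set w \<subseteq> J \<inter> {..int m}" "eval_word (map simple w) = id"
  shows "eqv w []"
  using assms
proof (induction m arbitrary: w)
  case 0
  then have "set w \<subseteq> {1..<int n} \<inter> {..0}" using J by fastforce
  then have "x \<notin> set w" for x by fastforce
  then have "w = []" by (metis list.set_intros(1) neq_Nil_conv)
  then show ?case by simp
next
  case (Suc m)
  let ?m = "int (Suc m)"
  obtain u k where u: "set u \<subseteq> J \<inter> {..<?m}" and k: "k \<le> ?m + 1" "{k..?m} \<subseteq> J" and w: "eqv w (u @ rev [k..?m])"
    using normal_form[OF Suc.prems(1)] by blast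
  have id: "eval_word (map simple (u @ rev [k..?m])) = id" using eqv_eval[OF w] Suc.prems(2) by (rule trans[OF sym])
  have "eval_word (map simple u) (?m + 1) = ?m + 1"
  proof (rule eval_word_fix)
    fix s assume "s \<in> set (map simple u)"
    then obtain i where i: "s = simple i" "i \<in> J" "i < ?m" using u by auto
    then have "1 \<le> i" using J by auto
    then show "s (?m + 1) = ?m + 1" using i unfolding i(1) simple_def by (intro tp_other) auto
  qed
  then have "eval_word (map simple (u @ rev [k..?m])) k = ?m + 1"
    using chain_eval[OF k(1)] by (simp add: eval_word_append)
  then have "k = ?m + 1" by (simp only: id id_apply)
  then have wu: "eqv w u" using w by simp
  then have "eval_word (map simple u) = id" using eqv_eval Suc.prems(2) by metis
  moreover have "set u \<subseteq> J \<inter> {..int m}" using u by auto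
  ultimately show ?case using Suc.IH eqv_trans[OF wu] by blast
qed

lemma coxeter_gen_set_simple: "coxeter_gen_set n (gen S) S"
  unfolding coxeter_gen_set_def
proof (intro conjI allI impI)
  fix ws assume ws: "set ws \<subseteq> S" "eval_word ws = id"
  then obtain w where w: "ws = map simple w" "set w \<subseteq> J"
    using word_over_image by metis
  have "set w \<subseteq> J \<inter> {..int n}" using w(2) J by auto
  then have "eqv w []" using trivial_word ws w by blast
  then show "equivclp (cox_step S) ws []" using w by (simp add: eqv_def)
qed (use S_refl in auto)

end

section \<open>Conjugates of Coxeter generating sets\<close>

lemma conj_reflections: "g \<in> WB n \<Longrightarrow> s \<in> reflections n \<Longrightarrow> conj g s \<in> reflections n"
proof -
  assume g: "g \<in> WB n" and "s \<in> reflections n"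
  then obtain x y where xy: "s = tp x y" "x \<in> pts n" "y \<in> pts n" "\<bar>x\<bar> \<noteq> \<bar>y\<bar>" using reflectionsE by metis
  then have "conj g s = tp (g x) (g y)" using conj_tp[OF WB_bij[OF g] WB_odd[OF g]] by simp
  then show ?thesis using xy g by (simp add: reflectionsI WB_pts WB_abs)
qed

lemma conj_funpow: "bij g \<Longrightarrow> conj g (f ^^ k) = conj g f ^^ k"
proof (induction k)
  case 0 then show ?case using conj_id by (metis funpow_0 id_apply ext)
next
  case (Suc k) then show ?case by (metis conj_comp funpow.simps(2))
qed

lemma conj_eq_id: "bij g \<Longrightarrow> conj g f = id \<longleftrightarrow> f = id"
  by (metis conj_id conj_inv)

lemma elem_order_conj: "bij g \<Longrightarrow> elem_order (conj g f) = elem_order f"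
  unfolding elem_order_def by (simp only: conj_funpow[symmetric] conj_eq_id)

lemma eval_word_conj: "bij g \<Longrightarrow> eval_word (map (conj g) ws) = conj g (eval_word ws)"
  by (induction ws) (simp_all only: list.map eval_word_Nil eval_word_Cons conj_id conj_comp)

text \<open>Conjugation preserves reflections and the orders of products, hence maps relators to
  relators. The conjugating element is taken in W(B_n) because \<open>Wminus\<close> arises by
  \<open>tsign\<close>, which is not in W(D_n).\<close>

lemma coxeter_gen_set_conj:
  assumes cox: "coxeter_gen_set n R S" and g: "g \<in> WB n"
  shows "coxeter_gen_set n (conj g ` R) (conj g ` S)"
  unfolding coxeter_gen_set_def
proof (intro conjI allI impI)
  have S: "S \<subseteq> reflections n" "gen S = R" using cox by (auto simp: coxeter_gen_set_def)
  note b = WB_bij[OF g]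
  show "conj g ` S \<subseteq> reflections n" using S(1) conj_reflections[OF g] by blast
  show "gen (conj g ` S) = conj g ` R" using gen_conj[OF b invols_refl[OF S(1)]] S(2) by simp
  fix ws assume ws: "set ws \<subseteq> conj g ` S" "eval_word ws = id"
  then obtain vs where vs: "ws = map (conj g) vs" "set vs \<subseteq> S"
    using word_over_image by metis
  have "eval_word vs = id" using ws(2) unfolding vs(1) eval_word_conj[OF b] conj_eq_id[OF b] .
  then have "equivclp (cox_step S) vs []" using cox vs(2) by (simp add: coxeter_gen_set_def)
  then have "equivclp (cox_step (conj g ` S)) (map (conj g) vs) (map (conj g) [])"
  proof (rule equivclp_map)
    fix x y assume "cox_step S x y"
    then show "cox_step (conj g ` S) (map (conj g) x) (map (conj g) y)"
    proof cases
      case (1 r u v)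
      then obtain s t where st: "s \<in> S" "t \<in> S" "r = concat (replicate (elem_order (s \<circ> t)) [s, t])"
        by (auto simp: cox_rels_def)
      have "elem_order (conj g s \<circ> conj g t) = elem_order (s \<circ> t)"
        using elem_order_conj[OF b, of "s \<circ> t"] unfolding conj_comp[OF b] .
      then have "map (conj g) r = concat (replicate (elem_order (conj g s \<circ> conj g t)) [conj g s, conj g t])"
        unfolding st(3) by (simp only: map_concat map_replicate list.map)
      then have "map (conj g) r \<in> cox_rels (conj g ` S)" using st(1,2) unfolding cox_rels_def by blast
      then show ?thesis using cox_step.intros[of "map (conj g) r" "conj g ` S" "map (conj g) u" "map (conj g) v"] 1
        by auto
    qed
  qed
  then show "equivclp (cox_step (conj g ` S)) ws []" using vs by simp
qed

lemma path_edges_upto: "path_edges [a..b] = simple ` {i. i \<in> set [a..b] \<and> i + 1 \<in> set [a..b]}"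
proof
  show "path_edges [a..b] \<subseteq> simple ` {i. i \<in> set [a..b] \<and> i + 1 \<in> set [a..b]}"
  proof
    fix w assume "w \<in> path_edges [a..b]"
    then obtain i where i: "w = tp ([a..b] ! i) ([a..b] ! Suc i)" "Suc i < length [a..b]" unfolding path_edges_nth by blast
    then have "w = simple (a + int i)" by (simp add: nth_upto simple_def algebra_simps)
    then show "w \<in> simple ` {i. i \<in> set [a..b] \<and> i + 1 \<in> set [a..b]}" using i(2) by auto
  qed
  show "simple ` {i. i \<in> set [a..b] \<and> i + 1 \<in> set [a..b]} \<subseteq> path_edges [a..b]"
  proof
    fix w assume "w \<in> simple ` {i. i \<in> set [a..b] \<and> i + 1 \<in> set [a..b]}"
    then obtain i where i: "w = simple i" "a \<le> i" "i + 1 \<le> b" by auto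
    then have "w = tp ([a..b] ! nat (i - a)) ([a..b] ! Suc (nat (i - a)))" "Suc (nat (i - a)) < length [a..b]"
      by (simp_all add: nth_upto simple_def algebra_simps)
    then show "w \<in> path_edges [a..b]" unfolding path_edges_nth by blast
  qed
qed

lemma blists_upto: "p \<in> set (blists s l) \<Longrightarrow> \<exists>a b. p = [a..b]"
  by (induction s l rule: blists.induct) auto

lemma Wplus_coxeter_gen_set:
  assumes "partition_of n l" "even_part l"
  shows "\<exists>S. coxeter_gen_set n (Wplus l) S"
proof -
  note b = even_blists[OF assms]
  let ?J = "\<Union>p\<in>set (blists 0 l). {i. i \<in> set p \<and> i + 1 \<in> set p}"
  have "?J \<subseteq> {1..<int n}"
  proof
    fix i assume "i \<in> ?J"
    then obtain p where p: "p \<in> set (blists 0 l)" "i \<in> set p" "i + 1 \<in> set p" by blast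
    then show "i \<in> {1..<int n}" using b(4)[OF p(1,2)] valid_pts[OF b(1) p(1,3)] by (auto simp: pts_def)
  qed
  then interpret simple_set n ?J by unfold_locales
  have "S = (\<Union>p\<in>set (blists 0 l). path_edges p)"
  proof -
    have "path_edges p = simple ` {i. i \<in> set p \<and> i + 1 \<in> set p}" if "p \<in> set (blists 0 l)" for p
      using blists_upto[OF that] path_edges_upto by blast
    then show ?thesis by (simp add: image_UN)
  qed
  then have "decomp n path_edges fork_edges S (blists 0 l) []" using b(1) by (simp add: decomp_def gens_union_def)
  then have "gen S = Wplus l" using decomp_gen(2) Wplus_piece_group by simp
  then show ?thesis using coxeter_gen_set_simple by auto
qed

lemma coxeter_element_ex: "coxeter_gen_set n R S \<Longrightarrow> \<exists>c. coxeter_element n R c"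
proof -
  assume S: "coxeter_gen_set n R S"
  then have "finite S" using finite_reflections finite_subset by (auto simp: coxeter_gen_set_def)
  then obtain ws where "distinct ws" "set ws = S" using finite_distinct_list by blast
  then show ?thesis using S unfolding coxeter_element_def by blast
qed

section \<open>Conjugacy of Coxeter elements\<close>

lemma piece_group_WB: "valid n (LA @ LD) \<Longrightarrow> w \<in> piece_group LA LD \<Longrightarrow> w \<in> WB n"
  using piece_group_subset_WD WD_WB by blast

lemma Wplus_WB: "partition_of n l \<Longrightarrow> even_part l \<Longrightarrow> w \<in> Wplus l \<Longrightarrow> w \<in> WB n"
  using piece_group_WB[of n "blists 0 l" "[]"] even_blists(1) by (simp add: Wplus_piece_group)

text \<open>The blocks read off a Coxeter generating set may be other lists than the given ones, but
  both describe the same subgroup, so their sizes agree by the orbit type.\<close>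

lemma coxeter_cycles_piece_group:
  assumes pc: "pieces n LA LD" and c: "coxeter_element n (piece_group LA LD) c"
  obtains P N where "c \<in> piece_group LA LD" "cycle_decomp n c P N" "mset (map length P) = mset (map length LA)"
    "mset (map length N) = mset (map (\<lambda>x. x - 1) (map length LD)) + replicate_mset (length LD) 1"
proof -
  obtain LA' LD' P N where *: "pieces n LA' LD'" "piece_group LA LD = piece_group LA' LD'" "c \<in> piece_group LA LD" "cycle_decomp n c P N"
    "map length P = map length LA'"
    "mset (map length N) = mset (map (\<lambda>q. length q - 1) LD') + replicate_mset (length LD') 1"
    using c by (rule coxeter_element_cycles)
  have m: "mset (map length LA) = mset (map length LA')" "mset (map length LD) = mset (map length LD')"
    using orbit_type_piece_group[OF pc] orbit_type_piece_group[OF *(1)] *(2) by simp_all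
  have "mset (map (\<lambda>q. length q - 1) LD') = image_mset (\<lambda>x. x - 1) (mset (map length LD'))"
    by (simp add: image_mset.compositionality comp_def)
  also have "\<dots> = mset (map (\<lambda>x. x - 1) (map length LD))" unfolding m(2)[symmetric] by (rule mset_map[symmetric])
  finally have "mset (map length N) = mset (map (\<lambda>x. x - 1) (map length LD)) + replicate_mset (length LD) 1"
    using *(6) mset_eq_length[OF m(2)] by simp
  moreover have "mset (map length P) = mset (map length LA)" unfolding *(5) by (rule m(1)[symmetric])
  ultimately show ?thesis using that[OF *(3,4)] by blast
qed

lemma cycle_type_coxeter_Wlam:
  assumes "double_partition n (l1, l2)" "gt1 l2" "coxeter_element n (Wlam (l1, l2)) c"
  shows "cycle_type n c = (mset l1, mset (map (\<lambda>x. x - 1) l2) + replicate_mset (length l2) 1)"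
proof -
  have pc: "pieces n (blists 0 l1) (blists (sum_list l1) l2)" using blists_pieces assms by blast
  have c: "coxeter_element n (piece_group (blists 0 l1) (blists (sum_list l1) l2)) c" using assms by (simp add: Wlam_piece_group)
  obtain P N where *: "c \<in> piece_group (blists 0 l1) (blists (sum_list l1) l2)" "cycle_decomp n c P N"
    "mset (map length P) = mset (map length (blists 0 l1))"
    "mset (map length N) = mset (map (\<lambda>x. x - 1) (map length (blists (sum_list l1) l2)))
      + replicate_mset (length (blists (sum_list l1) l2)) 1"
    using pc c by (rule coxeter_cycles_piece_group)
  have "c \<in> WB n" using piece_group_WB[OF _ *(1)] pc by (simp add: pieces_def)
  moreover have "length (blists (sum_list l1) l2) = length l2" by (metis length_blists length_map)
  ultimately show ?thesis using cycle_type_cycle_decomp[OF _ *(2)] *(3,4) by (simp only: length_blists)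
qed

text \<open>Elements of \<open>Wplus\<close> preserve the sign of points. As \<open>conj h x\<close>
  sends \<open>h t\<close> to \<open>h (x t)\<close>, the sign of \<open>h\<close> is constant along
  each cycle of \<open>x\<close>, and even cycles give an even number of sign changes.\<close>

lemma even_cycles_WD:
  assumes l: "partition_of n l" "even_part l" and m: "partition_of n m" "even_part m"
    and x: "x \<in> Wplus l" and dec: "cycle_decomp n x P []" and even: "\<And>p. p \<in> set P \<Longrightarrow> even (length p)"
    and h: "h \<in> WB n" and y: "conj h x \<in> Wplus m"
  shows "h \<in> WD n"
proof -
  have v: "valid n P" and sc: "\<And>p. p \<in> set P \<Longrightarrow> signed_cycle x 1 p" using dec by (auto simp: cycle_decomp_def)
  have xW: "x \<in> WB n" using Wplus_WB[OF l x] .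
  \<comment> \<open>As \<open>x\<close> lies in \<open>Wplus l\<close>, it preserves positivity, so
    its cycles may be listed by absolute values.\<close>
  let ?P = "map (map abs) P"
  have v': "valid n ?P" using v
    by (auto simp: valid_def map_concat[symmetric] image_UN[symmetric] comp_def image_image)
  show ?thesis
  proof (rule WD_of_even_blocks[OF h v'])
    show "even (length p)" if "p \<in> set ?P" for p using even that by auto
    show pos: "0 < i" if pP: "p \<in> set ?P" and ip: "i \<in> set p" for p i
    proof -
      obtain q where q: "q \<in> set P" "p = map abs q" using pP by auto
      then obtain j where "j \<in> set q" "i = \<bar>j\<bar>" using ip by auto
      with q(1) show ?thesis using valid_pts[OF v, of q j] pts_nz by force
    qed
    fix p i j assume p: "p \<in> set ?P" and i: "i \<in> set p" and j: "j \<in> set p"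
    obtain q where q: "q \<in> set P" "p = map abs q" using p by auto
    have qp: "t \<in> pts n" if "t \<in> set q" for t using valid_pts[OF v q(1) that] .
    have pp: "t \<in> pts n" "0 < t" if "t \<in> set p" for t
      using valid_pts[OF v' p that] pos[OF p that] by auto
    have step: "sgn (h (x t)) = sgn (h t)" if t: "t \<in> pts n" "0 < t" for t
    proof -
      have e: "conj h x (h t) = h (x t)" "conj h x (h (- t)) = h (x (- t))"
        using conj_apply[OF WB_bij[OF h]] by blast+
      have ht: "h t \<in> pts n" using t WB_pts[OF h] by blast
      show ?thesis
      proof (cases "0 < h t")
        case True
        then show ?thesis using Wplus_pos[OF m y ht] e(1) by (simp add: sgn_if)
      next
        case False
        then have neg: "0 < h (- t)" using pts_nz[OF ht] WB_odd[OF h] by simp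
        have "h (- t) \<in> pts n" using t WB_pts[OF h] by simp
        then have "0 < h (x (- t))" using Wplus_pos[OF m y _ neg] e(2) by simp
        then have "h (x t) < 0" using WB_odd[OF h] WB_odd[OF xW] by simp
        then show ?thesis using neg WB_odd[OF h] by (simp add: sgn_if)
      qed
    qed
    have "sgn (h (p ! k)) = sgn (h (p ! 0))" if "k < length p" for k
      using that
    proof (induction k)
      case (Suc k)
      have "x (q ! k) = q ! Suc k" using signed_cycle_nth[OF sc[OF q(1)]] Suc.prems q(2) by simp
      then have xk: "\<bar>x (p ! k)\<bar> = p ! Suc k" using Suc.prems q(2) WB_abs'[OF xW] by simp
      have pk: "p ! k \<in> set p" using Suc.prems by simp
      have "0 < x (p ! k)" using Wplus_pos[OF l x pp[OF pk]] .
      then have "x (p ! k) = p ! Suc k" using xk by simp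
      then show ?case using step[OF pp[OF pk]] Suc by simp
    qed simp
    then show "sgn (h i) = sgn (h j)" using i j by (metis in_set_conv_nth)
  qed
qed

text \<open>Matching the cycles of \<open>x\<close> and \<open>y\<close> in order of length gives a
  conjugating element in W(B_n); since all cycles are even, \<open>even_cycles_WD\<close> places it
  in W(D_n).\<close>

lemma Wplus_conj_el:
  assumes l: "partition_of n l" "even_part l" and x: "x \<in> Wplus l" "cycle_decomp n x P []" "mset (map length P) = mset l"
    and y: "y \<in> Wplus l" "cycle_decomp n y Q []" "mset (map length Q) = mset l"
  shows "conj_el n x y"
proof -
  note WB = Wplus_WB[OF l]
  have ne: "[] \<notin> set P" "[] \<notin> set Q" using x(2) y(2) by (auto simp: cycle_decomp_def valid_def)
  obtain P' where P': "mset P = mset P'" "is_partition (map length P')" by (rule sort_pieces[OF ne(1)])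
  obtain Q' where Q': "mset Q = mset Q'" "is_partition (map length Q')" by (rule sort_pieces[OF ne(2)])
  have len: "map length P' = map length Q'"
    by (rule is_partition_unique[OF P'(2) Q'(2)]) (metis P'(1) Q'(1) mset_map x(3) y(3))
  have v: "valid n P'" "valid n Q'"
    using valid_perm[OF P'(1)] valid_perm[OF Q'(1)] x(2) y(2) by (auto simp: cycle_decomp_def)
  have sc: "signed_cycle x 1 p" if "p \<in> set P'" for p using x(2) that mset_eq_setD[OF P'(1)] by (auto simp: cycle_decomp_def)
  have sc': "signed_cycle y 1 q" if "q \<in> set Q'" for q using y(2) that mset_eq_setD[OF Q'(1)] by (auto simp: cycle_decomp_def)
  obtain g where g: "g \<in> WB n" "map (map g) P' = Q'" using WB_of_lists[OF v len] by blast
  have comm: "g (x t) = y (g t)" if p: "p \<in> set P'" "t \<in> set p" for p t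
  proof -
    have mx: "map x p = tl p @ [hd p]" and ne: "p \<noteq> []" using sc[OF p(1)] by (simp_all add: signed_cycle_def)
    have "map g p \<in> set Q'" using g(2) p(1) by auto
    then have "signed_cycle y 1 (map g p)" by (rule sc')
    then have "map y (map g p) = tl (map g p) @ [hd (map g p)]" unfolding signed_cycle_def by simp
    also have "\<dots> = map g (map x p)" using ne unfolding mx by (simp add: map_tl hd_map)
    finally show ?thesis using p(2) by (simp add: map_eq_conv)
  qed
  have "g (x t) = y (g t)" for t
  proof (cases "t \<in> pts n")
    case True
    then obtain p where "p \<in> set P'" "t \<in> set p \<or> - t \<in> set p" using valid_cover[OF v(1)] by blast
    then show ?thesis
      using comm[of p t] comm[of p "- t"] WB_odd[OF g(1)] WB_odd[OF WB[OF x(1)]] WB_odd[OF WB[OF y(1)]] by auto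
  next
    case False
    then show ?thesis using WB_out[OF g(1)] WB_out[OF WB[OF x(1)]] WB_out[OF WB[OF y(1)]] by simp
  qed
  then have "conj g x (g t) = y (g t)" for t using conj_apply[OF WB_bij[OF g(1)]] by simp
  then have gy: "conj g x = y" using bij_is_surj[OF WB_bij[OF g(1)]] by (metis surjE ext)
  have "even (length p)" if "p \<in> set P" for p
  proof -
    have "length p \<in> set l" using mset_eq_setD[OF x(3)] that by auto
    then show ?thesis using l(2) by (simp add: even_part_def)
  qed
  then have "g \<in> WD n" using even_cycles_WD[OF l l x(1,2) _ g(1)] gy y(1) by blast
  then show ?thesis using gy unfolding conj_el_def by blast
qed

text \<open>The argument of \<open>Wplus_not_conj_Wminus\<close>, with cycles in place of
  blocks.\<close>

lemma Wplus_Wminus_not_conj_el: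
  assumes n: "1 \<le> n" and l: "partition_of n l" "even_part l" and m: "partition_of n m" "even_part m"
    and x: "x \<in> Wplus l" "cycle_decomp n x P []" "mset (map length P) = mset l" and y: "y \<in> Wminus m"
  shows "\<not> conj_el n x y"
proof
  assume "conj_el n x y"
  then obtain f where f: "f \<in> WD n" "y = conj f x" by (auto simp: conj_el_def)
  obtain d where d: "d \<in> Wplus m" "y = conj tsign d" using y by (auto simp: Wminus_def)
  note t = tsign_WB[OF n]
  have "conj (tsign \<circ> f) x = conj tsign y" using f conj_conj WB_bij WD_WB t by metis
  also have "\<dots> = d" unfolding d(2) using conj_conj[OF WB_bij[OF t] WB_bij[OF t], of d] tsign_tsign by simp
  finally have "conj (tsign \<circ> f) x \<in> Wplus m" using d by simp
  moreover have "even (length p)" if "p \<in> set P" for p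
  proof -
    have "length p \<in> set l" using mset_eq_setD[OF x(3)] that by auto
    then show ?thesis using l(2) by (simp add: even_part_def)
  qed
  ultimately have tf: "tsign \<circ> f \<in> WD n"
    using even_cycles_WD[OF l m x(1,2) _ WB_comp[OF t WD_WB[OF f(1)]]] by blast
  have "(tsign \<circ> f) \<circ> inv f = tsign"
    using surj_iff[of f] bij_is_surj[OF WB_bij[OF WD_WB[OF f(1)]]] by (simp add: comp_assoc)
  then show False using WD_comp[OF tf WD_inv[OF f(1)]] tsign_not_WD[OF n] by simp
qed

section \<open>Coxeter elements of W^+ and W^-\<close>

lemma coxeter_cycles_parabolic:
  assumes "pieces n LA []" "coxeter_element n (piece_group LA []) c"
  obtains P where "c \<in> piece_group LA []" "cycle_decomp n c P []" "mset (map length P) = mset (map length LA)"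
proof -
  obtain P N where *: "c \<in> piece_group LA []" "cycle_decomp n c P N" "mset (map length P) = mset (map length LA)"
    "mset (map length N) = {#}"
    using coxeter_cycles_piece_group[OF assms] by (metis add_0 length_0_conv list.map_disc_iff list.size(3) mset.simps(1) replicate_mset_0)
  then show ?thesis using that by simp
qed

lemma coxeter_Wplus:
  assumes l: "partition_of n l" "even_part l" and c: "coxeter_element n (Wplus l) c"
  obtains P where "c \<in> Wplus l" "cycle_decomp n c P []" "mset (map length P) = mset l"
proof -
  have c': "coxeter_element n (piece_group (blists 0 l) []) c" using c by (simp add: Wplus_piece_group)
  obtain P where *: "c \<in> piece_group (blists 0 l) []" "cycle_decomp n c P []"
    "mset (map length P) = mset (map length (blists 0 l))"
    using even_blists(2)[OF l] c' by (rule coxeter_cycles_parabolic)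
  then show ?thesis using that[of P] by (simp only: Wplus_piece_group length_blists)
qed

lemma coxeter_Wminus:
  assumes n: "1 \<le> n" and l: "partition_of n l" "even_part l" and c: "coxeter_element n (Wminus l) c"
  obtains d P where "d \<in> Wplus l" "c = conj tsign d" "cycle_decomp n d P []" "mset (map length P) = mset l"
proof -
  note t = tsign_WB[OF n]
  let ?L = "map (map tsign) (blists 0 l)"
  have c': "coxeter_element n (piece_group ?L []) c" using c Wminus_piece_group(1)[OF n l] by simp
  obtain P where *: "c \<in> piece_group ?L []" "cycle_decomp n c P []" "mset (map length P) = mset (map length ?L)"
    using Wminus_piece_group(2)[OF n l] c' by (rule coxeter_cycles_parabolic)
  have "c \<in> Wminus l" using *(1) Wminus_piece_group(1)[OF n l] by simp
  then obtain d where d: "d \<in> Wplus l" "c = conj tsign d" by (auto simp: Wminus_def)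
  have "conj tsign c = d" unfolding d(2) using conj_conj[OF WB_bij[OF t] WB_bij[OF t], of d] tsign_tsign by simp
  then have "cycle_decomp n d (map (map tsign) P) []" using cycle_decomp_conj[OF t *(2)] by simp
  moreover have "map length (map (map tsign) M) = map length M" for M :: "int list list" by simp
  then have "mset (map length (map (map tsign) P)) = mset l" using *(3) by (simp only: length_blists)
  ultimately show ?thesis using that d by blast
qed

text \<open>The cycle type determines the orbit type: positive cycles give the type A blocks, half
  the number of negative cycles is the number of type D blocks, and removing as many cycles of
  length 1 leaves their sizes minus one. It remains to tell \<open>Wplus\<close> from
  \<open>Wminus\<close>, by conjugating Coxeter elements along with their subgroups.\<close>

lemma coxeter_conj_subgroups:
  assumes n: "1 \<le> n" and R: "refl_subgroup n R1" "refl_subgroup n R2"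
    and c: "coxeter_element n R1 c1" "coxeter_element n R2 c2" and conj: "conj_el n c1 c2"
  shows "conj_sub n R1 R2"
proof -
  obtain A1 D1 P1 N1 where 1: "pieces n A1 D1" "R1 = piece_group A1 D1" "c1 \<in> R1" "cycle_decomp n c1 P1 N1"
    "map length P1 = map length A1"
    "mset (map length N1) = mset (map (\<lambda>q. length q - 1) D1) + replicate_mset (length D1) 1"
    using c(1) by (rule coxeter_element_cycles)
  obtain A2 D2 P2 N2 where 2: "pieces n A2 D2" "R2 = piece_group A2 D2" "c2 \<in> R2" "cycle_decomp n c2 P2 N2"
    "map length P2 = map length A2"
    "mset (map length N2) = mset (map (\<lambda>q. length q - 1) D2) + replicate_mset (length D2) 1"
    using c(2) by (rule coxeter_element_cycles)
  obtain f where f: "f \<in> WD n" "c2 = conj f c1" using conj by (auto simp: conj_el_def)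
  have c1W: "c1 \<in> WB n" and c2W: "c2 \<in> WB n"
    using 1(1,2,3) 2(1,2,3) piece_group_WB[of n A1 D1 c1] piece_group_WB[of n A2 D2 c2] by (simp_all add: pieces_def)
  have ml: "map length (map (map f) M) = map length M" for M :: "int list list" by simp
  have "cycle_decomp n c2 (map (map f) P1) (map (map f) N1)" using cycle_decomp_conj[OF WD_WB[OF f(1)] 1(4)] f(2) by simp
  from cycle_type_cycle_decomp[OF c2W this] cycle_type_cycle_decomp[OF c2W 2(4)]
  have mP: "mset (map length P1) = mset (map length P2)" and mN: "mset (map length N1) = mset (map length N2)"
    by (simp_all only: ml prod.inject)
  have mA: "mset (map length A1) = mset (map length A2)" using mP 1(5) 2(5) by simp
  have mN': "mset (map (\<lambda>q. length q - 1) D1) + replicate_mset (length D1) 1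
    = mset (map (\<lambda>q. length q - 1) D2) + replicate_mset (length D2) 1" using mN 1(6) 2(6) by simp
  from arg_cong[OF this, of size] have lD: "length D1 = length D2" by simp
  then have m1: "mset (map (\<lambda>q. length q - 1) D1) = mset (map (\<lambda>q. length q - 1) D2)" using mN' by simp
  \<comment> \<open>Blocks are nonempty, so nothing is lost to truncation in
    \<open>length q - 1\<close>.\<close>
  have rec: "mset (map length D) = image_mset Suc (mset (map (\<lambda>q. length q - 1) D))" if "\<forall>q\<in>set D. 2 \<le> length q"
    for D :: "int list list"
    using that by (induction D) auto
  have mD: "mset (map length D1) = mset (map length D2)"
  proof -
    have "\<forall>q\<in>set D1. 2 \<le> length q" "\<forall>q\<in>set D2. 2 \<le> length q" using 1(1) 2(1) by (simp_all add: pieces_def)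
    then show ?thesis using rec[of D1] rec[of D2] m1 by (simp only:)
  qed
  obtain l1 l2 where l: "double_partition n (l1, l2)" "gt1 l2" "mset l1 = mset (map length A1)"
    "mset l2 = mset (map length D1)"
    "l2 \<noteq> [] \<or> \<not> even_part l1 \<Longrightarrow> conj_sub n (piece_group A1 D1) (Wlam (l1, l2))"
    "l2 = [] \<Longrightarrow> even_part l1 \<Longrightarrow> conj_sub n (piece_group A1 D1) (Wplus l1) \<or> conj_sub n (piece_group A1 D1) (Wminus l1)"
    using pieces_conj_sub[OF 1(1) n] by metis
  obtain k1 k2 where k: "double_partition n (k1, k2)" "gt1 k2" "mset k1 = mset (map length A2)"
    "mset k2 = mset (map length D2)"
    "k2 \<noteq> [] \<or> \<not> even_part k1 \<Longrightarrow> conj_sub n (piece_group A2 D2) (Wlam (k1, k2))"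
    "k2 = [] \<Longrightarrow> even_part k1 \<Longrightarrow> conj_sub n (piece_group A2 D2) (Wplus k1) \<or> conj_sub n (piece_group A2 D2) (Wminus k1)"
    using pieces_conj_sub[OF 2(1) n] by metis
  have kl: "k1 = l1" "k2 = l2"
    by (rule is_partition_unique; use l(1,3,4) k(1,3,4) mA mD in \<open>simp add: double_partition_def\<close>)+
  show ?thesis
  proof (cases "l2 \<noteq> [] \<or> \<not> even_part l1")
    case True
    then show ?thesis using l(5) k(5) kl 1(2) 2(2) conj_sub_sym conj_sub_trans by metis
  next
    case False
    then have ev: "l2 = []" "even_part l1" by auto
    then have part: "partition_of n l1" using l(1) partition_double by blast
    have D: "D1 = []" "D2 = []" using l(4) k(4) kl ev by simp_all
    have N: "N1 = []" "N2 = []" using 1(6) 2(6) D by simp_all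
    have P: "mset (map length P1) = mset l1" "mset (map length P2) = mset l1"
      using 1(5) 2(5) l(3) k(3) kl by simp_all
    \<comment> \<open>Otherwise an element of \<open>Wplus l1\<close> with even cycles would be
      conjugate to an element of \<open>Wminus l1\<close>.\<close>
    have no: False
      if a: "conj_sub n R (Wplus l1)" "conj_sub n R' (Wminus l1)" "c \<in> R" "c' \<in> R'" "cycle_decomp n c P []"
        "mset (map length P) = mset l1" "c \<in> WB n" "c' \<in> WB n" "conj_el n c c'" for R R' c c' P
    proof -
      obtain g where g: "g \<in> WD n" "Wplus l1 = conj g ` R" using a(1) by (auto simp: conj_sub_def)
      obtain h where h: "h \<in> WD n" "Wminus l1 = conj h ` R'" using a(2) by (auto simp: conj_sub_def)
      obtain e where e: "e \<in> WD n" "c' = conj e c" using a(9) by (auto simp: conj_el_def)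
      have 1: "conj g c \<in> Wplus l1" "conj h c' \<in> Wminus l1" using g h a(3,4) by auto
      have 2: "cycle_decomp n (conj g c) (map (map g) P) []" using cycle_decomp_conj[OF WD_WB[OF g(1)] a(5)] by simp
      have "map length (map (map g) P) = map length P" by simp
      then have 3: "mset (map length (map (map g) P)) = mset l1" using a(6) by (simp only:)
      have b: "bij g" "bij h" "bij e" using g h e WD_WB WB_bij by blast+
      have "conj h c' = conj (h \<circ> e) c" unfolding e(2) by (rule conj_conj[OF b(2,3)])
      also have "\<dots> = conj (h \<circ> e) (conj (inv g) (conj g c))" using conj_inv b by simp
      also have "\<dots> = conj (h \<circ> e \<circ> inv g) (conj g c)"
        using conj_conj[OF bij_comp[OF b(3,2)] bij_imp_bij_inv[OF b(1)]] .
      finally have "conj_el n (conj g c) (conj h c')"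
        unfolding conj_el_def using WD_comp[OF WD_comp[OF h(1) e(1)] WD_inv[OF g(1)]] by (rule bexI)
      then show False using Wplus_Wminus_not_conj_el[OF n part ev(2) part ev(2) 1(1) 2 3 1(2)] by blast
    qed
    have conj': "conj_el n c2 c1"
      using conj_inv[OF WB_bij[OF WD_WB[OF f(1)]], of c1] WD_inv[OF f(1)] unfolding conj_el_def f(2) by metis
    have "conj_sub n R1 (Wplus l1) \<or> conj_sub n R1 (Wminus l1)" "conj_sub n R2 (Wplus l1) \<or> conj_sub n R2 (Wminus l1)"
      using l(6) k(6) kl ev 1(2) 2(2) by auto
    moreover have "\<not> (conj_sub n R1 (Wplus l1) \<and> conj_sub n R2 (Wminus l1))"
      using no[of R1 R2 c1 c2 P1] 1(3,4) 2(3) N P c1W c2W conj by blast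
    moreover have "\<not> (conj_sub n R2 (Wplus l1) \<and> conj_sub n R1 (Wminus l1))"
      using no[of R2 R1 c2 c1 P2] 2(3,4) 1(3) N P c1W c2W conj' by blast
    ultimately have "conj_sub n R1 (Wplus l1) \<and> conj_sub n R2 (Wplus l1) \<or>
        conj_sub n R1 (Wminus l1) \<and> conj_sub n R2 (Wminus l1)" by argo
    then show ?thesis using conj_sub_sym[of n R2] conj_sub_trans[of n R1 _ R2] by blast
  qed
qed

text \<open>Coxeter elements with a negative cycle have one of length \<open>1\<close>, so two negative
  \<open>2\<close>-cycles are not attained.\<close>

lemma not_coxeter_class:
  assumes n: "4 \<le> n"
  shows "\<exists>w\<in>WD n. \<forall>R c. refl_subgroup n R \<and> coxeter_element n R c \<longrightarrow> \<not> conj_el n c w"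
proof -
  \<comment> \<open>Each factor is a negative 2-cycle, 1 to 2 to -1 and 3 to 4 to -3, with a single
    sign change. One of them lies outside W(D_n), the product of both inside, which takes four
    lines.\<close>
  let ?u = "tp 1 2 \<circ> flip {2}" and ?v = "tp 3 4 \<circ> flip {4}"
  let ?w = "?u \<circ> ?v"
  have odd: "tp i j \<circ> flip {j} \<in> WB n \<and> tp i j \<circ> flip {j} \<notin> WD n"
    if "1 \<le> i" "1 \<le> j" "i \<le> int n" "j \<le> int n" "i \<noteq> j" for i j
  proof -
    have t: "tp i j \<in> WD n" by (rule WD_tp) (use that in \<open>auto simp: pts_def\<close>)
    have fW: "flip {j} \<in> WB n" "flip {j} \<notin> WD n" using flip_WB[of "{j}" n] flip_WD[of "{j}" n] that by auto
    have "flip {j} = tp i j \<circ> (tp i j \<circ> flip {j})"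
      using tp_tp[of i j] that by (simp add: adm_def fun_eq_iff)
    then show ?thesis using WB_comp[OF WD_WB[OF t] fW(1)] WD_comp[OF t] fW(2) by metis
  qed
  have uv: "?u \<in> WB n" "?u \<notin> WD n" "?v \<in> WB n" "?v \<notin> WD n"
    using odd[of 1 2] odd[of 3 4] n by simp_all
  have w: "?w \<in> WD n" using WD_comp_odd uv by blast
  let ?P = "map (\<lambda>i. [i]) [5..int n]" and ?N = "[[1, 2], [3, 4]] :: int list list"
  have "valid n (?P @ ?N)"
  proof -
    have c: "concat (map (\<lambda>i. [i]) xs) = xs" for xs :: "int list" by (induction xs) auto
    have a: "map abs [5..int n] = [5..int n]" by (rule map_idI) auto
    have "abs ` {5..int n} = {5..int n}" by (auto simp: image_iff)
    then show ?thesis using n by (auto simp: valid_def c a)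
  qed
  moreover have "signed_cycle ?w 1 [i]" if "5 \<le> i" for i
    using that by (simp add: signed_cycle_def tp_def flip_def)
  moreover have "signed_cycle ?w (-1) [1, 2]" "signed_cycle ?w (-1) [3, 4]" by (simp_all add: signed_cycle_def tp_def flip_def)
  ultimately have dec: "cycle_decomp n ?w ?P ?N" by (auto simp: cycle_decomp_def)
  have "\<not> conj_el n c ?w" if c: "coxeter_element n R c" for R c
  proof
    assume "conj_el n c ?w"
    then obtain f where f: "f \<in> WD n" "?w = conj f c" unfolding conj_el_def by blast
    obtain P N and LD :: "int list list" where *: "cycle_decomp n c P N"
      "mset (map length N) = mset (map (\<lambda>q. length q - 1) LD) + replicate_mset (length LD) 1"
      by (rule coxeter_element_cycles[OF c])
    have "cycle_decomp n ?w (map (map f) P) (map (map f) N)"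
      unfolding f(2) by (rule cycle_decomp_conj[OF WD_WB[OF f(1)] *(1)])
    from trans[OF sym[OF cycle_type_cycle_decomp[OF WD_WB[OF w] this]] cycle_type_cycle_decomp[OF WD_WB[OF w] dec]]
    have "mset (map length (map (map f) N)) = {#2, 2#}" by (simp add: numeral_2_eq_2)
    moreover have "map length (map (map f) N) = map length N" by simp
    ultimately have e: "mset (map (\<lambda>q. length q - 1) LD) + replicate_mset (length LD) 1 = {#2, 2#}"
      using *(2) by (simp only:)
    then have "LD \<noteq> []" by auto
    then have "1 \<in># mset (map (\<lambda>q. length q - 1) LD) + replicate_mset (length LD) 1" by simp
    then show False unfolding e by simp
  qed
  then show ?thesis using w by blast
qed

theorem theorem3p3:
  fixes n :: nat
  assumes "4 \<le> n"
  shows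
   "(odd n \<longrightarrow>
       is_reps n {Wlam lam | lam. double_partition n lam \<and> gt1 (snd lam)})
  \<and> (even n \<longrightarrow>
       is_reps n ({Wlam lam | lam. double_partition n lam \<and> gt1 (snd lam) \<and>
                     (snd lam = [] \<longrightarrow> \<not> even_part (fst lam))}
                  \<union> {Wplus l | l. partition_of n l \<and> even_part l}
                  \<union> {Wminus l | l. partition_of n l \<and> even_part l}))
  \<and> (\<forall>l1 l2. double_partition n (l1, l2) \<and> gt1 l2 \<longrightarrow>
       conj_sub n (par_closure n (Wlam (l1, l2)))
         (Wlam (l1, if n - sum_list l1 = 0 then [] else [n - sum_list l1])))
  \<and> (\<forall>l. partition_of n l \<and> even_part l \<longrightarrow>
       par_closure n (Wplus l) = Wplus l \<and> par_closure n (Wminus l) = Wminus l)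
  \<and> (\<forall>l1 l2 c. double_partition n (l1, l2) \<and> gt1 l2 \<and> coxeter_element n (Wlam (l1, l2)) c \<longrightarrow>
       cycle_type n c = (mset l1, mset (map (\<lambda>x. x - 1) l2) + replicate_mset (length l2) 1))
  \<and> (\<forall>l. partition_of n l \<and> even_part l \<longrightarrow>
       (\<exists>c. coxeter_element n (Wplus l) c) \<and> (\<exists>c. coxeter_element n (Wminus l) c) \<and>
       (\<forall>c c'. coxeter_element n (Wplus l) c \<and> coxeter_element n (Wplus l) c' \<longrightarrow> conj_el n c c') \<and>
       (\<forall>c c'. coxeter_element n (Wminus l) c \<and> coxeter_element n (Wminus l) c' \<longrightarrow> conj_el n c c') \<and>
       (\<forall>c c'. coxeter_element n (Wplus l) c \<and> coxeter_element n (Wminus l) c' \<longrightarrow> \<not> conj_el n c c') \<and>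
       (\<forall>c. coxeter_element n (Wplus l) c \<or> coxeter_element n (Wminus l) c \<longrightarrow>
            cycle_type n c = (mset l, {#})))
  \<and> (\<forall>R1 R2 c1 c2. refl_subgroup n R1 \<and> refl_subgroup n R2 \<and>
       coxeter_element n R1 c1 \<and> coxeter_element n R2 c2 \<and> conj_el n c1 c2 \<longrightarrow> conj_sub n R1 R2)
  \<and> (\<exists>w \<in> WD n. \<forall>R c. refl_subgroup n R \<and> coxeter_element n R c \<longrightarrow> \<not> conj_el n c w)"
proof -
  have n: "1 \<le> n" using assms by simp
  note t = tsign_WB[OF n]
  have closure: "par_closure n (Wplus l) = Wplus l \<and> par_closure n (Wminus l) = Wminus l"
    if "partition_of n l" "even_part l" for l
    using par_closure_parabolic[OF even_blists(2)[OF that]] par_closure_parabolic[OF Wminus_piece_group(2)[OF n that]]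
      Wminus_piece_group(1)[OF n that] by (simp add: Wplus_piece_group)
  have even: "(\<exists>c. coxeter_element n (Wplus l) c) \<and> (\<exists>c. coxeter_element n (Wminus l) c) \<and>
       (\<forall>c c'. coxeter_element n (Wplus l) c \<and> coxeter_element n (Wplus l) c' \<longrightarrow> conj_el n c c') \<and>
       (\<forall>c c'. coxeter_element n (Wminus l) c \<and> coxeter_element n (Wminus l) c' \<longrightarrow> conj_el n c c') \<and>
       (\<forall>c c'. coxeter_element n (Wplus l) c \<and> coxeter_element n (Wminus l) c' \<longrightarrow> \<not> conj_el n c c') \<and>
       (\<forall>c. coxeter_element n (Wplus l) c \<or> coxeter_element n (Wminus l) c \<longrightarrow>
            cycle_type n c = (mset l, {#}))" if l: "partition_of n l" "even_part l" for l
  proof (intro conjI allI impI)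
    obtain S where S: "coxeter_gen_set n (Wplus l) S" using Wplus_coxeter_gen_set[OF l] by blast
    then show "\<exists>c. coxeter_element n (Wplus l) c" by (rule coxeter_element_ex)
    show "\<exists>c. coxeter_element n (Wminus l) c"
      using coxeter_element_ex[OF coxeter_gen_set_conj[OF S t]] by (simp add: Wminus_def)
  next
    fix c c' assume "coxeter_element n (Wplus l) c \<and> coxeter_element n (Wplus l) c'"
    then show "conj_el n c c'" using coxeter_Wplus[OF l] Wplus_conj_el[OF l] by metis
  next
    fix c c' assume cc: "coxeter_element n (Wminus l) c \<and> coxeter_element n (Wminus l) c'"
    obtain d P where d: "d \<in> Wplus l" "c = conj tsign d" "cycle_decomp n d P []" "mset (map length P) = mset l"
      using coxeter_Wminus[OF n l] cc by metis
    obtain d' P' where d': "d' \<in> Wplus l" "c' = conj tsign d'" "cycle_decomp n d' P' []" "mset (map length P') = mset l"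
      using coxeter_Wminus[OF n l] cc by metis
    obtain g where g: "g \<in> WD n" "d' = conj g d"
      using Wplus_conj_el[OF l d(1,3,4) d'(1,3,4)] by (auto simp: conj_el_def)
    \<comment> \<open>The conjugator of the untwisted elements is twisted by \<open>tsign\<close> as
      well; the two odd factors cancel in \<open>eps\<close>.\<close>
    let ?h = "tsign \<circ> g \<circ> tsign"
    have b: "bij tsign" "bij g" using t g WD_WB WB_bij by blast+
    have "eps n tsign * eps n tsign = 1" using eps_comp[OF t t] tsign_tsign eps_id by metis
    then have "?h \<in> WD n"
      using g t WB_comp WD_WB by (simp add: WD_eps eps_comp algebra_simps)
    moreover have "c' = conj ?h c"
      unfolding d(2) d'(2) g(2) using conj_conj b bij_comp tsign_tsign by (metis comp_assoc comp_id)
    ultimately show "conj_el n c c'" unfolding conj_el_def by blast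
  next
    fix c c' assume cc: "coxeter_element n (Wplus l) c \<and> coxeter_element n (Wminus l) c'"
    obtain P where P: "c \<in> Wplus l" "cycle_decomp n c P []" "mset (map length P) = mset l"
      using coxeter_Wplus[OF l] cc by metis
    obtain d where "d \<in> Wplus l" "c' = conj tsign d" using coxeter_Wminus[OF n l] cc by metis
    then have "c' \<in> Wminus l" by (simp add: Wminus_def)
    then show "\<not> conj_el n c c'" using Wplus_Wminus_not_conj_el[OF n l l P] by blast
  next
    fix c assume "coxeter_element n (Wplus l) c \<or> coxeter_element n (Wminus l) c"
    then show "cycle_type n c = (mset l, {#})"
    proof
      assume "coxeter_element n (Wplus l) c"
      then show ?thesis using cycle_type_coxeter_Wlam[of n l "[]" c] l partition_double by (simp add: Wplus_Wlam)
    next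
      assume c: "coxeter_element n (Wminus l) c"
      obtain d P where d: "d \<in> Wplus l" "c = conj tsign d" "cycle_decomp n d P []" "mset (map length P) = mset l"
        using coxeter_Wminus[OF n l c] .
      have "d \<in> WB n" using Wplus_WB[OF l d(1)] .
      then have "c \<in> WB n" using d(2) WB_conj[OF t] by simp
      moreover have "cycle_decomp n c (map (map tsign) P) []" using cycle_decomp_conj[OF t d(3)] d(2) by simp
      moreover have "map length (map (map tsign) P) = map length P" by simp
      ultimately show ?thesis using cycle_type_cycle_decomp d(4) by (metis list.map(1) mset.simps(1))
    qed
  qed
  have closure_lam: "\<forall>l1 l2. double_partition n (l1, l2) \<and> gt1 l2 \<longrightarrow>
       conj_sub n (par_closure n (Wlam (l1, l2)))
         (Wlam (l1, if n - sum_list l1 = 0 then [] else [n - sum_list l1]))"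
    using par_closure_Wlam[of n] conj_sub_refl[of n] by simp
  have type_lam: "\<forall>l1 l2 c. double_partition n (l1, l2) \<and> gt1 l2 \<and> coxeter_element n (Wlam (l1, l2)) c \<longrightarrow>
       cycle_type n c = (mset l1, mset (map (\<lambda>x. x - 1) l2) + replicate_mset (length l2) 1)"
    using cycle_type_coxeter_Wlam by blast
  have injective: "\<forall>R1 R2 c1 c2. refl_subgroup n R1 \<and> refl_subgroup n R2 \<and>
       coxeter_element n R1 c1 \<and> coxeter_element n R2 c2 \<and> conj_el n c1 c2 \<longrightarrow> conj_sub n R1 R2"
    using coxeter_conj_subgroups[OF n] by blast
  show ?thesis
    by (intro conjI[OF impI conjI[OF impI]] is_reps_odd[OF n] is_reps_even[OF n] conjI[OF closure_lam]
        conjI[OF _ conjI[OF type_lam]] conjI[OF _ conjI[OF injective not_coxeter_class[OF assms]]])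
      (use closure even in \<open>blast+\<close>)
qed

end
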